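(* Let $\alpha>\beta>1$, let $p,q$ be relatively prime positive integers, and set $\rho=p/q$. Let $\Omega_0$, $u_0$, $A$, and (for each $\tau_0\in\mathbb{R}$) the sequences $\varepsilon_k(\tau_0)$, $\mathfrak{D}_k(\tau_0)=A\,\varepsilon_k(\tau_0)$ and $u_k(\tau)=u_k(\tau;\tau_0)$, $k\ge 1$, be defined as in the context. Then there is $\mu_0>0$ (depending on $\rho,\alpha,\beta$) such that for all real $\mu$ with $|\mu|<\mu_0$ the following hold. (1) For every $\tau_0\in\mathbb{R}$ the series $\mathfrak{D}(\tau_0,\mu):=\frac1A\sum_{k\ge1}\mu^k\mathfrak{D}_k(\tau_0)$ and $u(\tau)=u_0(\tau)+\sum_{k\ge1}\mu^k u_k(\tau;\tau_0)$ converge, and $u$ is a $2\pi p$-periodic solution of $$\ddot u+\tfrac1\omega h(u)\dot u+\tfrac1{\omega^2}k(u)+\mu\Big[\tfrac1\omega\dot u(3u^2-1)\sin(\tau+\tau_0)+\tfrac1{\omega^2}(u^3-u)\sin(\tau+\tau_0)+\tfrac1\omega(u^3-u)\cos(\tau+\tau_0)\Big]=0$$ with $\frac1\omega=\frac1{\rho\Omega_0}+\mathfrak{D}(\tau_0,\mu)$. (2) Put $\varepsilon_{\max}(\rho)=\max_{0\le\tau_0\le2\pi}\mathfrak{D}(\tau_0,\mu)$, $\varepsilon_{\min}(\rho)=\min_{0\le\tau_0\le2\pi}\mathfrak{D}(\tau_0,\mu)$ and $$\omega_{\min}(\rho)=\frac{\rho\Omega_0}{1+\rho\Omega_0\,\varepsilon_{\max}(\rho)},\qquad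 \omega_{\max}(\rho)=\frac{\rho\Omega_0}{1+\rho\Omega_0\,\varepsilon_{\min}(\rho)}.$$ For every $\omega$ with $\omega_{\min}(\rho)\le\omega\le\omega_{\max}(\rho)$ there is $\tau_0\in[0,2\pi]$ such that the equation displayed in (1) has a periodic solution of period $2\pi p$. (3) The width $\Delta\omega(\rho)=\omega_{\max}(\rho)-\omega_{\min}(\rho)$ of the locking interval satisfies, as $\mu\to0$, $$\Delta\omega(p/q)=O(\mu^{q})\ \text{ if } p \text{ is even},\qquad \Delta\omega(p/q)=O(\mu^{2q})\ \text{ if } p \text{ is odd}.$$
   Context: Let $h(u)=1-\beta+3\beta u^2$ and $k(u)=(\alpha-\beta)u+\beta u^3$ with $\alpha>\beta>1$. It is known that $u''+h(u)u'+k(u)=0$ has exactly one limit cycle; let $T_0$ be its period and $\Omega_0=2\pi/T_0$. For $\rho=p/q$ put $f(u)=\frac{1}{\rho\Omega_0}h(u)$ and $g(u)=\frac{1}{\rho^2\Omega_0^2}k(u)$. Dots denote $d/d\tau$. Let $u_0(\tau)$ be the solution of $\ddot u+f(u)\dot u+g(u)=0$ that runs on the limit cycle, with period $2\pi\rho$ and with $\dot u_0(0)=0$, $u_0(0)>0$. The displayed equation in the claim is the injection-locked frequency divider equation $$u''+(1-\beta+3\beta u^2)u'+(\alpha-\beta)u+\beta u^3+\mu\big[u'(3u^2-1)\sin\omega t+(u^3-u)\sin\omega t+\omega(u^3-u)\cos\omega t\big]=0$$ in the rescaled time $\tau=\omega t$, with the phase of the driving term shifted by $\tau_0$; a $2\pi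 p$-periodic solution in $\tau$ corresponds to a $2\pi p/\omega$-periodic solution in $t$. Let $W(\tau)=\begin{pmatrix} w_{11} & w_{12} \\ w_{21} & w_{22} \end{pmatrix}$ be the fundamental matrix, with $W(0)=\mathbb{1}$, of the linearization at $(u_0,\dot u_0)$ of the system $\dot u=v$, $\dot v=-f(u)v-g(u)$. Put $f_0=\frac1{2\pi\rho}\int_0^{2\pi\rho}f(u_0(\tau))\,d\tau$ (known to be $>0$) and $\tilde F(\tau)=\int_0^\tau(f(u_0(\tau'))-f_0)\,d\tau'$. One has $w_{11}(\tau)=a(\tau)+e^{-f_0\tau}b(\tau)$ with $a,b$ (uniquely determined) $2\pi\rho$-periodic functions. Denote by $\langle\cdot\rangle$ the average of a periodic function over a period. Define $$A=\Big\langle e^{\tilde F}b\Big[\dot u_0\,h(u_0)+\tfrac{2}{\rho\Omega_0}k(u_0)\Big]\Big\rangle,$$ which is nonzero. Recursive definition of $\varepsilon_k,\mathfrak{D}_k,u_k$ for fixed $\tau_0$: for a number $\lambda$ and a function $u$ write $$E(u,\lambda,\mu)=\ddot u+\lambda h(u)\dot u+\lambda^2k(u)+\mu\big[\lambda\dot u(3u^2-1)\sin(\tau+\tau_0)+\lambda^2(u^3-u)\sin(\tau+\tau_0)+\lambda(u^3-u)\cos(\tau+\tau_0)\big].$$ Given $\varepsilon_j,u_j$ for $1\le j<k$, let $\Xi_k(\tau;\tau_0)$ be the coefficient of $\mu^k$ in $E\big(\sum_{j=0}^{k-1}\mu^ju_j,\ \frac1{\rho\Omega_0}+\sum_{j=1}^{k-1}\mu^j\varepsilon_j,\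 \mu\big)$. Set $\mathfrak{D}_k(\tau_0)=-\langle e^{\tilde F}b\,\Xi_k(\cdot;\tau_0)\rangle$ (average over $[0,2\pi p]$) and $\varepsilon_k(\tau_0)=\mathfrak{D}_k(\tau_0)/A$. Let $u_k$ be the unique $2\pi p$-periodic solution, with $\dot u_k(0)=0$, of $$\ddot u_k+f(u_0)\dot u_k+\big(f'(u_0)\dot u_0+g'(u_0)\big)u_k+\varepsilon_k\Big[h(u_0)\dot u_0+\tfrac{2}{\rho\Omega_0}k(u_0)\Big]+\Xi_k(\tau;\tau_0)=0 .$$ *)

theory Defs
  imports
    "HOL-Analysis.Analysis"
    "HOL-Computational_Algebra.Polynomial"
    "HOL-Library.Landau_Symbols"
    "HOL-Library.Periodic_Fun"
begin

(* The right-hand sides are stated over an arbitrary commutative ring, so that they can be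
   evaluated both at real numbers and at polynomials in the perturbation parameter. *)

definition h_fun :: "'a::comm_ring_1 \<Rightarrow> 'a \<Rightarrow> 'a" where
  "h_fun \<beta> u = 1 - \<beta> + 3 * \<beta> * u^2"

definition k_fun :: "'a::comm_ring_1 \<Rightarrow> 'a \<Rightarrow> 'a \<Rightarrow> 'a" where
  "k_fun \<alpha> \<beta> u = (\<alpha> - \<beta>) * u + \<beta> * u^3"

(* S, C are the values of sin and cos at the shifted phase; du, ddu the values of the first and
   second derivative; l is the value of 1/omega. *)
definition E_expr ::
  "'a::comm_ring_1 \<Rightarrow> 'a \<Rightarrow> 'a \<Rightarrow> 'a \<Rightarrow> 'a \<Rightarrow> 'a \<Rightarrow> 'a \<Rightarrow> 'a \<Rightarrow> 'a \<Rightarrow> 'a" where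
  "E_expr \<alpha> \<beta> S C u du ddu l \<mu> =
     ddu + l * h_fun \<beta> u * du + l^2 * k_fun \<alpha> \<beta> u
     + \<mu> * (l * du * (3 * u^2 - 1) * S + l^2 * (u^3 - u) * S + l * (u^3 - u) * C)"

definition f_fun :: "real \<Rightarrow> real \<Rightarrow> real \<Rightarrow> real \<Rightarrow> real" where
  "f_fun \<beta> \<rho> \<Omega>\<^sub>0 u = 1 / (\<rho> * \<Omega>\<^sub>0) * h_fun \<beta> u"

definition g_fun :: "real \<Rightarrow> real \<Rightarrow> real \<Rightarrow> real \<Rightarrow> real \<Rightarrow> real" where
  "g_fun \<alpha> \<beta> \<rho> \<Omega>\<^sub>0 u = 1 / (\<rho>^2 * \<Omega>\<^sub>0^2) * k_fun \<alpha> \<beta> u"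

(* Classical global solutions of the second-order equation F(t, x, x', x'') = 0. *)
definition solves_ode2 ::
  "(real \<Rightarrow> real \<Rightarrow> real \<Rightarrow> real \<Rightarrow> real) \<Rightarrow> (real \<Rightarrow> real) \<Rightarrow> bool" where
  "solves_ode2 F x \<longleftrightarrow>
     (\<forall>t. x differentiable (at t) \<and> deriv x differentiable (at t) \<and>
          F t (x t) (deriv x t) (deriv (deriv x) t) = 0)"

(* C is a closed orbit, in the (u, u')-plane, of u'' + h(u) u' + k(u) = 0, with minimal period T.
   Requiring a positive minimal period excludes equilibria. *)
definition closed_orbit :: "real \<Rightarrow> real \<Rightarrow> real \<Rightarrow> (real \<times> real) set \<Rightarrow> bool" where
  "closed_orbit \<alpha> \<beta> T C \<longleftrightarrow>
     (\<exists>x. solves_ode2 (\<lambda>t u du ddu. ddu + h_fun \<beta> u * du + k_fun \<alpha> \<beta> u) x \<and>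
          T > 0 \<and> periodic_fun_simple x T \<and>
          (\<forall>s. 0 < s \<and> s < T \<longrightarrow> \<not> periodic_fun_simple x s) \<and>
          C = range (\<lambda>t. (x t, deriv x t)))"

(* A limit cycle is an isolated closed orbit. *)
definition limit_cycle :: "real \<Rightarrow> real \<Rightarrow> real \<Rightarrow> (real \<times> real) set \<Rightarrow> bool" where
  "limit_cycle \<alpha> \<beta> T C \<longleftrightarrow>
     closed_orbit \<alpha> \<beta> T C \<and>
     (\<exists>N. open N \<and> C \<subseteq> N \<and> (\<forall>T' C'. closed_orbit \<alpha> \<beta> T' C' \<and> C' \<subseteq> N \<longrightarrow> C' = C))"

(* Jacobian matrix of (u, v) |-> (v, - f(u) v - g(u)) along (u0, u0'). *)
definition linearization ::
  "real \<Rightarrow> real \<Rightarrow> real \<Rightarrow> real \<Rightarrow> (real \<Rightarrow> real) \<Rightarrow> real \<Rightarrow> real^2^2" where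
  "linearization \<alpha> \<beta> \<rho> \<Omega>\<^sub>0 u\<^sub>0 \<tau> =
     vector [vector [0, 1],
             vector [- (deriv (f_fun \<beta> \<rho> \<Omega>\<^sub>0) (u\<^sub>0 \<tau>) * deriv u\<^sub>0 \<tau>
                        + deriv (g_fun \<alpha> \<beta> \<rho> \<Omega>\<^sub>0) (u\<^sub>0 \<tau>)),
                     - f_fun \<beta> \<rho> \<Omega>\<^sub>0 (u\<^sub>0 \<tau>)]]"

definition fundamental_matrix :: "(real \<Rightarrow> real^2^2) \<Rightarrow> (real \<Rightarrow> real^2^2) \<Rightarrow> bool" where
  "fundamental_matrix J W \<longleftrightarrow>
     W 0 = mat 1 \<and> (\<forall>\<tau>. (W has_vector_derivative (J \<tau> ** W \<tau>)) (at \<tau>))"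

definition average :: "real \<Rightarrow> (real \<Rightarrow> real) \<Rightarrow> real" where
  "average P x = 1 / P * integral {0..P} x"

definition f_mean :: "real \<Rightarrow> real \<Rightarrow> real \<Rightarrow> (real \<Rightarrow> real) \<Rightarrow> real" where
  "f_mean \<beta> \<rho> \<Omega>\<^sub>0 u\<^sub>0 = average (2 * pi * \<rho>) (\<lambda>\<tau>. f_fun \<beta> \<rho> \<Omega>\<^sub>0 (u\<^sub>0 \<tau>))"

(* One of the two intervals is empty or a point, so this is the oriented integral from 0 to tau. *)
definition F_tilde :: "real \<Rightarrow> real \<Rightarrow> real \<Rightarrow> (real \<Rightarrow> real) \<Rightarrow> real \<Rightarrow> real" where
  "F_tilde \<beta> \<rho> \<Omega>\<^sub>0 u\<^sub>0 \<tau> =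
     integral {0..\<tau>} (\<lambda>s. f_fun \<beta> \<rho> \<Omega>\<^sub>0 (u\<^sub>0 s) - f_mean \<beta> \<rho> \<Omega>\<^sub>0 u\<^sub>0)
     - integral {\<tau>..0} (\<lambda>s. f_fun \<beta> \<rho> \<Omega>\<^sub>0 (u\<^sub>0 s) - f_mean \<beta> \<rho> \<Omega>\<^sub>0 u\<^sub>0)"

definition b_fun ::
  "real \<Rightarrow> real \<Rightarrow> real \<Rightarrow> (real \<Rightarrow> real) \<Rightarrow> (real \<Rightarrow> real^2^2) \<Rightarrow> real \<Rightarrow> real" where
  "b_fun \<beta> \<rho> \<Omega>\<^sub>0 u\<^sub>0 W =
     (THE b. periodic_fun_simple b (2 * pi * \<rho>) \<and>
        (\<exists>a. periodic_fun_simple a (2 * pi * \<rho>) \<and>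
             (\<forall>\<tau>. W \<tau> $ 1 $ 1 = a \<tau> + exp (- f_mean \<beta> \<rho> \<Omega>\<^sub>0 u\<^sub>0 * \<tau>) * b \<tau>)))"

definition weight ::
  "real \<Rightarrow> real \<Rightarrow> real \<Rightarrow> (real \<Rightarrow> real) \<Rightarrow> (real \<Rightarrow> real^2^2) \<Rightarrow> real \<Rightarrow> real" where
  "weight \<beta> \<rho> \<Omega>\<^sub>0 u\<^sub>0 W \<tau> = exp (F_tilde \<beta> \<rho> \<Omega>\<^sub>0 u\<^sub>0 \<tau>) * b_fun \<beta> \<rho> \<Omega>\<^sub>0 u\<^sub>0 W \<tau>"

definition A_const ::
  "real \<Rightarrow> real \<Rightarrow> real \<Rightarrow> real \<Rightarrow> (real \<Rightarrow> real) \<Rightarrow> (real \<Rightarrow> real^2^2) \<Rightarrow> real" where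
  "A_const \<alpha> \<beta> \<rho> \<Omega>\<^sub>0 u\<^sub>0 W =
     average (2 * pi * \<rho>) (\<lambda>\<tau>. weight \<beta> \<rho> \<Omega>\<^sub>0 u\<^sub>0 W \<tau> *
       (deriv u\<^sub>0 \<tau> * h_fun \<beta> (u\<^sub>0 \<tau>) + 2 / (\<rho> * \<Omega>\<^sub>0) * k_fun \<alpha> \<beta> (u\<^sub>0 \<tau>)))"

(* A list L of length k holds the pairs (eps_j, u_j) for j < k, with eps_0 = 1 / (rho Omega_0).
   Xi is the coefficient of mu^k in E(sum mu^j u_j, sum mu^j eps_j, mu); it is computed in the
   polynomial ring, with [:0, 1:] in the role of mu. *)
definition Xi ::
  "real \<Rightarrow> real \<Rightarrow> real \<Rightarrow> (real \<times> (real \<Rightarrow> real)) list \<Rightarrow> real \<Rightarrow> real" where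
  "Xi \<alpha> \<beta> \<tau>\<^sub>0 L \<tau> =
     coeff (E_expr [:\<alpha>:] [:\<beta>:] [:sin (\<tau> + \<tau>\<^sub>0):] [:cos (\<tau> + \<tau>\<^sub>0):]
              (Poly (map (\<lambda>(e, u). u \<tau>) L))
              (Poly (map (\<lambda>(e, u). deriv u \<tau>) L))
              (Poly (map (\<lambda>(e, u). deriv (deriv u) \<tau>) L))
              (Poly (map fst L))
              [:0, 1:])
           (length L)"

definition D_of ::
  "real \<Rightarrow> real \<Rightarrow> nat \<Rightarrow> real \<Rightarrow> real \<Rightarrow> (real \<Rightarrow> real) \<Rightarrow> (real \<Rightarrow> real^2^2) \<Rightarrow>
   real \<Rightarrow> (real \<times> (real \<Rightarrow> real)) list \<Rightarrow> real" where
  "D_of \<alpha> \<beta> p \<rho> \<Omega>\<^sub>0 u\<^sub>0 W \<tau>\<^sub>0 L =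
     - average (2 * pi * real p) (\<lambda>\<tau>. weight \<beta> \<rho> \<Omega>\<^sub>0 u\<^sub>0 W \<tau> * Xi \<alpha> \<beta> \<tau>\<^sub>0 L \<tau>)"

definition eps_of ::
  "real \<Rightarrow> real \<Rightarrow> nat \<Rightarrow> real \<Rightarrow> real \<Rightarrow> (real \<Rightarrow> real) \<Rightarrow> (real \<Rightarrow> real^2^2) \<Rightarrow>
   real \<Rightarrow> (real \<times> (real \<Rightarrow> real)) list \<Rightarrow> real" where
  "eps_of \<alpha> \<beta> p \<rho> \<Omega>\<^sub>0 u\<^sub>0 W \<tau>\<^sub>0 L =
     D_of \<alpha> \<beta> p \<rho> \<Omega>\<^sub>0 u\<^sub>0 W \<tau>\<^sub>0 L / A_const \<alpha> \<beta> \<rho> \<Omega>\<^sub>0 u\<^sub>0 W"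

definition u_of ::
  "real \<Rightarrow> real \<Rightarrow> nat \<Rightarrow> real \<Rightarrow> real \<Rightarrow> (real \<Rightarrow> real) \<Rightarrow> (real \<Rightarrow> real^2^2) \<Rightarrow>
   real \<Rightarrow> (real \<times> (real \<Rightarrow> real)) list \<Rightarrow> real \<Rightarrow> real" where
  "u_of \<alpha> \<beta> p \<rho> \<Omega>\<^sub>0 u\<^sub>0 W \<tau>\<^sub>0 L =
     (THE w. periodic_fun_simple w (2 * pi * real p) \<and> deriv w 0 = 0 \<and>
        solves_ode2 (\<lambda>\<tau> x dx ddx.
          ddx + f_fun \<beta> \<rho> \<Omega>\<^sub>0 (u\<^sub>0 \<tau>) * dx
          + (deriv (f_fun \<beta> \<rho> \<Omega>\<^sub>0) (u\<^sub>0 \<tau>) * deriv u\<^sub>0 \<tau>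
             + deriv (g_fun \<alpha> \<beta> \<rho> \<Omega>\<^sub>0) (u\<^sub>0 \<tau>)) * x
          + eps_of \<alpha> \<beta> p \<rho> \<Omega>\<^sub>0 u\<^sub>0 W \<tau>\<^sub>0 L *
            (h_fun \<beta> (u\<^sub>0 \<tau>) * deriv u\<^sub>0 \<tau> + 2 / (\<rho> * \<Omega>\<^sub>0) * k_fun \<alpha> \<beta> (u\<^sub>0 \<tau>))
          + Xi \<alpha> \<beta> \<tau>\<^sub>0 L \<tau>) w)"

(* prefix_list ... n is the list of the pairs (eps_j, u_j) with j <= n. *)
primrec prefix_list ::
  "real \<Rightarrow> real \<Rightarrow> nat \<Rightarrow> real \<Rightarrow> real \<Rightarrow> (real \<Rightarrow> real) \<Rightarrow> (real \<Rightarrow> real^2^2) \<Rightarrow>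
   real \<Rightarrow> nat \<Rightarrow> (real \<times> (real \<Rightarrow> real)) list" where
  "prefix_list \<alpha> \<beta> p \<rho> \<Omega>\<^sub>0 u\<^sub>0 W \<tau>\<^sub>0 0 = [(1 / (\<rho> * \<Omega>\<^sub>0), u\<^sub>0)]"
| "prefix_list \<alpha> \<beta> p \<rho> \<Omega>\<^sub>0 u\<^sub>0 W \<tau>\<^sub>0 (Suc n) =
     (let L = prefix_list \<alpha> \<beta> p \<rho> \<Omega>\<^sub>0 u\<^sub>0 W \<tau>\<^sub>0 n
      in L @ [(eps_of \<alpha> \<beta> p \<rho> \<Omega>\<^sub>0 u\<^sub>0 W \<tau>\<^sub>0 L, u_of \<alpha> \<beta> p \<rho> \<Omega>\<^sub>0 u\<^sub>0 W \<tau>\<^sub>0 L)])"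

(* D_coeff and u_coeff are the paper's sequences for indices k >= 1. *)
definition D_coeff ::
  "real \<Rightarrow> real \<Rightarrow> nat \<Rightarrow> real \<Rightarrow> real \<Rightarrow> (real \<Rightarrow> real) \<Rightarrow> (real \<Rightarrow> real^2^2) \<Rightarrow>
   nat \<Rightarrow> real \<Rightarrow> real" where
  "D_coeff \<alpha> \<beta> p \<rho> \<Omega>\<^sub>0 u\<^sub>0 W k \<tau>\<^sub>0 =
     D_of \<alpha> \<beta> p \<rho> \<Omega>\<^sub>0 u\<^sub>0 W \<tau>\<^sub>0 (prefix_list \<alpha> \<beta> p \<rho> \<Omega>\<^sub>0 u\<^sub>0 W \<tau>\<^sub>0 (k - 1))"

definition u_coeff ::
  "real \<Rightarrow> real \<Rightarrow> nat \<Rightarrow> real \<Rightarrow> real \<Rightarrow> (real \<Rightarrow> real) \<Rightarrow> (real \<Rightarrow> real^2^2) \<Rightarrow>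
   nat \<Rightarrow> real \<Rightarrow> real \<Rightarrow> real" where
  "u_coeff \<alpha> \<beta> p \<rho> \<Omega>\<^sub>0 u\<^sub>0 W k \<tau>\<^sub>0 =
     u_of \<alpha> \<beta> p \<rho> \<Omega>\<^sub>0 u\<^sub>0 W \<tau>\<^sub>0 (prefix_list \<alpha> \<beta> p \<rho> \<Omega>\<^sub>0 u\<^sub>0 W \<tau>\<^sub>0 (k - 1))"

(* Sums over k >= 1 are written as sums over all k with Suc k as index. *)
definition D_series ::
  "real \<Rightarrow> real \<Rightarrow> nat \<Rightarrow> real \<Rightarrow> real \<Rightarrow> (real \<Rightarrow> real) \<Rightarrow> (real \<Rightarrow> real^2^2) \<Rightarrow>
   real \<Rightarrow> real \<Rightarrow> real" where
  "D_series \<alpha> \<beta> p \<rho> \<Omega>\<^sub>0 u\<^sub>0 W \<tau>\<^sub>0 \<mu> =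
     1 / A_const \<alpha> \<beta> \<rho> \<Omega>\<^sub>0 u\<^sub>0 W *
     (\<Sum>k. \<mu> ^ Suc k * D_coeff \<alpha> \<beta> p \<rho> \<Omega>\<^sub>0 u\<^sub>0 W (Suc k) \<tau>\<^sub>0)"

definition u_series ::
  "real \<Rightarrow> real \<Rightarrow> nat \<Rightarrow> real \<Rightarrow> real \<Rightarrow> (real \<Rightarrow> real) \<Rightarrow> (real \<Rightarrow> real^2^2) \<Rightarrow>
   real \<Rightarrow> real \<Rightarrow> real \<Rightarrow> real" where
  "u_series \<alpha> \<beta> p \<rho> \<Omega>\<^sub>0 u\<^sub>0 W \<tau>\<^sub>0 \<mu> \<tau> =
     u\<^sub>0 \<tau> + (\<Sum>k. \<mu> ^ Suc k * u_coeff \<alpha> \<beta> p \<rho> \<Omega>\<^sub>0 u\<^sub>0 W (Suc k) \<tau>\<^sub>0 \<tau>)"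

definition solves_driven ::
  "real \<Rightarrow> real \<Rightarrow> real \<Rightarrow> real \<Rightarrow> real \<Rightarrow> (real \<Rightarrow> real) \<Rightarrow> bool" where
  "solves_driven \<alpha> \<beta> \<tau>\<^sub>0 \<omega> \<mu> u \<longleftrightarrow>
     solves_ode2 (\<lambda>\<tau> x dx ddx.
       E_expr \<alpha> \<beta> (sin (\<tau> + \<tau>\<^sub>0)) (cos (\<tau> + \<tau>\<^sub>0)) x dx ddx (1 / \<omega>) \<mu>) u"

definition eps_max ::
  "real \<Rightarrow> real \<Rightarrow> nat \<Rightarrow> real \<Rightarrow> real \<Rightarrow> (real \<Rightarrow> real) \<Rightarrow> (real \<Rightarrow> real^2^2) \<Rightarrow> real \<Rightarrow> real" where
  "eps_max \<alpha> \<beta> p \<rho> \<Omega>\<^sub>0 u\<^sub>0 W \<mu> =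
     (GREATEST e. e \<in> (\<lambda>\<tau>\<^sub>0. D_series \<alpha> \<beta> p \<rho> \<Omega>\<^sub>0 u\<^sub>0 W \<tau>\<^sub>0 \<mu>) ` {0..2 * pi})"

definition eps_min ::
  "real \<Rightarrow> real \<Rightarrow> nat \<Rightarrow> real \<Rightarrow> real \<Rightarrow> (real \<Rightarrow> real) \<Rightarrow> (real \<Rightarrow> real^2^2) \<Rightarrow> real \<Rightarrow> real" where
  "eps_min \<alpha> \<beta> p \<rho> \<Omega>\<^sub>0 u\<^sub>0 W \<mu> =
     (LEAST e. e \<in> (\<lambda>\<tau>\<^sub>0. D_series \<alpha> \<beta> p \<rho> \<Omega>\<^sub>0 u\<^sub>0 W \<tau>\<^sub>0 \<mu>) ` {0..2 * pi})"

definition omega_min ::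
  "real \<Rightarrow> real \<Rightarrow> nat \<Rightarrow> real \<Rightarrow> real \<Rightarrow> (real \<Rightarrow> real) \<Rightarrow> (real \<Rightarrow> real^2^2) \<Rightarrow> real \<Rightarrow> real" where
  "omega_min \<alpha> \<beta> p \<rho> \<Omega>\<^sub>0 u\<^sub>0 W \<mu> =
     \<rho> * \<Omega>\<^sub>0 / (1 + \<rho> * \<Omega>\<^sub>0 * eps_max \<alpha> \<beta> p \<rho> \<Omega>\<^sub>0 u\<^sub>0 W \<mu>)"

definition omega_max ::
  "real \<Rightarrow> real \<Rightarrow> nat \<Rightarrow> real \<Rightarrow> real \<Rightarrow> (real \<Rightarrow> real) \<Rightarrow> (real \<Rightarrow> real^2^2) \<Rightarrow> real \<Rightarrow> real" where
  "omega_max \<alpha> \<beta> p \<rho> \<Omega>\<^sub>0 u\<^sub>0 W \<mu> =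
     \<rho> * \<Omega>\<^sub>0 / (1 + \<rho> * \<Omega>\<^sub>0 * eps_min \<alpha> \<beta> p \<rho> \<Omega>\<^sub>0 u\<^sub>0 W \<mu>)"

end

(* With the remainder of the expansion around (u_0, 1/(rho Omega_0)) denoted by N, the k-th step
   of the recursion solves L u_k + eps_k chi + Xi_k = 0, where L is the linearized operator.

   Linear part. The equation L w = 0 has the periodic solution u_0' and a solution y_2 with
   y_2(t + 2 pi rho) = exp(-2 pi rho f_0) y_2(t); the weight exp(F~) b is y_2 divided by the
   Wronskian, that is the periodic solution of the adjoint equation. The mean f_0 is positive because
   y = E - E* (E the energy, E* the potential at the zero of h) satisfies (y exp(2 int f))' >= 0
   and y > 0 somewhere. Since L(t u_0') is a multiple of chi, integration by parts gives
   A = - rho Omega_0 u_0''(0) > 0. Variation of parameters then yields a bounded solution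
   operator for the periodic problem.

   Convergence. Xi_k is the k-th coefficient of N, whose terms are at least quadratic or contain mu.
   The sequence V_k = (theta/8) R^k / k^2 satisfies V * V <= theta V, so |u_k| <= V_k follows by
   induction once theta is small and R large.

   Width. D_k is a trigonometric polynomial of degree at most k in tau_0. The solution is unique
   near u_0, so a solution shifted in time by a (half) period of u_0 is again in the family up to
   a shift delta = O(mu) restoring u'(0) = 0: D(tau_0 + sigma + delta, mu) = D(tau_0, mu).
   Hence the first nonconstant D_m is invariant under the shift by sigma, which forces m >= q for
   sigma = 2 pi p/q and m >= 2q for sigma = pi p/q. The half period is available for odd p
   since u_0(t + pi rho) = - u_0(t): a closed orbit meets its reflection in the origin. *)

theory Submission
  imports Defs
begin

section \<open>Auxiliary facts on functions of a real variable\<close>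

text \<open>The remainder N is used three times: to bound the coefficients, to contract the
  difference of two solutions, and to see that order k involves lower orders only. All three rest on
  the same count of small factors in \<open>rem\<close>, so it is done once, over abstract
  relations. A purely geometric majorant would not do, since its convolution square gains a factor
  of order k; the damping 1/k^2 removes it. The phase occurs only in terms multiplied by \<mu>, so
  each degree in the phase costs one power of \<mu>. The obstacle in the width estimate is that
  delta depends on \<mu> and on the phase, so the symmetry relation cannot be read off coefficient
  by coefficient. Instead, once the coefficients below order m are constant, division by \<mu>^m and
  the limit \<mu> -> 0 give exact invariance of the m-th one under sigma alone. The multiples of
  sigma = 2 pi p/N, with N = q or N = 2q, run through all N-th parts of the circle because p and N
  are coprime, and a trigonometric polynomial of degree m < N that is invariant under them is
  constant. For N = 2q this coprimality is where p has to be odd.\<close>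

lemma periodic_fun_simple_iff: "periodic_fun_simple f T \<longleftrightarrow> (\<forall>x. f (x + T) = f x)"
  by (simp add: periodic_fun_simple_def)

lemma periodic_reduce:
  fixes f :: "real \<Rightarrow> 'a"
  assumes "\<And>x. f (x + T) = f x" and "T > 0"
  obtains y where "y \<in> {0..T}" and "f y = f x" and "\<exists>n::int. y = x - n * T"
proof
  interpret periodic_fun_simple f T using assms by (simp add: periodic_fun_simple_iff)
  define n where "n = \<lfloor>x / T\<rfloor>"
  have "of_int n \<le> x / T" "x / T < of_int n + 1" by (auto simp: n_def)
  then show "x - n * T \<in> {0..T}" using \<open>T > 0\<close> by (auto simp: field_simps)
  show "f (x - n * T) = f x" by (rule minus_of_int)
  show "\<exists>n'::int. x - n * T = x - n' * T" by blast
qed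

lemma periodic_bounded:
  fixes f :: "real \<Rightarrow> real"
  assumes "\<And>x. f (x + T) = f x" and "T > 0" and "continuous_on UNIV f"
  obtains K where "K > 0" and "\<And>x. \<bar>f x\<bar> \<le> K"
proof -
  have "compact (f ` {0..T})"
    using assms(3) by (intro compact_continuous_image compact_Icc) (auto intro: continuous_on_subset)
  then obtain K where K: "\<And>y. y \<in> {0..T} \<Longrightarrow> \<bar>f y\<bar> \<le> K"
    using compact_imp_bounded bounded_iff by (metis image_eqI real_norm_def)
  show ?thesis
  proof
    fix x obtain y where "y \<in> {0..T}" "f y = f x"
      using periodic_reduce[of f T x] assms(1,2) by metis
    then show "\<bar>f x\<bar> \<le> \<bar>K\<bar> + 1" using K[of y] by auto
  qed auto
qed

text \<open>The factor m covers periodic functions (m = 1), Floquet solutions, and the sign change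
  under a half period (m = -1).\<close>

lemma periodic_deriv:
  fixes f f' :: "real \<Rightarrow> real"
  assumes "\<And>t. (f has_real_derivative f' t) (at t)" and "\<And>t. f (t + T) = m * f t"
  shows "f' (t + T) = m * f' t"
proof -
  have "((\<lambda>t. f (t + T)) has_real_derivative f' (t + T) * 1) (at t)"
    by (rule DERIV_chain2[OF assms(1)]) (auto intro!: derivative_eq_intros)
  moreover have "((\<lambda>t. m * f t) has_real_derivative m * f' t) (at t)"
    by (intro DERIV_cmult assms(1))
  ultimately show ?thesis using assms(2) by (auto dest: DERIV_unique)
qed

text \<open>Two-sided Gronwall: exp(-K t) e t is nonincreasing to the right of t0 and exp(K t) e t
  nondecreasing to its left, so e cannot become positive.\<close>

lemma gronwall_zero:
  fixes e :: "real \<Rightarrow> real"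
  assumes d: "\<And>t. (e has_real_derivative e' t) (at t)"
    and b: "\<And>t. \<bar>e' t\<bar> \<le> K * e t" and z: "e t0 = 0" and nn: "\<And>t. e t \<ge> 0"
  shows "e t = 0"
proof -
  have "e t \<le> 0"
  proof (cases "t0 \<le> t")
    case True
    have "exp (- K * t) * e t \<le> exp (- K * t0) * e t0"
    proof (rule DERIV_nonpos_imp_nonincreasing[OF True, where f="\<lambda>t. exp (- K * t) * e t"])
      fix x
      have "((\<lambda>t. exp (- K * t) * e t) has_real_derivative exp (- K * x) * (e' x - K * e x)) (at x)"
        by (auto intro!: derivative_eq_intros d simp: algebra_simps)
      moreover have "exp (- K * x) * (e' x - K * e x) \<le> 0"
        using b[of x] by (intro mult_nonneg_nonpos) auto
      ultimately show "\<exists>y. ((\<lambda>t. exp (- K * t) * e t) has_real_derivative y) (at x) \<and> y \<le> 0"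
        by blast
    qed
    then show ?thesis using z by (simp add: mult_le_0_iff)
  next
    case False
    have "exp (K * t) * e t \<le> exp (K * t0) * e t0"
    proof (rule DERIV_nonneg_imp_nondecreasing[where f="\<lambda>t. exp (K * t) * e t"])
      show "t \<le> t0" using False by simp
      fix x
      have "((\<lambda>t. exp (K * t) * e t) has_real_derivative exp (K * x) * (e' x + K * e x)) (at x)"
        by (auto intro!: derivative_eq_intros d simp: algebra_simps)
      moreover have "exp (K * x) * (e' x + K * e x) \<ge> 0"
        using b[of x] by (intro mult_nonneg_nonneg) auto
      ultimately show "\<exists>y. ((\<lambda>t. exp (K * t) * e t) has_real_derivative y) (at x) \<and> 0 \<le> y"
        by blast
    qed
    then show ?thesis using z by (simp add: mult_le_0_iff)
  qed
  with nn[of t] show ?thesis by simp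
qed

text \<open>Oriented integral in the two-interval form of \<open>F_tilde\<close>, so that it is an
  antiderivative on both sides of 0.\<close>

definition oint :: "(real \<Rightarrow> real) \<Rightarrow> real \<Rightarrow> real" where
  "oint f t = integral {0..t} f - integral {t..0} f"

lemma oint_0 [simp]: "oint f 0 = 0"
  by (simp add: oint_def)

lemma oint_nonneg: "t \<ge> 0 \<Longrightarrow> oint f t = integral {0..t} f"
  by (cases "t = 0") (auto simp: oint_def)

lemma oint_has_derivative:
  assumes "continuous_on UNIV f"
  shows "(oint f has_real_derivative f t) (at t)"
proof -
  \<comment> \<open>A base point to the left of both t and 0: near t, \<open>oint f\<close> is then
    an ordinary integral from a up to a constant, whatever the sign of t.\<close>
  define a where "a = min t 0 - 1"
  define b where "b = t + 1"
  have int: "f integrable_on {x..y}" for x y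
    using assms by (intro integrable_continuous_real) (auto intro: continuous_on_subset)
  have eq: "oint f s = integral {a..s} f - integral {a..0} f" if "s > a" for s
  proof (cases "s \<ge> 0")
    case True
    have "integral {a..0} f + integral {0..s} f = integral {a..s} f"
      using True by (intro Henstock_Kurzweil_Integration.integral_combine int) (auto simp: a_def)
    then show ?thesis using oint_nonneg[OF True, of f] by simp
  next
    case False
    have "integral {a..s} f + integral {s..0} f = integral {a..0} f"
      using False that by (intro Henstock_Kurzweil_Integration.integral_combine int) auto
    then show ?thesis using False by (simp add: oint_def)
  qed
  have "((\<lambda>s. integral {a..s} f) has_real_derivative f t) (at t within {a..b})"
    using assms by (intro integral_has_real_derivative) (auto intro: continuous_on_subset simp: a_def b_def)
  then have "((\<lambda>s. integral {a..s} f) has_real_derivative f t) (at t)"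
    by (subst (asm) at_within_interior) (auto simp: a_def b_def)
  then have "((\<lambda>s. integral {a..s} f - integral {a..0} f) has_real_derivative f t - 0) (at t)"
    by (intro DERIV_diff DERIV_const)
  then have "((\<lambda>s. integral {a..s} f - integral {a..0} f) has_real_derivative f t) (at t)" by simp
  then show ?thesis
    by (rule has_field_derivative_transform_within_open[where S="{a<..}"])
       (auto simp: eq a_def)
qed

lemma integral_eq_of_antideriv:
  fixes G g :: "real \<Rightarrow> real"
  assumes "\<And>t. (G has_real_derivative g t) (at t)" and "a \<le> b"
  shows "integral {a..b} g = G b - G a"
  by (intro integral_unique fundamental_theorem_of_calculus assms)
     (auto simp: has_real_derivative_iff_has_vector_derivative[symmetric] 
           intro: has_field_derivative_at_within assms)

lemma derivs_imp_cont:
  fixes f :: "real \<Rightarrow> real"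
  shows "(\<And>t. (f has_real_derivative f' t) (at t)) \<Longrightarrow> continuous_on S f"
  by (meson DERIV_continuous_on has_field_derivative_at_within)

lemma abs_integral_le:
  fixes f :: "real \<Rightarrow> real"
  assumes "continuous_on UNIV f" and "\<And>t. t \<in> {0..T} \<Longrightarrow> \<bar>f t\<bar> \<le> K" and "0 \<le> s" "s \<le> T"
  shows "\<bar>integral {0..s} f\<bar> \<le> K * T"
proof -
  have "K \<ge> 0" using assms(2)[of 0] assms(3,4) by auto
  have "norm (integral {0..s} f) \<le> K * (s - 0)"
    using assms by (intro integral_bound) (auto intro: continuous_on_subset)
  also have "\<dots> \<le> K * T" using \<open>K \<ge> 0\<close> assms by (intro mult_left_mono) auto
  finally show ?thesis by simp
qed

section \<open>Periodic linear equations with Floquet multipliers 1 and m\<close>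

text \<open>y1 and y2 form a fundamental system with multipliers 1 and m over the time Q, which may
  be any multiple of the orbit period; s is the scale of the parameter direction
  \<open>chi\<close>.\<close>

locale floquet =
  fixes F B y1 z1 y2 z2 \<Phi> :: "real \<Rightarrow> real" and Q m s :: real
  assumes Q: "Q > 0"
    and y1: "\<And>t. (y1 has_real_derivative z1 t) (at t)"
    and z1: "\<And>t. (z1 has_real_derivative - (F t * z1 t + B t * y1 t)) (at t)"
    and y2: "\<And>t. (y2 has_real_derivative z2 t) (at t)"
    and z2: "\<And>t. (z2 has_real_derivative - (F t * z2 t + B t * y2 t)) (at t)"
    and Phi: "\<And>t. (\<Phi> has_real_derivative F t) (at t)"
    and init: "y1 0 = 0" "z1 0 = 1" "y2 0 = 1" "\<Phi> 0 = 0"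
    and per1: "\<And>t. y1 (t + Q) = y1 t" and per2: "\<And>t. y2 (t + Q) = m * y2 t"
    and m: "m > 0" "m \<noteq> 1"
    and contF: "continuous_on UNIV F" and contB: "continuous_on UNIV B"
    and perF: "\<And>t. F (t + Q) = F t" and perB: "\<And>t. B (t + Q) = B t"
    and s: "s \<noteq> 0"
begin

definition psi where "psi t = exp (\<Phi> t) * y2 t"
text \<open>The linear operator applied to t y1(t), scaled by s. This secular form is what makes
  \<open>integral_psi_chi\<close> an explicit boundary term.\<close>

definition chi where "chi t = s * (2 * z1 t + F t * y1 t)"

lemma wronskian: "y2 t * z1 t - y1 t * z2 t = exp (- \<Phi> t)"
proof -
  define G where "G t = (y2 t * z1 t - y1 t * z2 t) * exp (\<Phi> t)" for t
  have "(G has_real_derivative 0) (at t)" for t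
    unfolding G_def by (auto intro!: derivative_eq_intros y1 z1 y2 z2 Phi simp: algebra_simps)
  then have "G t = G 0" by (metis DERIV_isconst_all)
  then show ?thesis by (simp add: G_def init exp_minus field_simps)
qed

lemma perz1: "z1 (t + Q) = z1 t"
  using periodic_deriv[OF y1, where T=Q and m=1] per1 by simp

lemma perz2: "z2 (t + Q) = m * z2 t"
  using periodic_deriv[OF y2 per2] .

text \<open>Reading the Wronskian one period later turns the multipliers 1 and m into the growth of
  exp(-Phi), that is, exp(-Phi Q) = m.\<close>

lemma perPhi: "exp (- \<Phi> (t + Q)) = m * exp (- \<Phi> t)"
  unfolding wronskian[symmetric] per1 per2 perz1 perz2 by (simp add: algebra_simps)

lemma perPhi': "exp (\<Phi> (t + Q)) * m = exp (\<Phi> t)"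
  using perPhi[of t] by (simp add: exp_minus field_simps)

lemma per_psi: "psi (t + Q) = psi t"
  by (simp add: psi_def per2 mult.assoc[symmetric] perPhi')

lemma per_chi: "chi (t + Q) = chi t"
  by (simp add: chi_def per1 perz1 perF)

lemma conts: "continuous_on S y1" "continuous_on S z1" "continuous_on S y2" "continuous_on S z2" 
  "continuous_on S \<Phi>" "continuous_on S F" "continuous_on S B"
  using derivs_imp_cont[OF y1] derivs_imp_cont[OF z1] derivs_imp_cont[OF y2] derivs_imp_cont[OF z2]
   derivs_imp_cont[OF Phi] contF contB
  by (auto intro: continuous_on_subset)

lemma cont_psi: "continuous_on S psi"
  unfolding psi_def by (intro continuous_intros conts)

lemma cont_chi: "continuous_on S chi"
  unfolding chi_def by (intro continuous_intros conts)

text \<open>The coefficients of w in the basis y2, y1 are the constants G1, G2 of Cramer's rule.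
  Periodicity kills the y2 part because m \<noteq> 1, and x 0 = 0 then kills the y1 part because z1
  0 = 1.\<close>

lemma homogeneous_zero:
  assumes w: "\<And>t. (w has_real_derivative x t) (at t)"
    and x: "\<And>t. (x has_real_derivative - (F t * x t + B t * w t)) (at t)"
    and ini: "(w 0 = 0 \<and> x 0 = 0) \<or> ((\<forall>t. w (t + Q) = w t) \<and> x 0 = 0)"
  shows "w t = 0 \<and> x t = 0"
proof -
  define G1 where "G1 t = (w t * z1 t - x t * y1 t) * exp (\<Phi> t)" for t
  define G2 where "G2 t = (x t * y2 t - w t * z2 t) * exp (\<Phi> t)" for t
  have "(G1 has_real_derivative 0) (at t)" for t
    unfolding G1_def by (auto intro!: derivative_eq_intros y1 z1 y2 z2 Phi w x simp: algebra_simps)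
  then have G1: "G1 t = G1 0" for t by (metis DERIV_isconst_all)
  have "(G2 has_real_derivative 0) (at t)" for t
    unfolding G2_def by (auto intro!: derivative_eq_intros y1 z1 y2 z2 Phi w x simp: algebra_simps)
  then have G2: "G2 t = G2 0" for t by (metis DERIV_isconst_all)
  have e: "exp (\<Phi> t) * (y2 t * z1 t - y1 t * z2 t) = 1" for t
    by (simp add: wronskian exp_minus)
  have W: "w t = G1 0 * y2 t + G2 0 * y1 t" for t
  proof -
    have "G1 t * y2 t + G2 t * y1 t = w t * (exp (\<Phi> t) * (y2 t * z1 t - y1 t * z2 t))"
      by (simp add: G1_def G2_def algebra_simps)
    then show ?thesis by (simp add: e G1[of t] G2[of t])
  qed
  have X: "x t = G1 0 * z2 t + G2 0 * z1 t" for t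
  proof -
    have "G1 t * z2 t + G2 t * z1 t = x t * (exp (\<Phi> t) * (y2 t * z1 t - y1 t * z2 t))"
      by (simp add: G1_def G2_def algebra_simps)
    then show ?thesis by (simp add: e G1[of t] G2[of t])
  qed
  have "G1 0 = 0"
    using ini
  proof
    assume "(\<forall>t. w (t + Q) = w t) \<and> x 0 = 0"
    then have "w (0 + Q) = w 0" by blast
    then have "G1 0 * (m - 1) = 0"
      unfolding W per1 per2 by (simp add: init algebra_simps)
    then show ?thesis using m by simp
  qed (simp add: G1_def)
  moreover have "x 0 = 0" using ini by blast
  ultimately have "G1 0 = 0" "G2 0 = 0" using X[of 0] by (simp_all add: init)
  then show ?thesis using W X by simp
qed

text \<open>Lagrange identity: psi R is the derivative of -exp(Phi) (y2 x - z2 w), which is periodic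
  because the multipliers of exp(Phi) and of y2, z2 cancel.\<close>

lemma solvability:
  assumes w: "\<And>t. (w has_real_derivative x t) (at t)"
    and x: "\<And>t. (x has_real_derivative - (F t * x t + B t * w t + R t)) (at t)"
    and per: "\<And>t. w (t + Q) = w t"
  shows "integral {0..Q} (\<lambda>t. psi t * R t) = 0"
proof -
  define G where "G t = - exp (\<Phi> t) * (y2 t * x t - z2 t * w t)" for t
  have "(G has_real_derivative psi t * R t) (at t)" for t
    unfolding G_def psi_def by (auto intro!: derivative_eq_intros y1 z1 y2 z2 Phi w x simp: algebra_simps)
  then have "integral {0..Q} (\<lambda>t. psi t * R t) = G Q - G 0"
    using Q by (intro integral_eq_of_antideriv) auto
  also have "x (0 + Q) = x 0" using periodic_deriv[OF w, of Q 1 0] per by simp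
  then have "G (0 + Q) = - (exp (\<Phi> (0 + Q)) * m) * (y2 0 * x 0 - z2 0 * w 0)"
    unfolding G_def per2 perz2 per by (simp add: algebra_simps)
  then have "G Q - G 0 = 0" unfolding perPhi' by (simp add: G_def)
  finally show ?thesis .
qed

text \<open>The Lagrange identity for the nonperiodic function t y1(t): its boundary terms fail to
  cancel by exactly Q.\<close>

lemma integral_psi_chi: "integral {0..Q} (\<lambda>t. psi t * chi t) = s * Q"
proof -
  define G where "G t = exp (\<Phi> t) * (y2 t * (y1 t + t * z1 t) - z2 t * (t * y1 t))" for t
  have "(G has_real_derivative psi t * (2 * z1 t + F t * y1 t)) (at t)" for t
    unfolding G_def psi_def by (auto intro!: derivative_eq_intros y1 z1 y2 z2 Phi simp: algebra_simps)
  then have "((\<lambda>t. s * G t) has_real_derivative s * (psi t * (2 * z1 t + F t * y1 t))) (at t)" for t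
    by (rule DERIV_cmult)
  moreover have "s * (psi t * (2 * z1 t + F t * y1 t)) = psi t * chi t" for t
    by (simp add: chi_def)
  ultimately have "((\<lambda>t. s * G t) has_real_derivative psi t * chi t) (at t)" for t by simp
  then have *: "integral {0..Q} (\<lambda>t. psi t * chi t) = s * G Q - s * G 0"
    using Q by (intro integral_eq_of_antideriv) auto
  have "G (0 + Q) = (exp (\<Phi> (0 + Q)) * m) * Q"
    unfolding G_def per1 per2 perz1 perz2 by (simp add: init algebra_simps)
  then have "G Q = Q" unfolding perPhi' by (simp add: init)
  then show ?thesis by (simp add: * G_def init)
qed

text \<open>The only e for which e chi + phi is orthogonal to psi, because the integral of psi chi
  is s Q.\<close>

definition eps where "eps \<phi> = - integral {0..Q} (\<lambda>t. psi t * \<phi> t) / (s * Q)"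

text \<open>The condition x 0 = 0 removes the multiple of y1 that the periodic problem leaves
  free.\<close>

definition solves_lin where
  "solves_lin \<phi> e w x \<longleftrightarrow> (\<forall>t. (w has_real_derivative x t) (at t)) \<and>
     (\<forall>t. (x has_real_derivative - (F t * x t + B t * w t + e * chi t + \<phi> t)) (at t)) \<and>
     (\<forall>t. w (t + Q) = w t) \<and> x 0 = 0"

lemma psi_int: "continuous_on UNIV \<phi> \<Longrightarrow> (\<lambda>t. psi t * \<phi> t) integrable_on {0..Q}"
  by (intro integrable_continuous_real continuous_intros cont_psi) (auto intro: continuous_on_subset)

lemma solves_lin_eps:
  assumes c: "continuous_on UNIV \<phi>" and w: "solves_lin \<phi> e w x"
  shows "e = eps \<phi>"
proof -
  have "integral {0..Q} (\<lambda>t. psi t * (e * chi t + \<phi> t)) = 0"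
    by (rule solvability[where w=w and x=x]) (use w in \<open>auto simp: solves_lin_def add.assoc\<close>)
  moreover have "(\<lambda>t. psi t * (e * chi t + \<phi> t)) = (\<lambda>t. e * (psi t * chi t) + psi t * \<phi> t)"
    by (auto simp: algebra_simps)
  moreover have "integral {0..Q} (\<lambda>t. e * (psi t * chi t) + psi t * \<phi> t) 
      = e * (s * Q) + integral {0..Q} (\<lambda>t. psi t * \<phi> t)"
    by (subst Henstock_Kurzweil_Integration.integral_add)
       (auto intro!: integrable_on_mult_right psi_int c cont_chi simp: integral_psi_chi)
  ultimately show ?thesis using s Q by (simp add: eps_def field_simps)
qed

lemma solves_lin_unique:
  assumes "solves_lin \<phi> e w x" "solves_lin \<phi> e w' x'"
  shows "w t = w' t \<and> x t = x' t"
proof -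
  have "w t - w' t = 0 \<and> x t - x' t = 0"
    by (rule homogeneous_zero[where w="\<lambda>t. w t - w' t" and x="\<lambda>t. x t - x' t"])
       (use assms in \<open>auto simp: solves_lin_def algebra_simps intro!: derivative_eq_intros\<close>)
  then show ?thesis by simp
qed

lemma solves_lin_add:
  "solves_lin \<phi> e w x \<Longrightarrow> solves_lin \<phi>' e' w' x' \<Longrightarrow>
    solves_lin (\<lambda>t. \<phi> t + \<phi>' t) (e + e') (\<lambda>t. w t + w' t) (\<lambda>t. x t + x' t)"
  by (auto simp: solves_lin_def algebra_simps intro!: derivative_eq_intros)

lemma solves_lin_cmult:
  "solves_lin \<phi> e w x \<Longrightarrow> solves_lin (\<lambda>t. k * \<phi> t) (k * e) (\<lambda>t. k * w t) (\<lambda>t. k * x t)"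
  by (auto simp: solves_lin_def algebra_simps intro!: derivative_eq_intros)

text \<open>Variation of parameters. The constant beta0 solves m beta(Q) = beta(0), which is
  possible since m \<noteq> 1; alpha(0) = -beta0 z2(0) is forced by x 0 = 0; alpha returns to its
  initial value because R is orthogonal to psi. The data then agree at 0 and Q, and uniqueness gives
  periodicity.\<close>

lemma particular_solution:
  assumes c: "continuous_on UNIV R" and z: "integral {0..Q} (\<lambda>t. psi t * R t) = 0"
    and per: "\<And>t. R (t + Q) = R t"
  defines "\<beta>0 \<equiv> m * oint (\<lambda>t. exp (\<Phi> t) * y1 t * R t) Q / (1 - m)"
  defines "\<alpha> \<equiv> \<lambda>t. - \<beta>0 * z2 0 - oint (\<lambda>t. psi t * R t) t"
    and "\<beta> \<equiv> \<lambda>t. \<beta>0 + oint (\<lambda>t. exp (\<Phi> t) * y1 t * R t) t"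
  defines "w \<equiv> \<lambda>t. \<alpha> t * y1 t + \<beta> t * y2 t" and "x \<equiv> \<lambda>t. \<alpha> t * z1 t + \<beta> t * z2 t"
  shows "(w has_real_derivative x t) (at t)"
    and "(x has_real_derivative - (F t * x t + B t * w t + R t)) (at t)"
    and "w (t + Q) = w t" and "x 0 = 0"
proof -
  have c1: "continuous_on UNIV (\<lambda>t. psi t * R t)" "continuous_on UNIV (\<lambda>t. exp (\<Phi> t) * y1 t * R t)"
    by (intro continuous_intros cont_psi conts c)+
  have a: "(\<alpha> has_real_derivative - (psi t * R t)) (at t)" for t
    unfolding \<alpha>_def by (auto intro!: derivative_eq_intros oint_has_derivative c1)
  have b: "(\<beta> has_real_derivative exp (\<Phi> t) * y1 t * R t) (at t)" for t
    unfolding \<beta>_def by (auto intro!: derivative_eq_intros oint_has_derivative c1)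
  show dw: "(w has_real_derivative x t) (at t)" for t
    unfolding w_def x_def psi_def[symmetric]
    by (auto intro!: derivative_eq_intros a b y1 y2 simp: algebra_simps psi_def)
  have e: "exp (\<Phi> t) * (y2 t * z1 t - y1 t * z2 t) = 1" for t
    by (simp add: wronskian exp_minus)
  have "(x has_real_derivative - (F t * x t + B t * w t) - exp (\<Phi> t) * (y2 t * z1 t - y1 t * z2 t) * R t) (at t)" for t
    unfolding w_def x_def
    by (auto intro!: derivative_eq_intros a b z1 z2 simp: algebra_simps psi_def)
  then show dx: "(x has_real_derivative - (F t * x t + B t * w t + R t)) (at t)" for t
    unfolding e mult_1 by (metis (no_types, opaque_lifting) diff_conv_add_uminus minus_add_distrib)
  show x0: "x 0 = 0" by (simp add: x_def \<alpha>_def \<beta>_def init)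
  have bQ: "m * \<beta> Q = \<beta>0" unfolding \<beta>_def \<beta>0_def using m by (simp add: field_simps)
  have aQ: "\<alpha> Q = \<alpha> 0" unfolding \<alpha>_def using z Q by (simp add: oint_nonneg)
  have vQ: "y1 Q = 0" "y2 Q = m" "z1 Q = 1" "z2 Q = m * z2 0"
    using per1[of 0] per2[of 0] perz1[of 0] perz2[of 0] by (simp_all add: init)
  have wQ: "w Q = w 0" using bQ by (simp add: w_def vQ init \<beta>_def mult.commute)
  have "x Q = \<alpha> 0 + m * \<beta> Q * z2 0" by (simp add: x_def vQ aQ)
  then have xQ: "x Q = x 0" unfolding bQ by (simp add: x_def init \<beta>_def)
  have "w (t + Q) - w t = 0 \<and> x (t + Q) - x t = 0"
  proof (rule homogeneous_zero[where w="\<lambda>t. w (t + Q) - w t" and x="\<lambda>t. x (t + Q) - x t"])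
    show "((\<lambda>t. w (t + Q) - w t) has_real_derivative x (t + Q) - x t) (at t)" for t
      using DERIV_diff[OF dw[of "t + Q", unfolded DERIV_shift] dw[of t]] .
    show "((\<lambda>t. x (t + Q) - x t) has_real_derivative
          - (F t * (x (t + Q) - x t) + B t * (w (t + Q) - w t))) (at t)" for t
    proof -
      have "((\<lambda>t. x (t + Q)) has_real_derivative - (F t * x (t + Q) + B t * w (t + Q) + R t)) (at t)"
        using dx[of "t + Q"] unfolding DERIV_shift perF perB per .
      from DERIV_diff[OF this dx[of t]] show ?thesis by (simp add: algebra_simps)
    qed
  qed (simp add: wQ xQ)
  then show "w (t + Q) = w t" by simp
qed

definition solution_bound where
  "solution_bound M \<longleftrightarrow> (\<forall>\<phi> b. continuous_on UNIV \<phi> \<longrightarrow> (\<forall>t. \<phi> (t + Q) = \<phi> t) \<longrightarrow> (\<forall>t. \<bar>\<phi> t\<bar> \<le> b) \<longrightarrow>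
     (\<exists>w x. solves_lin \<phi> (eps \<phi>) w x \<and> \<bar>eps \<phi>\<bar> \<le> M * b \<and> (\<forall>t. \<bar>w t\<bar> \<le> M * b \<and> \<bar>x t\<bar> \<le> M * b)))"

lemma solution_bound_ex: "\<exists>M>0. solution_bound M"
proof -
  obtain K1 where K1: "K1 > 0" "\<And>t. \<bar>psi t\<bar> \<le> K1"
    using periodic_bounded[of psi Q] per_psi Q cont_psi by metis
  obtain K2 where K2: "K2 > 0" "\<And>t. \<bar>chi t\<bar> \<le> K2"
    using periodic_bounded[of chi Q] per_chi Q cont_chi by metis
  have "\<exists>K>0. \<forall>t\<in>{0..Q}. \<bar>f t\<bar> \<le> K" if "continuous_on {0..Q} f" for f :: "real \<Rightarrow> real"
  proof -
    have "compact (f ` {0..Q})" using that by (intro compact_continuous_image compact_Icc)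
    then obtain K where K: "\<And>y. y \<in> {0..Q} \<Longrightarrow> \<bar>f y\<bar> \<le> K"
      using compact_imp_bounded bounded_iff by (metis image_eqI real_norm_def)
    then have "\<bar>f t\<bar> \<le> \<bar>K\<bar> + 1" if "t \<in> {0..Q}" for t using that by (smt (verit) imageI)
    then show ?thesis by (intro exI[of _ "\<bar>K\<bar> + 1"]) auto
  qed
  note ex = this
  \<comment> \<open>The functions y2, z2 and exp Phi are not periodic, so they are bounded on one
    period only; the periodic w and x are reduced to that period at the end.\<close>
  have "continuous_on {0..Q} (\<lambda>t. \<bar>y1 t\<bar> + \<bar>y2 t\<bar> + \<bar>z1 t\<bar> + \<bar>z2 t\<bar> + \<bar>exp (\<Phi> t) * y1 t\<bar>)"
    by (intro continuous_intros conts)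
  from ex[OF this] obtain K where K: "K > 0" and
    "\<And>t. t \<in> {0..Q} \<Longrightarrow> \<bar>\<bar>y1 t\<bar> + \<bar>y2 t\<bar> + \<bar>z1 t\<bar> + \<bar>z2 t\<bar> + \<bar>exp (\<Phi> t) * y1 t\<bar>\<bar> \<le> K" by blast
  then have Kt: "\<bar>y1 t\<bar> \<le> K" "\<bar>y2 t\<bar> \<le> K" "\<bar>z1 t\<bar> \<le> K" "\<bar>z2 t\<bar> \<le> K" "\<bar>exp (\<Phi> t) * y1 t\<bar> \<le> K" 
    if "t \<in> {0..Q}" for t using that by fastforce+
  \<comment> \<open>In units of b: Me bounds the parameter, Mr the corrected right-hand side R, and
    Mb Mr the initial coefficient beta0.\<close>
  define Me where "Me = K1 * Q / (\<bar>s\<bar> * Q)"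
  define Mr where "Mr = 1 + Me * K2"
  define Mb where "Mb = m * (K * Q) / \<bar>1 - m\<bar>"
  define M where "M = (Me + ((Mb * K + K1 * Q) * K + (Mb + K * Q) * K) * Mr) + 1"
  have pos: "Me \<ge> 0" "Mr \<ge> 0" "Mb \<ge> 0"
    using K1 K2 K Q m by (auto simp: Me_def Mr_def Mb_def)
  have posb: "((Mb * K + K1 * Q) * K + (Mb + K * Q) * K) * Mr \<ge> 0"
    using K1 K Q by (intro mult_nonneg_nonneg add_nonneg_nonneg pos) auto
  show ?thesis
    unfolding solution_bound_def
  proof (intro exI[of _ M] conjI allI impI)
    show "M > 0" using posb pos by (simp add: M_def)
    fix \<phi> :: "real \<Rightarrow> real" and b :: real
    assume c: "continuous_on UNIV \<phi>" and per: "\<forall>t. \<phi> (t + Q) = \<phi> t" and b: "\<forall>t. \<bar>\<phi> t\<bar> \<le> b"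
    have b0: "b \<ge> 0" using b by (meson abs_ge_zero order_trans)
    have "\<bar>integral {0..Q} (\<lambda>t. psi t * \<phi> t)\<bar> \<le> (K1 * b) * Q"
      using Q K1 b by (intro abs_integral_le continuous_intros cont_psi c)
        (auto simp: abs_mult intro!: mult_mono)
    then have eb: "\<bar>eps \<phi>\<bar> \<le> Me * b"
      unfolding eps_def Me_def using Q s by (simp add: abs_mult divide_right_mono field_simps)
    define R where "R t = eps \<phi> * chi t + \<phi> t" for t
    have cR: "continuous_on UNIV R" unfolding R_def by (intro continuous_intros cont_chi c)
    have perR: "R (t + Q) = R t" for t using per by (simp add: R_def per_chi)
    have Rb: "\<bar>R t\<bar> \<le> Mr * b" for t
    proof -
      have "\<bar>R t\<bar> \<le> \<bar>eps \<phi>\<bar> * \<bar>chi t\<bar> + \<bar>\<phi> t\<bar>" unfolding R_def by (metis abs_mult abs_triangle_ineq)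
      also have "\<dots> \<le> (Me * b) * K2 + b"
        by (rule add_mono[OF mult_mono[OF eb K2(2)] b[rule_format]]) (simp_all add: pos b0)
      finally show ?thesis by (simp add: Mr_def algebra_simps)
    qed
    have iR: "integral {0..Q} (\<lambda>t. psi t * R t) = 0"
    proof -
      have "(\<lambda>t. psi t * R t) = (\<lambda>t. eps \<phi> * (psi t * chi t) + psi t * \<phi> t)"
        by (auto simp: R_def algebra_simps)
      then have "integral {0..Q} (\<lambda>t. psi t * R t) = eps \<phi> * (s * Q) + integral {0..Q} (\<lambda>t. psi t * \<phi> t)"
        by (simp, subst Henstock_Kurzweil_Integration.integral_add)
           (auto intro!: integrable_on_mult_right psi_int c cont_chi simp: integral_psi_chi)
      then show ?thesis using s Q by (simp add: eps_def)
    qed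
    define \<beta>0 where "\<beta>0 = m * oint (\<lambda>t. exp (\<Phi> t) * y1 t * R t) Q / (1 - m)"
    define \<alpha> where "\<alpha> t = - \<beta>0 * z2 0 - oint (\<lambda>t. psi t * R t) t" for t
    define \<beta> where "\<beta> t = \<beta>0 + oint (\<lambda>t. exp (\<Phi> t) * y1 t * R t) t" for t
    define w where "w t = \<alpha> t * y1 t + \<beta> t * y2 t" for t
    define x where "x t = \<alpha> t * z1 t + \<beta> t * z2 t" for t
    note P = particular_solution[OF cR iR perR, folded \<beta>0_def, folded \<alpha>_def \<beta>_def, folded w_def x_def]
    have sol: "solves_lin \<phi> (eps \<phi>) w x"
      unfolding solves_lin_def using P by (simp add: R_def add.assoc)
    have o1: "\<bar>oint (\<lambda>t. exp (\<Phi> t) * y1 t * R t) t\<bar> \<le> K * Q * (Mr * b)" if "t \<in> {0..Q}" for t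
    proof -
      have "\<bar>integral {0..t} (\<lambda>t. exp (\<Phi> t) * y1 t * R t)\<bar> \<le> (K * (Mr * b)) * Q"
      proof (rule abs_integral_le)
        show "continuous_on UNIV (\<lambda>t. exp (\<Phi> t) * y1 t * R t)" by (intro continuous_intros conts cR)
        fix u assume "u \<in> {0..Q}"
        then show "\<bar>exp (\<Phi> u) * y1 u * R u\<bar> \<le> K * (Mr * b)"
          unfolding abs_mult[of "exp (\<Phi> u) * y1 u"] using Rb[of u] Kt[of u] K by (intro mult_mono) auto
      qed (use that in auto)
      then show ?thesis using that by (simp add: oint_nonneg mult_ac)
    qed
    have o2: "\<bar>oint (\<lambda>t. psi t * R t) t\<bar> \<le> K1 * Q * (Mr * b)" if "t \<in> {0..Q}" for t
    proof -
      have "\<bar>integral {0..t} (\<lambda>t. psi t * R t)\<bar> \<le> (K1 * (Mr * b)) * Q"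
        using that K1 Rb by (intro abs_integral_le continuous_intros cont_psi cR)
          (auto simp: abs_mult intro!: mult_mono)
      then show ?thesis using that by (simp add: oint_nonneg mult_ac)
    qed
    have rb0: "Mr * b \<ge> 0" using pos b0 by simp
    have bb0: "\<bar>\<beta>0\<bar> \<le> Mb * (Mr * b)"
    proof -
      have "m * \<bar>oint (\<lambda>t. exp (\<Phi> t) * y1 t * R t) Q\<bar> / \<bar>1 - m\<bar> \<le> m * (K * Q * (Mr * b)) / \<bar>1 - m\<bar>"
        using o1[of Q] Q m by (intro divide_right_mono mult_left_mono) auto
      then show ?thesis using m by (simp add: \<beta>0_def Mb_def abs_mult field_simps)
    qed
    have ba: "\<bar>\<alpha> t\<bar> \<le> (Mb * K + K1 * Q) * (Mr * b)" if "t \<in> {0..Q}" for t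
    proof -
      have "\<bar>\<alpha> t\<bar> \<le> \<bar>\<beta>0\<bar> * \<bar>z2 0\<bar> + \<bar>oint (\<lambda>t. psi t * R t) t\<bar>"
        unfolding \<alpha>_def by (simp add: abs_mult[symmetric])
      also have "\<dots> \<le> (Mb * (Mr * b)) * K + K1 * Q * (Mr * b)"
        by (rule add_mono[OF mult_mono[OF bb0 Kt(4)] o2[OF that]]) (use Q pos rb0 in simp_all)
      finally show ?thesis by (simp add: algebra_simps)
    qed
    have bb: "\<bar>\<beta> t\<bar> \<le> (Mb + K * Q) * (Mr * b)" if "t \<in> {0..Q}" for t
      unfolding \<beta>_def using bb0 o1[OF that] by (simp add: algebra_simps)
    have fin: "\<bar>\<alpha> t * u + \<beta> t * v\<bar> \<le> M * b" if "t \<in> {0..Q}" "\<bar>u\<bar> \<le> K" "\<bar>v\<bar> \<le> K" for t u v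
    proof -
      have "\<bar>\<alpha> t * u + \<beta> t * v\<bar> \<le> \<bar>\<alpha> t\<bar> * \<bar>u\<bar> + \<bar>\<beta> t\<bar> * \<bar>v\<bar>"
        by (metis abs_mult abs_triangle_ineq)
      also have "\<dots> \<le> ((Mb * K + K1 * Q) * (Mr * b)) * K + ((Mb + K * Q) * (Mr * b)) * K"
        by (rule add_mono[OF mult_mono[OF ba that(2)] mult_mono[OF bb that(3)]])
           (use that(1) pos rb0 K K1 Q in simp_all)
      also have "\<dots> = (((Mb * K + K1 * Q) * K + (Mb + K * Q) * K) * Mr) * b" by (simp add: algebra_simps)
      also have "\<dots> \<le> M * b" unfolding M_def using pos b0 by (intro mult_right_mono) auto
      finally show ?thesis .
    qed
    have pw: "w (t + Q) = w t" for t using P(3) .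
    have px: "x (t + Q) = x t" for t using periodic_deriv[OF P(1), of Q 1 t] pw by simp
    have wx: "\<bar>w t\<bar> \<le> M * b \<and> \<bar>x t\<bar> \<le> M * b" for t
    proof -
      obtain y where y: "y \<in> {0..Q}" "(w y, x y) = (w t, x t)"
        using periodic_reduce[of "\<lambda>t. (w t, x t)" Q t] Q pw px by metis
      then show ?thesis using fin[OF y(1), of "y1 y" "y2 y"] fin[OF y(1), of "z1 y" "z2 y"] Kt[OF y(1)]
        by (simp add: w_def x_def)
    qed
    have "Me * b \<le> M * b" unfolding M_def using posb b0 by (intro mult_right_mono) auto
    with sol wx eb show "\<exists>w x. solves_lin \<phi> (eps \<phi>) w x \<and> \<bar>eps \<phi>\<bar> \<le> M * b \<and> (\<forall>t. \<bar>w t\<bar> \<le> M * b \<and> \<bar>x t\<bar> \<le> M * b)"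
      by (meson order_trans)
  qed
qed

end

section \<open>The Lienard equation and its closed orbits\<close>

text \<open>Gronwall for d^2 + w^2; the constant 1 + 3 L collects 2 |d w| \<le> e and w^2 \<le>
  e.\<close>

lemma linear_zero:
  fixes d w a b :: "real \<Rightarrow> real"
  assumes d: "\<And>t. (d has_real_derivative w t) (at t)"
    and w: "\<And>t. (w has_real_derivative - (a t * w t + b t * d t)) (at t)"
    and bnd: "\<And>t. \<bar>a t\<bar> \<le> L" "\<And>t. \<bar>b t\<bar> \<le> L" and z: "d t0 = 0" "w t0 = 0"
  shows "d t = 0 \<and> w t = 0"
proof -
  define e where "e t = (d t)^2 + (w t)^2" for t
  have L: "L \<ge> 0" using bnd(1)[of 0] by linarith
  have "e t = 0"
  proof (rule gronwall_zero[where e=e and ?t0.0=t0 and K="1 + 3 * L"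
        and e'="\<lambda>t. 2 * d t * w t - 2 * w t * (a t * w t + b t * d t)"])
    fix t
    show "(e has_real_derivative 2 * d t * w t - 2 * w t * (a t * w t + b t * d t)) (at t)"
      unfolding e_def by (auto intro!: derivative_eq_intros d w simp: algebra_simps power2_eq_square)
    have dw: "2 * \<bar>d t * w t\<bar> \<le> e t"
      using sum_squares_bound[of "\<bar>d t\<bar>" "\<bar>w t\<bar>"] by (simp add: e_def abs_mult)
    have w2: "(w t)^2 \<le> e t" by (simp add: e_def)
    have "\<bar>a t * (w t)^2\<bar> \<le> L * (w t)^2" "\<bar>b t * (d t * w t)\<bar> \<le> L * \<bar>d t * w t\<bar>"
      using bnd by (auto simp: abs_mult intro!: mult_right_mono)
    then have "\<bar>2 * d t * w t - 2 * w t * (a t * w t + b t * d t)\<bar>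
        \<le> 2 * \<bar>d t * w t\<bar> + 2 * (L * (w t)^2) + L * (2 * \<bar>d t * w t\<bar>)"
      by (simp add: algebra_simps power2_eq_square)
    also have "\<dots> \<le> e t + 2 * (L * e t) + L * e t"
      using L dw w2 by (intro add_mono mult_left_mono) auto
    finally show "\<bar>2 * d t * w t - 2 * w t * (a t * w t + b t * d t)\<bar> \<le> (1 + 3 * L) * e t"
      by (simp add: algebra_simps)
  qed (auto simp: e_def z)
  then show ?thesis by (simp add: e_def sum_power2_eq_zero_iff)
qed

text \<open>The constant c is the time scale: c = 1 is the original oscillator, c = 1/(rho Omega0)
  the one in rescaled time.\<close>

definition lienard :: "real \<Rightarrow> real \<Rightarrow> real \<Rightarrow> (real \<Rightarrow> real) \<Rightarrow> (real \<Rightarrow> real) \<Rightarrow> bool" where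
  "lienard c \<alpha> \<beta> u v \<longleftrightarrow> (\<forall>t. (u has_real_derivative v t) (at t)) \<and>
    (\<forall>t. (v has_real_derivative - (c * h_fun \<beta> (u t) * v t + c^2 * k_fun \<alpha> \<beta> (u t))) (at t))"

lemma lienardD:
  assumes "lienard c \<alpha> \<beta> u v"
  shows "(u has_real_derivative v t) (at t)"
    and "(v has_real_derivative - (c * h_fun \<beta> (u t) * v t + c^2 * k_fun \<alpha> \<beta> (u t))) (at t)"
  using assms by (auto simp: lienard_def)

lemma lienard_shift: "lienard c \<alpha> \<beta> u v \<Longrightarrow> lienard c \<alpha> \<beta> (\<lambda>t. u (t + s)) (\<lambda>t. v (t + s))"
  by (auto simp: lienard_def DERIV_shift[symmetric])

lemma lienard_uminus: "lienard c \<alpha> \<beta> u v \<Longrightarrow> lienard c \<alpha> \<beta> (\<lambda>t. - u t) (\<lambda>t. - v t)"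
  by (auto simp: lienard_def h_fun_def k_fun_def algebra_simps power3_eq_cube intro!: derivative_eq_intros)

text \<open>The difference of two solutions solves a linear equation whose coefficients are divided
  differences of the polynomials h and k; they are bounded because both solutions are.\<close>

lemma lienard_unique:
  assumes 1: "lienard c \<alpha> \<beta> u v" and 2: "lienard c \<alpha> \<beta> u' v'"
    and b: "\<And>t. \<bar>u t\<bar> \<le> M" "\<And>t. \<bar>v t\<bar> \<le> M" "\<And>t. \<bar>u' t\<bar> \<le> M" "\<And>t. \<bar>v' t\<bar> \<le> M"
    and z: "u t0 = u' t0" "v t0 = v' t0"
  shows "u t = u' t \<and> v t = v' t"
proof -
  define a where "a t = c * h_fun \<beta> (u t)" for t
  define b where "b t = c * (3 * \<beta>) * (u t + u' t) * v' t
     + c^2 * (\<alpha> - \<beta> + \<beta> * ((u t)^2 + u t * u' t + (u' t)^2))" for t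
  have M: "M \<ge> 0" using assms(3)[of 0] by linarith
  have sq: "\<bar>x * y\<bar> \<le> M^2" if "\<bar>x\<bar> \<le> M" "\<bar>y\<bar> \<le> M" for x y
    using that M by (simp add: abs_mult power2_eq_square mult_mono)
  have sq2: "(u t)^2 \<le> M^2" "(u' t)^2 \<le> M^2" for t using sq[of "u t" "u t"] sq[of "u' t" "u' t"] assms(3,5)
    by (auto simp: power2_eq_square)
  define La where "La = \<bar>c\<bar> * (\<bar>1 - \<beta>\<bar> + \<bar>3 * \<beta>\<bar> * M^2)"
  define Lb where "Lb = \<bar>c * (3 * \<beta>)\<bar> * (2 * M * M) + c^2 * (\<bar>\<alpha> - \<beta>\<bar> + \<bar>\<beta>\<bar> * (3 * M^2))"
  have La: "\<bar>a t\<bar> \<le> La" for t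
  proof -
    have "\<bar>1 - \<beta> + 3 * \<beta> * (u t)^2\<bar> \<le> \<bar>1 - \<beta>\<bar> + \<bar>3 * \<beta>\<bar> * M^2"
      by (rule order_trans[OF abs_triangle_ineq], unfold abs_mult[of "3 * \<beta>"])
         (use sq2 in \<open>auto intro!: mult_left_mono\<close>)
    then show ?thesis unfolding a_def La_def h_fun_def abs_mult by (intro mult_left_mono) auto
  qed
  have Lb: "\<bar>b t\<bar> \<le> Lb" for t
  proof -
    have 1: "\<bar>c * (3 * \<beta>) * ((u t + u' t) * v' t)\<bar> \<le> \<bar>c * (3 * \<beta>)\<bar> * (2 * M * M)"
      unfolding abs_mult[of "c * (3 * \<beta>)"] abs_mult[of "u t + u' t"]
      using assms(3)[of t] assms(5)[of t] assms(6)[of t] M by (intro mult_left_mono mult_mono) auto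
    have "\<bar>(u t)^2 + u t * u' t + (u' t)^2\<bar> \<le> 3 * M^2"
      using sq2[of t] sq[OF assms(3)[of t] assms(5)[of t]] zero_le_power2[of "u t"] zero_le_power2[of "u' t"]
      unfolding abs_le_iff by linarith
    then have "\<bar>\<alpha> - \<beta> + \<beta> * ((u t)^2 + u t * u' t + (u' t)^2)\<bar> \<le> \<bar>\<alpha> - \<beta>\<bar> + \<bar>\<beta>\<bar> * (3 * M^2)"
      by (intro order_trans[OF abs_triangle_ineq], unfold abs_mult[of "\<beta>"])
         (auto intro!: mult_left_mono)
    then have "\<bar>c^2 * (\<alpha> - \<beta> + \<beta> * ((u t)^2 + u t * u' t + (u' t)^2))\<bar> \<le> c^2 * (\<bar>\<alpha> - \<beta>\<bar> + \<bar>\<beta>\<bar> * (3 * M^2))"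
      unfolding abs_mult[of "c^2"] by (intro mult_mono) auto
    with 1 show ?thesis unfolding b_def Lb_def by (simp add: mult.assoc)
  qed
  have "u t - u' t = 0 \<and> v t - v' t = 0"
  proof (rule linear_zero[where d="\<lambda>t. u t - u' t" and w="\<lambda>t. v t - v' t" and ?t0.0=t0 and a=a and b=b and L="max La Lb"])
    fix t
    show "((\<lambda>t. u t - u' t) has_real_derivative v t - v' t) (at t)"
      by (intro DERIV_diff lienardD[OF 1] lienardD[OF 2])
    have "- (c * h_fun \<beta> (u t) * v t + c^2 * k_fun \<alpha> \<beta> (u t)) - - (c * h_fun \<beta> (u' t) * v' t + c^2 * k_fun \<alpha> \<beta> (u' t))
      = - (a t * (v t - v' t) + b t * (u t - u' t))"
      unfolding a_def b_def h_fun_def k_fun_def power2_eq_square power3_eq_cube by algebra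
    then show "((\<lambda>t. v t - v' t) has_real_derivative - (a t * (v t - v' t) + b t * (u t - u' t))) (at t)"
      using DERIV_diff[OF lienardD(2)[OF 1, of t] lienardD(2)[OF 2, of t]] by simp
  qed (use La Lb z in \<open>auto intro: max.coboundedI1 max.coboundedI2\<close>)
  then show ?thesis by simp
qed

lemma next_zero:
  fixes v :: "real \<Rightarrow> real"
  assumes cont: "continuous_on UNIV v" and dv: "(v has_real_derivative D) (at t0)"
    and vt: "v t0 = 0" and D: "D < 0" and P: "P > 0" and vP: "v (t0 + P) = 0"
  obtains b where "t0 < b" "v b = 0" "\<And>t. t0 < t \<Longrightarrow> t < b \<Longrightarrow> v t < 0"
proof -
  from DERIV_neg_dec_right[OF dv D] obtain d where d: "d > 0" "\<And>h. 0 < h \<Longrightarrow> h < d \<Longrightarrow> v (t0 + h) < 0"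
    using vt by auto
  \<comment> \<open>Starting at t0 + d/2 excludes the zero t0 itself, so the infimum of this closed
    set is the first zero after t0.\<close>
  define A where "A = {t0 + d / 2..t0 + P} \<inter> v -` {0}"
  have "\<not> P < d" using d(2)[of P] P vP by auto
  then have mem: "t0 + P \<in> A" using d(1) vP by (simp add: A_def)
  have "isCont v x" for x using cont by (simp add: continuous_on_eq_continuous_at)
  then have "closed A" unfolding A_def by (intro closed_Int continuous_closed_vimage) auto
  moreover have "bdd_below A" by (auto simp: A_def)
  ultimately have inf: "Inf A \<in> A" using mem by (intro closed_contains_Inf) auto
  define b where "b = Inf A"
  have b: "t0 + d/2 \<le> b" "b \<le> t0 + P" "v b = 0" using inf by (auto simp: A_def b_def)
  have neg: "v t < 0" if t: "t0 < t" "t < b" for t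
  proof (rule ccontr)
    assume "\<not> v t < 0"
    then have ge: "v t \<ge> 0" by simp
    have le: "t \<ge> t0 + d" using d(2)[of "t - t0"] t ge by force
    have "v (t0 + d/2) \<le> 0" using d by (intro less_imp_le d(2)) auto
    then obtain x where x: "t0 + d/2 \<le> x" "x \<le> t" "v x = 0"
      using IVT'[of v "t0 + d/2" 0 t] ge le d(1) continuous_on_subset[OF cont] by auto
    then have "x \<in> A" using t b by (simp add: A_def)
    then have "b \<le> x" unfolding b_def by (intro cInf_lower) (auto simp: A_def bdd_below_def)
    then show False using x t by simp
  qed
  with b d show ?thesis by (intro that[of b]) auto
qed

locale orbit =
  fixes \<alpha> \<beta> c P :: real and u v :: "real \<Rightarrow> real"
  assumes \<beta>: "\<beta> > 1" and \<alpha>: "\<alpha> > \<beta>" and c: "c > 0" and P: "P > 0"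
    and ode: "lienard c \<alpha> \<beta> u v"
    and per: "\<And>t. u (t + P) = u t" and v0: "v 0 = 0" and u0: "u 0 > 0"
begin

definition F where "F t = c * h_fun \<beta> (u t)"

lemma du: "(u has_real_derivative v t) (at t)"
  and dv: "(v has_real_derivative - (F t * v t + c^2 * k_fun \<alpha> \<beta> (u t))) (at t)"
  using lienardD[OF ode] by (auto simp: F_def)

lemma per_v: "v (t + P) = v t"
  using periodic_deriv[OF du, of P 1 t] per by simp

lemma cont_u: "continuous_on S u" and cont_v: "continuous_on S v"
  using derivs_imp_cont[OF du] derivs_imp_cont[OF dv] by auto

lemma cont_F: "continuous_on S F"
  unfolding F_def h_fun_def by (intro continuous_intros cont_u)

lemma per_F: "F (t + P) = F t"
  by (simp add: F_def per)

lemma bounded_uv: obtains K where "K > 0" "\<And>t. \<bar>u t\<bar> \<le> K" "\<And>t. \<bar>v t\<bar> \<le> K"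
proof -
  obtain K1 where "K1 > 0" "\<And>t. \<bar>u t\<bar> \<le> K1"
    using periodic_bounded[of u P] per P cont_u by metis
  moreover obtain K2 where "K2 > 0" "\<And>t. \<bar>v t\<bar> \<le> K2"
    using periodic_bounded[of v P] per_v P cont_v by metis
  ultimately have "max K1 K2 > 0" "\<bar>u t\<bar> \<le> max K1 K2" "\<bar>v t\<bar> \<le> max K1 K2" for t
    by (auto intro: max.coboundedI1 max.coboundedI2)
  then show ?thesis by (rule that)
qed

lemma k_sgn: "k_fun \<alpha> \<beta> x > 0 \<longleftrightarrow> x > 0" "k_fun \<alpha> \<beta> x < 0 \<longleftrightarrow> x < 0"
proof -
  have "k_fun \<alpha> \<beta> x = x * (\<alpha> - \<beta> + \<beta> * x^2)"
    by (simp add: k_fun_def power2_eq_square power3_eq_cube algebra_simps)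
  moreover have "\<alpha> - \<beta> + \<beta> * x^2 > 0" using \<alpha> \<beta> by (intro add_pos_nonneg) auto
  ultimately show "k_fun \<alpha> \<beta> x > 0 \<longleftrightarrow> x > 0" "k_fun \<alpha> \<beta> x < 0 \<longleftrightarrow> x < 0"
    by (simp_all add: zero_less_mult_iff mult_less_0_iff)
qed

section \<open>Positive mean damping along the orbit\<close>

definition Phi where "Phi = oint F"

lemma dPhi: "(Phi has_real_derivative F t) (at t)"
  unfolding Phi_def by (intro oint_has_derivative cont_F)

lemma Phi_0 [simp]: "Phi 0 = 0" by (simp add: Phi_def)

lemma Phi_shift: "Phi (t + P) = Phi t + Phi P"
proof -
  have "((\<lambda>t. Phi (t + P) - Phi t) has_real_derivative F (t + P) - F t) (at t)" for t
    by (intro DERIV_diff dPhi) (simp add: DERIV_shift[symmetric] dPhi)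
  then have "((\<lambda>t. Phi (t + P) - Phi t) has_real_derivative 0) (at t)" for t
    by (simp add: per_F)
  then have "Phi (t + P) - Phi t = Phi (0 + P) - Phi 0"
    using DERIV_isconst_all[of "\<lambda>t. Phi (t + P) - Phi t"] by blast
  then show ?thesis by simp
qed

lemma Phi_P_pos: "Phi P > 0"
proof -
  \<comment> \<open>Here s is the zero of h as a function of u^2, and y is the energy minus the
    potential at u^2 = s. The factored potential part has the sign of u^2 - s, as F does, so r is
    nonnegative.\<close>
  define s where "s = (\<beta> - 1) / (3 * \<beta>)"
  define y where "y t = (v t)^2 / 2 + c^2 * (((u t)^2 - s) * ((\<alpha> - \<beta>) / 2 + \<beta> * ((u t)^2 + s) / 4))" for t
  define z where "z t = y t * exp (2 * Phi t)" for t
  define r where "r t = 2 * F t * (c^2 * (((u t)^2 - s) * ((\<alpha> - \<beta>) / 2 + \<beta> * ((u t)^2 + s) / 4)))" for t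
  have s: "s > 0" using \<beta> by (simp add: s_def)
  have Fs: "F t = c * (3 * \<beta>) * ((u t)^2 - s)" for t
    using \<beta> by (simp add: F_def h_fun_def s_def field_simps)
  have pos: "(\<alpha> - \<beta>) / 2 + \<beta> * ((u t)^2 + s) / 4 > 0" for t
    using \<alpha> \<beta> s by (intro add_pos_nonneg) auto
  have dy: "(y has_real_derivative - F t * (v t)^2) (at t)" for t
  proof -
    have "(y has_real_derivative - (F t * v t + c^2 * k_fun \<alpha> \<beta> (u t)) * v t
        + c^2 * (2 * u t * v t * ((\<alpha> - \<beta>) / 2 + \<beta> * ((u t)^2 + s) / 4) + ((u t)^2 - s) * (\<beta> * (2 * u t * v t) / 4))) (at t)"
      unfolding y_def by (auto intro!: derivative_eq_intros du dv simp: k_fun_def field_simps power2_eq_square power3_eq_cube)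
    moreover have "- (F t * v t + c^2 * k_fun \<alpha> \<beta> (u t)) * v t
        + c^2 * (2 * u t * v t * ((\<alpha> - \<beta>) / 2 + \<beta> * ((u t)^2 + s) / 4) + ((u t)^2 - s) * (\<beta> * (2 * u t * v t) / 4)) = - F t * (v t)^2"
      by (simp add: k_fun_def field_simps power2_eq_square power3_eq_cube)
    ultimately show ?thesis by (simp only:)
  qed
  have dz: "(z has_real_derivative r t * exp (2 * Phi t)) (at t)" for t
    unfolding z_def by (rule derivative_eq_intros dy dPhi refl)+
      (simp add: y_def r_def field_simps)
  have r_eq: "r t = c^3 * (6 * \<beta>) * ((u t)^2 - s)^2 * ((\<alpha> - \<beta>) / 2 + \<beta> * ((u t)^2 + s) / 4)" for t
    unfolding r_def Fs power2_eq_square power3_eq_cube by (simp only: mult_ac)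
  have r_nn: "r t \<ge> 0" for t
    unfolding r_eq using c \<beta> pos[of t] by (intro mult_nonneg_nonneg) auto
  have mono: "z t \<le> z t'" if "t \<le> t'" for t t'
    using that dz by (rule_tac DERIV_nonneg_imp_nondecreasing) (auto intro!: exI mult_nonneg_nonneg r_nn)
  \<comment> \<open>Just after time 0 the velocity is negative, so F v^2 = 0 would make u^2 = s
    constant there and hence u v = 0.\<close>
  have nontriv: "\<exists>t. F t * (v t)^2 \<noteq> 0"
  proof (rule ccontr)
    assume "\<nexists>t. F t * (v t)^2 \<noteq> 0"
    then have 0: "(u t)^2 = s \<or> v t = 0" for t using c \<beta> by (auto simp: Fs)
    have "- (F 0 * v 0 + c^2 * k_fun \<alpha> \<beta> (u 0)) < 0" using k_sgn(1)[of "u 0"] u0 c by (simp add: v0)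
    from DERIV_neg_dec_right[OF dv this] obtain d where d: "d > 0" "\<And>h. 0 < h \<Longrightarrow> h < d \<Longrightarrow> v h < 0"
      using v0 by auto
    have "((\<lambda>t. (u t)^2) has_real_derivative 2 * u (d/2) * v (d/2)) (at (d/2))"
      by (auto intro!: derivative_eq_intros du)
    moreover have "((\<lambda>t. (u t)^2) has_real_derivative 0) (at (d/2))"
      by (rule has_field_derivative_transform_within_open[OF DERIV_const[of s], where S="{0<..<d}"])
         (use d 0 in force)+
    ultimately have "2 * u (d/2) * v (d/2) = 0" by (rule DERIV_unique)
    moreover have "v (d/2) < 0" using d by auto
    moreover have "u (d/2) \<noteq> 0" using 0[of "d/2"] \<open>v (d/2) < 0\<close> s by auto
    ultimately show False by simp
  qed
  have per_y: "y (t + P) = y t" for t by (simp add: y_def per per_v)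
  \<comment> \<open>If u^2 stayed at most s, then F \<le> 0 and the energy would be nondecreasing
    and periodic, hence constant, so F v^2 would vanish identically.\<close>
  obtain \<tau> where \<tau>: "(u \<tau>)^2 > s"
  proof (rule ccontr)
    assume "\<not> thesis"
    then have le: "(u t)^2 \<le> s" for t using that by (meson not_le_imp_less)
    have nn: "- F t * (v t)^2 \<ge> 0" for t
      using le[of t] c \<beta> by (simp add: Fs mult_nonneg_nonpos mult_nonpos_nonneg)
    have ymono: "y t \<le> y t'" if "t \<le> t'" for t t'
      using that dy nn by (rule_tac DERIV_nonneg_imp_nondecreasing) blast+
    have "y t = y 0" for t
    proof -
      obtain t' where "t' \<in> {0..P}" "y t' = y t" using periodic_reduce[of y P t] per_y P by metis
      moreover have "y (0 + P) = y 0" by (rule per_y)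
      ultimately show ?thesis using ymono[of 0 t'] ymono[of t' P] by auto
    qed
    then have "(y has_real_derivative 0) (at t)" for t
      using DERIV_const[of "y 0" "at t"] by (metis (no_types, lifting) ext)
    then have "F t * (v t)^2 = 0" for t using dy[of t] DERIV_unique by fastforce
    then show False using nontriv by blast
  qed
  have r_pos: "r \<tau> > 0" unfolding r_eq using c \<beta> pos[of \<tau>] \<tau> by simp
  have y_pos: "y \<tau> > 0" 
    unfolding y_def by (intro add_nonneg_pos mult_pos_pos pos) (use \<tau> c in auto)
  have "r \<tau> * exp (2 * Phi \<tau>) > 0" using r_pos by simp
  from DERIV_pos_inc_right[OF dz this] obtain d where d: "d > 0" "\<And>h. 0 < h \<Longrightarrow> h < d \<Longrightarrow> z \<tau> < z (\<tau> + h)"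
    by blast
  \<comment> \<open>The increase of z is strict right after \<tau>; the minimum with P keeps this
    step within one period. Since y is periodic and positive at \<tau>, the growth of z is carried
    by exp(2 Phi P).\<close>
  have "z \<tau> < z (\<tau> + min (d/2) P)" using d P by auto
  also have "\<dots> \<le> z (\<tau> + P)" by (intro mono) auto
  also have "\<dots> = z \<tau> * exp (2 * Phi P)"
    by (simp add: z_def per_y Phi_shift distrib_left exp_add)
  finally have "1 < exp (2 * Phi P)" using y_pos by (simp add: z_def)
  then show ?thesis by simp
qed

section \<open>The orbit and its reflection in the origin\<close>

lemma no_equilibrium: "u t \<noteq> 0 \<or> v t \<noteq> 0"
proof (rule ccontr)
  assume z: "\<not> ?thesis"
  obtain K where K: "K > 0" "\<And>t. \<bar>u t\<bar> \<le> K" "\<And>t. \<bar>v t\<bar> \<le> K" using bounded_uv by blast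
  have "lienard c \<alpha> \<beta> (\<lambda>_. 0) (\<lambda>_. 0)" by (simp add: lienard_def k_fun_def)
  then have "u 0 = 0 \<and> v 0 = 0"
    by (rule lienard_unique[OF ode, where ?t0.0=t and M=K]) (use K z in auto)
  then show False using u0 by simp
qed

text \<open>At a zero of v the acceleration is -c^2 k(u), negative for u > 0. Hence v can return to
  0 from below only where u < 0.\<close>

lemma descending_branch:
  assumes vt: "v tM = 0" and ut: "u tM > 0"
  obtains b where "tM < b" "v b = 0" "\<And>t. tM < t \<Longrightarrow> t < b \<Longrightarrow> v t < 0" "u b < 0"
proof -
  have "- (F tM * v tM + c^2 * k_fun \<alpha> \<beta> (u tM)) < 0" using k_sgn(1)[of "u tM"] ut c by (simp add: vt)
  moreover have "v (tM + P) = 0" using per_v vt by simp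
  ultimately obtain b where b: "tM < b" "v b = 0" "\<And>t. tM < t \<Longrightarrow> t < b \<Longrightarrow> v t < 0"
    using next_zero[OF cont_v dv vt] P by metis
  have "u b < 0"
  proof (rule ccontr)
    assume "\<not> u b < 0"
    then have "u b > 0" using no_equilibrium[of b] b by auto
    then have "- (F b * v b + c^2 * k_fun \<alpha> \<beta> (u b)) < 0" using k_sgn(1)[of "u b"] c by (simp add: b)
    from DERIV_neg_dec_left[OF dv this] obtain d' where d': "d' > 0" "\<And>h. 0 < h \<Longrightarrow> h < d' \<Longrightarrow> v (b - h) > 0"
      using b by auto
    define h where "h = min (d'/2) ((b - tM) / 2)"
    have "0 < h" "h < d'" "tM < b - h" using d' b(1) by (auto simp: h_def min_def field_simps)
    then show False using d'(2)[of h] b(3)[of "b - h"] by auto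
  qed
  with b show ?thesis by (intro that[of b]) auto
qed

text \<open>Time reversal: \<open>next_zero\<close> is applied to -v(-t), whose derivative at -tM is
  again the negative acceleration at tM.\<close>

lemma ascending_branch:
  assumes vt: "v tM = 0" and ut: "u tM > 0"
  obtains a where "a < tM" "v a = 0" "\<And>t. a < t \<Longrightarrow> t < tM \<Longrightarrow> v t > 0" "u a < 0"
proof -
  have neg: "- (F tM * v tM + c^2 * k_fun \<alpha> \<beta> (u tM)) < 0" using k_sgn(1)[of "u tM"] ut c by (simp add: vt)
  have "v (tM - P) = 0" using per_v[of "tM - P"] vt by simp
  then have vP: "- v (- (- tM + P)) = 0" by simp
  have dw: "((\<lambda>t. - v (- t)) has_real_derivative - (F tM * v tM + c^2 * k_fun \<alpha> \<beta> (u tM))) (at (- tM))"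
  proof -
    have "((\<lambda>t. v (- t)) has_real_derivative - (F tM * v tM + c^2 * k_fun \<alpha> \<beta> (u tM)) * (- 1)) (at (- tM))"
      by (rule DERIV_chain2[where g=uminus]) (use dv[of tM] in \<open>auto intro!: derivative_eq_intros\<close>)
    from DERIV_minus[OF this] show ?thesis by (simp only: mult_minus1_right minus_minus)
  qed
  have cw: "continuous_on UNIV (\<lambda>t. - v (- t))"
    by (intro continuous_intros continuous_on_compose2[OF cont_v[of UNIV]]) auto
  obtain b where b: "- tM < b" "- v (- b) = 0" "\<And>t. - tM < t \<Longrightarrow> t < b \<Longrightarrow> - v (- t) < 0"
    using next_zero[OF cw dw _ neg P vP] vt by auto
  have gt: "v t > 0" if "- b < t" "t < tM" for t using b(3)[of "- t"] that by auto
  have "u (- b) < 0"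
  proof (rule ccontr)
    assume "\<not> u (- b) < 0"
    then have "u (- b) > 0" using no_equilibrium[of "- b"] b by auto
    then have "- (F (- b) * v (- b) + c^2 * k_fun \<alpha> \<beta> (u (- b))) < 0" using k_sgn(1)[of "u (- b)"] c b by simp
    from DERIV_neg_dec_right[OF dv this] obtain d' where d': "d' > 0" "\<And>h. 0 < h \<Longrightarrow> h < d' \<Longrightarrow> v (- b + h) < 0"
      using b by auto
    define h where "h = min (d'/2) ((b + tM) / 2)"
    have "0 < h" "h < d'" "- b + h < tM" using d' b(1) by (auto simp: h_def min_def field_simps)
    then show False using d'(2)[of h] gt[of "- b + h"] by auto
  qed
  with b gt show ?thesis by (intro that[of "- b"]) auto
qed

text \<open>The descending branch from the maximum and the reflection of the ascending branch into the
  maximum are graphs over overlapping intervals. Each end of the overlap is an end point, with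
  \<open>v = 0\<close>, of a different branch, so the branches cross.\<close>

lemma meets_reflection_aux:
  assumes max: "\<And>t. \<bar>u t\<bar> \<le> u tM"
  shows "\<exists>t1 t2. u t1 = - u t2 \<and> v t1 = - v t2"
proof -
  have ut: "u tM > 0" using max[of 0] u0 by linarith
  have vt: "v tM = 0"
    by (rule DERIV_local_max[OF du, of 1]) (use max in \<open>auto simp: abs_le_iff\<close>)
  obtain b where b: "tM < b" "v b = 0" "\<And>t. tM < t \<Longrightarrow> t < b \<Longrightarrow> v t < 0" "u b < 0"
    using descending_branch[OF vt ut] by metis
  obtain a where a: "a < tM" "v a = 0" "\<And>t. a < t \<Longrightarrow> t < tM \<Longrightarrow> v t > 0" "u a < 0"
    using ascending_branch[OF vt ut] by metis
  have incr: "u x < u y" if "a \<le> x" "x < y" "y \<le> tM" for x y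
    using that a(3) by (intro DERIV_pos_imp_increasing_open[of x y u]) (auto intro!: exI du cont_u)
  \<comment> \<open>Inverting u on the ascending branch makes v a function of u there.\<close>
  define g where "g = inv_into {a..tM} u"
  have inj: "inj_on u {a..tM}"
    by (intro strict_mono_on_imp_inj_on strict_mono_onI) (auto intro: incr)
  have gu: "g (u x) = x" if "x \<in> {a..tM}" for x using inv_into_f_f[OF inj that] by (simp add: g_def)
  have im: "u ` {a..tM} = {u a..u tM}"
  proof
    show "u ` {a..tM} \<subseteq> {u a..u tM}" using incr by (force simp: le_less)
    show "{u a..u tM} \<subseteq> u ` {a..tM}"
      using IVT'[of u a _ tM] a(1) cont_u by (force simp: image_iff)
  qed
  have cg: "continuous_on {u a..u tM} g"
    unfolding im[symmetric] by (intro continuous_on_inv cont_u) (auto simp: gu)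
  have ug: "u (g x) = x" and gm: "g x \<in> {a..tM}" if "x \<in> {u a..u tM}" for x
    using that unfolding im[symmetric] g_def by (auto simp only: f_inv_into_f inv_into_into)
  have ia: "- u a \<in> {u b..u tM}" using a(4) b(4) max[of a] by auto
  \<comment> \<open>The overlap of the two graphs begins at ts, where the descending branch reaches
    the height of the reflected lower end of the ascending one.\<close>
  obtain ts where ts: "tM \<le> ts" "ts \<le> b" "u ts = - u a"
    using IVT2'[of u b "- u a" tM] ia b(1) cont_u by auto
  have decr: "u x \<ge> u y" if "tM \<le> x" "x \<le> y" "y \<le> b" for x y
  proof (cases "x = y")
    case False
    then have "u y < u x"
      using that b(3) by (intro DERIV_neg_imp_decreasing_open[of x y u]) (auto intro!: exI du cont_u)
    then show ?thesis by simp
  qed auto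
  have rng: "- u t \<in> {u a..u tM}" if "t \<in> {ts..b}" for t
    using that decr[of ts t] ts max[of t] by auto
  \<comment> \<open>A zero of D is a crossing of the descending branch with the reflected ascending
    one. One summand vanishes at each end of [ts, b], and the other fixes the sign.\<close>
  define D where "D t = v t + v (g (- u t))" for t
  have "continuous_on {ts..b} D"
    unfolding D_def by (intro continuous_intros cont_v continuous_on_compose2[OF cont_v[of UNIV]]
        continuous_on_compose2[OF cg] cont_u) (use rng in auto)
  moreover have "D ts \<le> 0"
  proof -
    have "v ts \<le> 0" using b(2,3) ts vt by (cases "ts = tM \<or> ts = b") (auto simp: less_imp_le)
    moreover have "g (- u ts) = a" using gu[of a] ts a(1) by simp
    ultimately show ?thesis by (simp add: D_def a)
  qed
  moreover have "0 \<le> D b"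
  proof -
    have "g (- u b) \<in> {a..tM}" by (intro gm rng) (use ts in auto)
    then have "v (g (- u b)) \<ge> 0" using a(2,3) vt by (cases "g (- u b) = a \<or> g (- u b) = tM") (auto simp: less_imp_le)
    then show ?thesis by (simp add: D_def b)
  qed
  ultimately obtain t where t: "ts \<le> t" "t \<le> b" "D t = 0"
    using IVT'[of D ts 0 b] ts by auto
  then have "u t = - u (g (- u t)) \<and> v t = - v (g (- u t))"
    using ug[OF rng[of t]] by (simp add: D_def)
  then show ?thesis by blast
qed

end

lemma (in orbit) meets_reflection: "\<exists>t1 t2. u t1 = - u t2 \<and> v t1 = - v t2"
proof -
  have "\<exists>x\<in>{0..P}. \<forall>y\<in>{0..P}. \<bar>u y\<bar> \<le> \<bar>u x\<bar>"
    using P by (intro continuous_attains_sup continuous_intros cont_u) auto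
  then obtain tM where tM: "\<And>y. y \<in> {0..P} \<Longrightarrow> \<bar>u y\<bar> \<le> \<bar>u tM\<bar>" by blast
  have max: "\<bar>u t\<bar> \<le> \<bar>u tM\<bar>" for t
  proof -
    obtain y where "y \<in> {0..P}" "u y = u t" using periodic_reduce[of u P t] per P by metis
    then show ?thesis using tM[of y] by simp
  qed
  show ?thesis
  proof (cases "u tM > 0")
    case True
    then show ?thesis using meets_reflection_aux[of tM] max by simp
  next
    case False
    have ne: "u tM < 0" using False max[of 0] u0 by linarith
    have v: "v tM = 0"
      by (rule DERIV_local_min[OF du, of 1]) (use max ne in \<open>auto simp: abs_le_iff\<close>)
    \<comment> \<open>If |u| is largest at a negative value, the reflected orbit started there falls
      under the previous case, and the conclusion is invariant under reflection.\<close>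
    interpret neg: orbit \<alpha> \<beta> c P "\<lambda>t. - u (t + tM)" "\<lambda>t. - v (t + tM)"
    proof
      show "lienard c \<alpha> \<beta> (\<lambda>t. - u (t + tM)) (\<lambda>t. - v (t + tM))"
        by (intro lienard_uminus lienard_shift ode)
      show "- u (t + P + tM) = - u (t + tM)" for t using per[of "t + tM"] by (simp add: ac_simps)
    qed (use \<beta> \<alpha> c P v ne in auto)
    have "\<exists>t1 t2. - u (t1 + tM) = - (- u (t2 + tM)) \<and> - v (t1 + tM) = - (- v (t2 + tM))"
      by (rule neg.meets_reflection_aux[of 0]) (use max ne in auto)
    then show ?thesis by (metis minus_minus)
  qed
qed

text \<open>A common point with the reflected orbit gives u(t + delta) = -u(t). Then 2 delta is a
  period, so 2 delta = n P by minimality; even n would give u 0 = -u 0, and odd n leaves delta = P/2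
  modulo P.\<close>

lemma (in orbit) half_period_antisymmetry:
  assumes minimal: "\<And>s. 0 < s \<Longrightarrow> s < P \<Longrightarrow> \<exists>t. u (t + s) \<noteq> u t"
  shows "u (t + P / 2) = - u t"
proof -
  interpret per: periodic_fun_simple u P by (simp add: periodic_fun_simple_iff per)
  obtain t1 t2 where t: "u t1 = - u t2" "v t1 = - v t2" using meets_reflection by blast
  obtain K where K: "K > 0" "\<And>t. \<bar>u t\<bar> \<le> K" "\<And>t. \<bar>v t\<bar> \<le> K" using bounded_uv by blast
  have shift: "u (t + t1) = - u (t + t2)" for t
    using lienard_unique[OF lienard_shift[OF ode, of t1] lienard_uminus[OF lienard_shift[OF ode, of t2]],
        where M=K and ?t0.0=0] K t by auto
  define \<delta> where "\<delta> = t1 - t2"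
  have anti: "u (t + \<delta>) = - u t" for t using shift[of "t - t2"] by (simp add: \<delta>_def algebra_simps)
  have per2: "u (t + 2 * \<delta>) = u t" for t using anti[of "t + \<delta>"] anti[of t] by (simp add: algebra_simps)
  define n where "n = \<lfloor>2 * \<delta> / P\<rfloor>"
  define s where "s = 2 * \<delta> - n * P"
  have "of_int n \<le> 2 * \<delta> / P" "2 * \<delta> / P < of_int n + 1" by (auto simp: n_def)
  then have s: "0 \<le> s" "s < P" using P by (auto simp: s_def field_simps)
  have "u (t + s) = u t" for t
    using per.minus_of_int[of "t + 2 * \<delta>" n] per2[of t] by (simp add: s_def algebra_simps)
  then have "s = 0" using minimal[of s] s by force
  then have d: "\<delta> = n * P / 2" by (simp add: s_def)
  show ?thesis
  proof (cases "even n")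
    case True
    then obtain k where "n = 2 * k" by (elim evenE)
    then have "u (0 + \<delta>) = u 0" using per.plus_of_int[of 0 k] d by simp
    then show ?thesis using anti[of 0] u0 by simp
  next
    case False
    then obtain k where "n = 2 * k + 1" by (elim oddE)
    then have "\<delta> = P / 2 + k * P" by (simp add: d field_simps)
    then have "u (t + \<delta>) = u (t + P / 2)" using per.plus_of_int[of "t + P / 2" k] by (simp add: algebra_simps)
    then show ?thesis using anti[of t] by simp
  qed
qed

section \<open>Linearization along the closed orbit\<close>

lemma (in orbit) linear_hom_zero:
  assumes B: "\<And>t. B (t + P) = B t" "continuous_on UNIV B"
    and d: "\<And>t. (d has_real_derivative w t) (at t)"
    and w: "\<And>t. (w has_real_derivative - (F t * w t + B t * d t)) (at t)"
    and z: "d 0 = 0" "w 0 = 0"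
  shows "d t = 0 \<and> w t = 0"
proof -
  obtain K1 where K1: "\<And>t. \<bar>F t\<bar> \<le> K1" using periodic_bounded[of F P] per_F P cont_F by metis
  obtain K2 where K2: "\<And>t. \<bar>B t\<bar> \<le> K2" using periodic_bounded[of B P] B P by metis
  show ?thesis
    by (rule linear_zero[OF d w _ _ z, where L="max K1 K2"]) (use K1 K2 in \<open>auto intro: max.coboundedI1 max.coboundedI2\<close>)
qed

locale driven = orbit \<alpha> \<beta> c P u v for \<alpha> \<beta> c P :: real and u v :: "real \<Rightarrow> real" +
  fixes \<rho> \<Omega>\<^sub>0 :: real and p q :: nat and W :: "real \<Rightarrow> real^2^2"
  assumes c_eq: "c = 1 / (\<rho> * \<Omega>\<^sub>0)" and P_eq: "P = 2 * pi * \<rho>" and rho: "\<rho> = real p / real q"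
    and pq: "p > 0" "q > 0" and v_eq: "v = deriv u"
    and W: "fundamental_matrix (linearization \<alpha> \<beta> \<rho> \<Omega>\<^sub>0 u) W"
begin

lemma inv_c: "1 / (\<rho> * \<Omega>\<^sub>0) = c" "2 / (\<rho> * \<Omega>\<^sub>0) = 2 * c" "1 / (\<rho>^2 * \<Omega>\<^sub>0^2) = c^2"
  by (simp_all add: c_eq power_divide power_mult_distrib)

lemma deriv_u: "deriv u = v" by (simp add: v_eq)

text \<open>The common period of the forcing (p periods 2 pi) and of the orbit (q periods
  P).\<close>

abbreviation "Q \<equiv> 2 * pi * real p"

lemma Q_eq: "Q = real q * P" using pq by (simp add: P_eq rho)
lemma Q_pos: "Q > 0" using pq by simp

lemma per_q: "u (t + Q) = u t" "v (t + Q) = v t" "F (t + Q) = F t"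
proof -
  interpret u: periodic_fun_simple u P by (simp add: periodic_fun_simple_iff per)
  interpret v: periodic_fun_simple v P by (simp add: periodic_fun_simple_iff per_v)
  show 1: "u (t + Q) = u t" and "v (t + Q) = v t" unfolding Q_eq by (rule u.plus_of_nat v.plus_of_nat)+
  show "F (t + Q) = F t" using 1 by (simp add: F_def)
qed

definition B where "B t = c * (6 * \<beta> * u t) * v t + c^2 * (\<alpha> - \<beta> + 3 * \<beta> * (u t)^2)"

lemma cont_B: "continuous_on S B"
  unfolding B_def by (intro continuous_intros cont_u cont_v)

lemma per_B: "B (t + P) = B t" by (simp add: B_def per per_v)
lemma per_B_q: "B (t + Q) = B t" by (simp add: B_def per_q)

lemma deriv_f: "deriv (f_fun \<beta> \<rho> \<Omega>\<^sub>0) x = c * (6 * \<beta> * x)"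
  unfolding f_fun_def[abs_def] h_fun_def inv_c by (rule DERIV_imp_deriv) (auto intro!: derivative_eq_intros)

lemma deriv_g: "deriv (g_fun \<alpha> \<beta> \<rho> \<Omega>\<^sub>0) x = c^2 * (\<alpha> - \<beta> + 3 * \<beta> * x^2)"
  unfolding g_fun_def[abs_def] k_fun_def inv_c
  by (rule DERIV_imp_deriv) (auto intro!: derivative_eq_intros)

lemma B_eq: "deriv (f_fun \<beta> \<rho> \<Omega>\<^sub>0) (u t) * deriv u t + deriv (g_fun \<alpha> \<beta> \<rho> \<Omega>\<^sub>0) (u t) = B t"
  by (simp add: deriv_f deriv_g B_def deriv_u)

lemma f_fun_eq: "f_fun \<beta> \<rho> \<Omega>\<^sub>0 (u t) = F t"
  by (simp add: f_fun_def F_def inv_c(1)[simplified])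

lemma dW: "((\<lambda>t. W t $ 1 $ j) has_real_derivative W t $ 2 $ j) (at t)"
  "((\<lambda>t. W t $ 2 $ j) has_real_derivative - (F t * W t $ 2 $ j + B t * W t $ 1 $ j)) (at t)"
proof -
  have "(W has_vector_derivative (linearization \<alpha> \<beta> \<rho> \<Omega>\<^sub>0 u t ** W t)) (at t)"
    using W by (simp add: fundamental_matrix_def)
  then have "((\<lambda>t. W t $ i $ j) has_vector_derivative (linearization \<alpha> \<beta> \<rho> \<Omega>\<^sub>0 u t ** W t) $ i $ j) (at t)" for i
    by (intro bounded_linear.has_vector_derivative[OF bounded_linear_vec_nth])
  from this[of 1] this[of 2] show "((\<lambda>t. W t $ 1 $ j) has_real_derivative W t $ 2 $ j) (at t)"
    "((\<lambda>t. W t $ 2 $ j) has_real_derivative - (F t * W t $ 2 $ j + B t * W t $ 1 $ j)) (at t)"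
    unfolding has_real_derivative_iff_has_vector_derivative linearization_def B_eq f_fun_eq
    by (simp_all add: matrix_matrix_mult_def sum_2 vector_2 algebra_simps)
qed

lemma W0: "W 0 $ 1 $ 1 = 1" "W 0 $ 1 $ 2 = 0" "W 0 $ 2 $ 1 = 0" "W 0 $ 2 $ 2 = 1"
  using W by (auto simp: fundamental_matrix_def mat_def)

text \<open>The second derivative of u at 0, where v vanishes.\<close>

definition a0 where "a0 = - (c^2 * k_fun \<alpha> \<beta> (u 0))"

lemma a0: "a0 < 0" using k_sgn(1)[of "u 0"] u0 c by (simp add: a0_def)

text \<open>Differentiating the autonomous equation shows that v solves the linearized one, with
  initial data (0, a0). Hence the second column of W is periodic, which is the multiplier 1.\<close>

lemma v_W: "v t = a0 * W t $ 1 $ 2" "- (F t * v t + c^2 * k_fun \<alpha> \<beta> (u t)) = a0 * W t $ 2 $ 2"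
proof -
  have ddv: "((\<lambda>t. - (F t * v t + c^2 * k_fun \<alpha> \<beta> (u t))) has_real_derivative
      - (F t * (- (F t * v t + c^2 * k_fun \<alpha> \<beta> (u t))) + B t * v t)) (at t)" for t
    unfolding F_def[abs_def] h_fun_def k_fun_def
    by (rule derivative_eq_intros du dv refl)+
       (simp add: B_def F_def h_fun_def k_fun_def algebra_simps power2_eq_square power3_eq_cube)
  have "v t - a0 * W t $ 1 $ 2 = 0 \<and> - (F t * v t + c^2 * k_fun \<alpha> \<beta> (u t)) - a0 * W t $ 2 $ 2 = 0"
  proof (rule linear_hom_zero[OF per_B cont_B, where d="\<lambda>t. v t - a0 * W t $ 1 $ 2"
        and w="\<lambda>t. - (F t * v t + c^2 * k_fun \<alpha> \<beta> (u t)) - a0 * W t $ 2 $ 2"])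
    show "((\<lambda>t. v t - a0 * W t $ 1 $ 2) has_real_derivative
        - (F t * v t + c^2 * k_fun \<alpha> \<beta> (u t)) - a0 * W t $ 2 $ 2) (at t)" for t
      by (intro DERIV_diff dv DERIV_cmult dW)
    show "((\<lambda>t. - (F t * v t + c^2 * k_fun \<alpha> \<beta> (u t)) - a0 * W t $ 2 $ 2) has_real_derivative
        - (F t * (- (F t * v t + c^2 * k_fun \<alpha> \<beta> (u t)) - a0 * W t $ 2 $ 2) + B t * (v t - a0 * W t $ 1 $ 2))) (at t)" for t
      using DERIV_diff[OF ddv[of t] DERIV_cmult[OF dW(2)[of 2 t], of a0]] by (simp add: algebra_simps)
  qed (simp_all add: v0 W0 a0_def)
  then show "v t = a0 * W t $ 1 $ 2" "- (F t * v t + c^2 * k_fun \<alpha> \<beta> (u t)) = a0 * W t $ 2 $ 2" by auto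
qed

lemma per_W2: "W (t + P) $ 1 $ 2 = W t $ 1 $ 2" "W (t + P) $ 2 $ 2 = W t $ 2 $ 2"
  using v_W(1)[of t] v_W(1)[of "t + P"] v_W(2)[of t] v_W(2)[of "t + P"] a0
  by (auto simp: per per_v per_F)

definition m1 where "m1 = exp (- Phi P)"
lemma m1: "m1 > 0" "m1 < 1" using Phi_P_pos by (auto simp: m1_def)

text \<open>After one period the first column of W is m1 times itself plus W21(P) times the periodic
  second column. Subtracting kappa times that column diagonalizes the monodromy; m1 < 1 makes kappa
  well defined.\<close>

definition \<kappa> where "\<kappa> = W P $ 2 $ 1 / (1 - m1)"
definition y2 where "y2 t = W t $ 1 $ 1 - \<kappa> * W t $ 1 $ 2"
definition z2 where "z2 t = W t $ 2 $ 1 - \<kappa> * W t $ 2 $ 2"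

lemma det_W: "W t $ 1 $ 1 * W t $ 2 $ 2 - W t $ 1 $ 2 * W t $ 2 $ 1 = exp (- Phi t)"
proof -
  define G where "G t = (W t $ 1 $ 1 * W t $ 2 $ 2 - W t $ 1 $ 2 * W t $ 2 $ 1) * exp (Phi t)" for t
  have "(G has_real_derivative 0) (at t)" for t
    unfolding G_def by (rule derivative_eq_intros dW dPhi refl)+ (simp add: algebra_simps)
  then have "G t = G 0" by (metis DERIV_isconst_all)
  then show ?thesis by (simp add: G_def W0 exp_minus field_simps)
qed

lemma y2_shift: "y2 (t + P) = m1 * y2 t"
proof -
  have WP: "W P $ 1 $ 2 = 0" "W P $ 2 $ 2 = 1" using per_W2[of 0] by (auto simp: W0)
  then have W11: "W P $ 1 $ 1 = m1" using det_W[of P] by (simp add: m1_def)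
  let ?d = "\<lambda>i t. W (t + P) $ i $ 1 - m1 * W t $ i $ 1 - W P $ 2 $ 1 * W t $ i $ 2"
  have "?d 1 t = 0 \<and> ?d 2 t = 0"
  proof (rule linear_hom_zero[OF per_B cont_B, where d="?d 1" and w="?d 2"])
    show "(?d 1 has_real_derivative ?d 2 t) (at t)" for t
      using DERIV_diff[OF DERIV_diff[OF dW(1)[of 1 "t + P", unfolded DERIV_shift] DERIV_cmult[OF dW(1)[of 1 t], of m1]]
          DERIV_cmult[OF dW(1)[of 2 t], of "W P $ 2 $ 1"]] .
    show "(?d 2 has_real_derivative - (F t * ?d 2 t + B t * ?d 1 t)) (at t)" for t
    proof -
      have "((\<lambda>t. W (t + P) $ 2 $ 1) has_real_derivative - (F t * W (t + P) $ 2 $ 1 + B t * W (t + P) $ 1 $ 1)) (at t)"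
        using dW(2)[of 1 "t + P"] unfolding DERIV_shift per_F per_B .
      from DERIV_diff[OF DERIV_diff[OF this DERIV_cmult[OF dW(2)[of 1 t], of m1]] DERIV_cmult[OF dW(2)[of 2 t], of "W P $ 2 $ 1"]]
      show ?thesis by (simp add: algebra_simps)
    qed
  qed (simp_all add: W0 W11)
  then have "W (t + P) $ 1 $ 1 = m1 * W t $ 1 $ 1 + W P $ 2 $ 1 * W t $ 1 $ 2" by simp
  moreover have "W P $ 2 $ 1 = \<kappa> * (1 - m1)" using m1 by (simp add: \<kappa>_def)
  ultimately show ?thesis unfolding y2_def per_W2 by (simp add: algebra_simps)
qed

lemma y2_shift_nat: "y2 (t + real n * P) = m1 ^ n * y2 t"
proof (induction n)
  case (Suc n)
  then show ?case using y2_shift[of "t + real n * P"] by (simp add: algebra_simps)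
qed simp

text \<open>With this scale \<open>fl.chi\<close> is the derivative of the unperturbed equation in
  1/omega (\<open>chi_eq\<close>), and s is the value of \<open>A_const\<close>.\<close>

definition s where "s = - a0 / c"
lemma s_pos: "s > 0" using a0 c unfolding s_def by (intro divide_pos_pos) auto

text \<open>All multiples of P are treated at once: n = 1 serves \<open>A_const\<close>, n = q the 2
  pi p-periodic recursion.\<close>

lemma floquet_nat:
  assumes n: "n > 0"
  shows "floquet F B (\<lambda>t. W t $ 1 $ 2) (\<lambda>t. W t $ 2 $ 2) y2 z2 Phi (real n * P) (m1 ^ n) s"
proof
  interpret y: periodic_fun_simple "\<lambda>t. W t $ 1 $ 2" P by (simp add: periodic_fun_simple_iff per_W2)
  interpret F: periodic_fun_simple F P by (simp add: periodic_fun_simple_iff per_F)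
  interpret B: periodic_fun_simple B P by (simp add: periodic_fun_simple_iff per_B)
  show "W (t + real n * P) $ 1 $ 2 = W t $ 1 $ 2" for t by (rule y.plus_of_nat)
  show "F (t + real n * P) = F t" "B (t + real n * P) = B t" for t by (rule F.plus_of_nat B.plus_of_nat)+
  show "(y2 has_real_derivative z2 t) (at t)" for t
    unfolding y2_def z2_def by (intro DERIV_diff DERIV_cmult dW)
  show "(z2 has_real_derivative - (F t * z2 t + B t * y2 t)) (at t)" for t
    using DERIV_diff[OF dW(2)[of 1 t] DERIV_cmult[OF dW(2)[of 2 t], of \<kappa>]]
    unfolding y2_def z2_def by (simp add: algebra_simps)
  show "m1 ^ n \<noteq> 1" using power_less_one_iff[of m1 n] m1 n by auto
qed (use P n s_pos m1 dW dPhi in \<open>auto simp: W0 y2_def[of 0] y2_shift_nat cont_F cont_B\<close>)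

sublocale fl: floquet F B "\<lambda>t. W t $ 1 $ 2" "\<lambda>t. W t $ 2 $ 2" y2 z2 Phi Q "m1 ^ q" s
  unfolding Q_eq by (rule floquet_nat) (use pq in simp)

definition chi where "chi t = v t * h_fun \<beta> (u t) + 2 * c * k_fun \<alpha> \<beta> (u t)"

lemma chi_eq: "fl.chi t = chi t"
proof -
  have "c * s = - a0" using c by (simp add: s_def)
  then have "c * fl.chi t = - (2 * (a0 * W t $ 2 $ 2) + F t * (a0 * W t $ 1 $ 2))"
    unfolding fl.chi_def mult.assoc[symmetric] by (simp add: algebra_simps)
  also have "\<dots> = c * chi t"
    unfolding v_W[symmetric] by (simp add: chi_def F_def algebra_simps power2_eq_square)
  finally show ?thesis using c by simp
qed

section \<open>Identification of the averaged quantities and of the recursion step\<close>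

lemma f_mean_eq: "f_mean \<beta> \<rho> \<Omega>\<^sub>0 u = Phi P / P"
  using integral_eq_of_antideriv[OF dPhi, of 0 P] P
  by (simp add: f_mean_def average_def f_fun_eq P_eq)

lemma F_tilde_eq: "F_tilde \<beta> \<rho> \<Omega>\<^sub>0 u t = Phi t - Phi P / P * t"
proof -
  let ?f = "\<lambda>s. F s - Phi P / P"
  have "F_tilde \<beta> \<rho> \<Omega>\<^sub>0 u t = oint ?f t"
    by (simp add: F_tilde_def oint_def f_fun_eq f_mean_eq)
  moreover have "((\<lambda>t. oint ?f t - (Phi t - Phi P / P * t)) has_real_derivative ?f t - (F t - Phi P / P * 1)) (at t)" for t
    by (intro DERIV_diff DERIV_cmult oint_has_derivative dPhi continuous_intros cont_F DERIV_ident)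
  then have "oint ?f t - (Phi t - Phi P / P * t) = oint ?f 0 - (Phi 0 - Phi P / P * 0)"
    using DERIV_isconst_all[of "\<lambda>t. oint ?f t - (Phi t - Phi P / P * t)" t 0] by simp
  ultimately show ?thesis by simp
qed

text \<open>The decomposition is W11 = kappa W12 + y2. For uniqueness, the difference of two
  candidates times exp(-f0 t) is P-periodic and also multiplied by m1 < 1 over each period, so it
  vanishes.\<close>

lemma b_fun_eq: "b_fun \<beta> \<rho> \<Omega>\<^sub>0 u W = (\<lambda>t. exp (Phi P / P * t) * y2 t)"
  unfolding b_fun_def
proof (rule the_equality, unfold f_mean_eq P_eq[symmetric])
  let ?b = "\<lambda>t. exp (Phi P / P * t) * y2 t"
  have "exp (Phi P / P * (t + P)) = exp (Phi P / P * t) * exp (Phi P)" for t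
    using P by (simp add: distrib_left exp_add)
  moreover have "exp (Phi P) * m1 = 1" by (simp add: m1_def exp_minus)
  ultimately have perb: "?b (t + P) = ?b t" for t by (simp add: y2_shift)
  have eq: "W t $ 1 $ 1 = \<kappa> * W t $ 1 $ 2 + exp (- (Phi P / P) * t) * ?b t" for t
    by (simp add: y2_def mult.assoc[symmetric] exp_add[symmetric])
  show "periodic_fun_simple ?b P \<and>
    (\<exists>a. periodic_fun_simple a P \<and> (\<forall>\<tau>. W \<tau> $ 1 $ 1 = a \<tau> + exp (- (Phi P / P) * \<tau>) * ?b \<tau>))"
    using perb eq per_W2 by (auto simp: periodic_fun_simple_iff intro!: exI[of _ "\<lambda>t. \<kappa> * W t $ 1 $ 2"])
  fix b
  assume "periodic_fun_simple b P \<and>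
    (\<exists>a. periodic_fun_simple a P \<and> (\<forall>\<tau>. W \<tau> $ 1 $ 1 = a \<tau> + exp (- (Phi P / P) * \<tau>) * b \<tau>))"
  then obtain a where b: "\<And>t. b (t + P) = b t" and a: "\<And>t. a (t + P) = a t"
    and W': "\<And>t. W t $ 1 $ 1 = a t + exp (- (Phi P / P) * t) * b t"
    by (auto simp: periodic_fun_simple_iff)
  show "b = ?b"
  proof
    fix t
    define e where "e t = exp (- (Phi P / P) * t)" for t
    have eP: "e (t + P) = m1 * e t" for t
      using P by (simp add: e_def m1_def exp_add[symmetric] distrib_left)
    have 1: "e t * (b t - ?b t) = \<kappa> * W t $ 1 $ 2 - a t" for t
      using W'[of t] eq[of t] by (simp add: e_def algebra_simps)
    have "m1 * e t * (b t - ?b t) = e t * (b t - ?b t)"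
      using 1[of "t + P"] unfolding eP b perb a per_W2 1[of t, symmetric] .
    then have "m1 * (e t * (b t - ?b t)) = e t * (b t - ?b t)" by (simp only: mult.assoc)
    then have "e t * (b t - ?b t) = 0" using m1(2) by (metis mult_cancel_right1 less_irrefl)
    then have "b t - ?b t = 0" by (simp add: e_def)
    then show "b t = ?b t" by simp
  qed
qed

lemma weight_eq: "weight \<beta> \<rho> \<Omega>\<^sub>0 u W t = fl.psi t"
  by (simp add: weight_def F_tilde_eq b_fun_eq fl.psi_def mult.assoc[symmetric] exp_add[symmetric])

lemma A_const_eq: "A_const \<alpha> \<beta> \<rho> \<Omega>\<^sub>0 u W = s"
proof -
  interpret f1: floquet F B "\<lambda>t. W t $ 1 $ 2" "\<lambda>t. W t $ 2 $ 2" y2 z2 Phi "real 1 * P" "m1 ^ 1" s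
    by (rule floquet_nat) simp
  have "weight \<beta> \<rho> \<Omega>\<^sub>0 u W t * (deriv u t * h_fun \<beta> (u t) + 2 / (\<rho> * \<Omega>\<^sub>0) * k_fun \<alpha> \<beta> (u t))
     = f1.psi t * f1.chi t" for t
    using chi_eq[of t]
    by (simp add: weight_eq fl.psi_def f1.psi_def f1.chi_def fl.chi_def chi_def deriv_u inv_c)
  then have "A_const \<alpha> \<beta> \<rho> \<Omega>\<^sub>0 u W = 1 / P * integral {0..real 1 * P} (\<lambda>t. f1.psi t * f1.chi t)"
    by (simp add: A_const_def average_def P_eq)
  also have "\<dots> = s" unfolding f1.integral_psi_chi using P by simp
  finally show ?thesis .
qed

lemma eps_of_eq: "eps_of \<alpha> \<beta> p \<rho> \<Omega>\<^sub>0 u W \<tau>\<^sub>0 L = fl.eps (Xi \<alpha> \<beta> \<tau>\<^sub>0 L)"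
  using s_pos pq by (simp add: eps_of_def D_of_def A_const_eq weight_eq average_def fl.eps_def)

text \<open>Two classical solutions of the normalized periodic problem coincide by
  \<open>solves_lin_unique\<close>, which justifies the definite description in
  \<open>u_of\<close>.\<close>

lemma u_of_eq:
  assumes sol: "fl.solves_lin (Xi \<alpha> \<beta> \<tau>\<^sub>0 L) (fl.eps (Xi \<alpha> \<beta> \<tau>\<^sub>0 L)) w x"
  shows "u_of \<alpha> \<beta> p \<rho> \<Omega>\<^sub>0 u W \<tau>\<^sub>0 L = w"
proof -
  define e where "e = fl.eps (Xi \<alpha> \<beta> \<tau>\<^sub>0 L)"
  have chi_eq': "h_fun \<beta> (u t) * deriv u t + 2 / (\<rho> * \<Omega>\<^sub>0) * k_fun \<alpha> \<beta> (u t) = fl.chi t" for t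
    by (simp add: chi_eq chi_def deriv_u inv_c)
  show ?thesis
    unfolding u_of_def eps_of_eq B_eq f_fun_eq chi_eq'
  proof (rule the_equality, fold e_def)
    have dw: "\<And>t. (w has_real_derivative x t) (at t)"
      and dx: "\<And>t. (x has_real_derivative - (F t * x t + B t * w t + e * fl.chi t + Xi \<alpha> \<beta> \<tau>\<^sub>0 L t)) (at t)"
      and rest: "\<And>t. w (t + Q) = w t" "x 0 = 0"
      using sol by (auto simp: fl.solves_lin_def e_def)
    have dw': "deriv w = x" using dw DERIV_imp_deriv by blast
    have dx': "deriv x t = - (F t * x t + B t * w t + e * fl.chi t + Xi \<alpha> \<beta> \<tau>\<^sub>0 L t)" for t
      using dx DERIV_imp_deriv by blast
    show "periodic_fun_simple w Q \<and> deriv w 0 = 0 \<and>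
      solves_ode2 (\<lambda>\<tau> x dx ddx. ddx + F \<tau> * dx + B \<tau> * x + e * fl.chi \<tau> + Xi \<alpha> \<beta> \<tau>\<^sub>0 L \<tau>) w"
      using dw dx rest unfolding solves_ode2_def periodic_fun_simple_iff dw' dx'
      by (auto simp: real_differentiable_def)
    fix w' assume w': "periodic_fun_simple w' Q \<and> deriv w' 0 = 0 \<and>
      solves_ode2 (\<lambda>\<tau> x dx ddx. ddx + F \<tau> * dx + B \<tau> * x + e * fl.chi \<tau> + Xi \<alpha> \<beta> \<tau>\<^sub>0 L \<tau>) w'"
    have "fl.solves_lin (Xi \<alpha> \<beta> \<tau>\<^sub>0 L) e w' (deriv w')"
      unfolding fl.solves_lin_def
    proof (intro conjI allI)
      fix t
      show "(w' has_real_derivative deriv w' t) (at t)"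
        using w' by (simp add: solves_ode2_def DERIV_deriv_iff_real_differentiable)
      have "deriv (deriv w') t = - (F t * deriv w' t + B t * w' t + e * fl.chi t + Xi \<alpha> \<beta> \<tau>\<^sub>0 L t)"
        using w' by (simp add: solves_ode2_def algebra_simps add_eq_0_iff)
      moreover have "(deriv w' has_real_derivative deriv (deriv w') t) (at t)"
        using w' by (simp add: solves_ode2_def DERIV_deriv_iff_real_differentiable)
      ultimately show "(deriv w' has_real_derivative - (F t * deriv w' t + B t * w' t + e * fl.chi t + Xi \<alpha> \<beta> \<tau>\<^sub>0 L t)) (at t)"
        by simp
    qed (use w' in \<open>auto simp: periodic_fun_simple_iff\<close>)
    then show "w' = w" using fl.solves_lin_unique sol unfolding e_def by blast
  qed
qed

end

section \<open>The nonlinear remainder\<close>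

text \<open>Here h1 and k1 are the increments of h and k at u0, so every summand has two factors
  that vanish with v, w, e. Powers are written as products to let the estimates run factor by
  factor.\<close>

definition quad_rem :: "'a::comm_ring_1 \<Rightarrow> 'a \<Rightarrow> 'a \<Rightarrow> 'a \<Rightarrow> 'a \<Rightarrow> 'a \<Rightarrow> 'a \<Rightarrow> 'a \<Rightarrow> 'a" where
  "quad_rem \<alpha> \<beta> u0 v0 l0 v w e =
     (let h0 = 1 - \<beta> + 3 * \<beta> * (u0 * u0);
          h1 = 3 * \<beta> * (2 * u0 * v + v * v);
          k0 = (\<alpha> - \<beta>) * u0 + \<beta> * (u0 * u0 * u0);
          k1 = (\<alpha> - \<beta> + \<beta> * (3 * (u0 * u0) + 3 * u0 * v + v * v)) * v
      in h1 * e * v0 + h0 * (e * w) + l0 * (h1 * w) + h1 * e * w + l0 * v0 * (3 * \<beta>) * (v * v)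
         + l0 * l0 * (\<beta> * (3 * u0 + v)) * (v * v) + k0 * (e * e) + (2 * l0 + e) * (k1 * e))"

definition drive_rem :: "'a::comm_ring_1 \<Rightarrow> 'a \<Rightarrow> 'a \<Rightarrow> 'a \<Rightarrow> 'a \<Rightarrow> 'a" where
  "drive_rem S C u v l =
     (l * v * (3 * (u * u) - 1)) * S + (l * l * (u * u * u - u)) * S + (l * (u * u * u - u)) * C"

definition rem ::
  "'a::comm_ring_1 \<Rightarrow> 'a \<Rightarrow> 'a \<Rightarrow> 'a \<Rightarrow> 'a \<Rightarrow> 'a \<Rightarrow> 'a \<Rightarrow> 'a \<Rightarrow> 'a \<Rightarrow> 'a \<Rightarrow> 'a \<Rightarrow> 'a" where
  "rem \<alpha> \<beta> S C u0 v0 l0 v w e \<mu> =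
     quad_rem \<alpha> \<beta> u0 v0 l0 v w e + \<mu> * drive_rem S C (u0 + v) (v0 + w) (l0 + e)"

text \<open>An exact Taylor expansion, valid in any commutative ring: unperturbed equation,
  linearized operator with parameter increment e, remainder. It serves both formal power series and
  actual solutions.\<close>

lemma E_expr_split:
  "E_expr \<alpha> \<beta> S C (u0 + v) (v0 + w) (a + x) (l0 + e) \<mu> =
     (a + l0 * h_fun \<beta> u0 * v0 + l0^2 * k_fun \<alpha> \<beta> u0)
     + (x + l0 * h_fun \<beta> u0 * w + (l0 * (6 * \<beta> * u0) * v0 + l0^2 * (\<alpha> - \<beta> + 3 * \<beta> * u0^2)) * v
        + e * (v0 * h_fun \<beta> u0 + 2 * l0 * k_fun \<alpha> \<beta> u0))
     + rem \<alpha> \<beta> S C u0 v0 l0 v w e \<mu>"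
  unfolding E_expr_def h_fun_def k_fun_def rem_def quad_rem_def drive_rem_def Let_def power2_eq_square power3_eq_cube
  by (simp add: algebra_simps)

text \<open>Three classes of elements: big, small (vanishing with the perturbation) and tiny
  (second order). A product is tiny as soon as it contains two small factors or a tiny one.
  The relations are binary so that the same computation bounds values, increments and
  dependence on low-order coefficients.\<close>

locale graded =
  fixes B S T :: "real \<Rightarrow> 'a::comm_ring_1 \<Rightarrow> 'a \<Rightarrow> bool"
  assumes BB: "B m x x' \<Longrightarrow> B n y y' \<Longrightarrow> B (3 * m * n) (x * y) (x' * y')"
    and SS: "S m x x' \<Longrightarrow> S n y y' \<Longrightarrow> T (3 * m * n) (x * y) (x' * y')"
    and BS: "B m x x' \<Longrightarrow> S n y y' \<Longrightarrow> S (3 * m * n) (x * y) (x' * y')"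
    and BT: "B m x x' \<Longrightarrow> T n y y' \<Longrightarrow> T (3 * m * n) (x * y) (x' * y')"
    and Badd: "B m x x' \<Longrightarrow> B n y y' \<Longrightarrow> B (m + n) (x + y) (x' + y')"
    and Bdiff: "B m x x' \<Longrightarrow> B n y y' \<Longrightarrow> B (m + n) (x - y) (x' - y')"
    and Sadd: "S m x x' \<Longrightarrow> S n y y' \<Longrightarrow> S (m + n) (x + y) (x' + y')"
    and Tadd: "T m x x' \<Longrightarrow> T n y y' \<Longrightarrow> T (m + n) (x + y) (x' + y')"
    and SB: "S m x x' \<Longrightarrow> B m x x'" and TS: "T m x x' \<Longrightarrow> S m x x'"
    and B1: "B 1 1 1"
begin

lemma B2: "B (1 + 1) 2 2" using Badd[OF B1 B1] by simp
lemma B3: "B (1 + 1 + 1) 3 3" using Badd[OF Badd[OF B1 B1] B1] by simp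

lemma TB: "T m x x' \<Longrightarrow> B n y y' \<Longrightarrow> T (3 * n * m) (x * y) (x' * y')"
  using BT[of n y y' m x x'] by (simp add: mult_ac)

context
  fixes \<alpha> \<beta> s c u0 v0 l0 v w e \<mu> v' w' e' \<mu>' :: 'a and K :: real
  assumes a: "B K \<alpha> \<alpha>" and b: "B K \<beta> \<beta>" and s: "B K s s" and c: "B K c c"
    and u0: "B K u0 u0" and v0: "B K v0 v0" and l0: "B K l0 l0"
    and v: "S 1 v v'" and w: "S 1 w w'" and e: "S 1 e e'" and \<mu>: "T 1 \<mu> \<mu>'"
begin

lemmas uu = BB[OF u0 u0]
lemmas h0 = Badd[OF Bdiff[OF B1 b] BB[OF BB[OF B3 b] uu]]
lemmas h1 = BS[OF BB[OF B3 b] Sadd[OF BS[OF BB[OF B2 u0] v] TS[OF SS[OF v v]]]]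
lemmas k0 = Badd[OF BB[OF Bdiff[OF a b] u0] BB[OF b BB[OF uu u0]]]
lemmas k1 = BS[OF Badd[OF Bdiff[OF a b] BB[OF b Badd[OF Badd[OF BB[OF B3 uu] BB[OF BB[OF B3 u0] SB[OF v]]] SB[OF TS[OF SS[OF v v]]]]]] v]
text \<open>The composition mirrors the expression tree of \<open>quad_rem\<close>; the resulting
  bound is an explicit polynomial in K that is never written out.\<close>

lemmas quad_graded = Tadd[OF Tadd[OF Tadd[OF Tadd[OF Tadd[OF Tadd[OF Tadd[OF
    TB[OF SS[OF h1 e] v0] BT[OF h0 SS[OF e w]]] BT[OF l0 SS[OF h1 w]]] TB[OF SS[OF h1 e] SB[OF w]]]
    BT[OF BB[OF BB[OF l0 v0] BB[OF B3 b]] SS[OF v v]]]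
    BT[OF BB[OF BB[OF l0 l0] BB[OF b Badd[OF BB[OF B3 u0] SB[OF v]]]] SS[OF v v]]]
    BT[OF k0 SS[OF e e]]] BT[OF Badd[OF BB[OF B2 l0] SB[OF e]] SS[OF k1 e]]]
lemmas U = Badd[OF u0 SB[OF v]] and V = Badd[OF v0 SB[OF w]] and L = Badd[OF l0 SB[OF e]]
lemmas U3 = Bdiff[OF BB[OF BB[OF U U] U] U]
lemmas drive_graded = Badd[OF Badd[OF
    BB[OF BB[OF BB[OF L V] Bdiff[OF BB[OF B3 BB[OF U U]] B1]] s] BB[OF BB[OF BB[OF L L] U3] s]]
    BB[OF BB[OF L U3] c]]
lemmas rem_graded = Tadd[OF quad_graded TB[OF \<mu> drive_graded]]

end
end

definition rem_estimate :: "'a::comm_ring_1 itself \<Rightarrow> real \<Rightarrow> real \<Rightarrow> bool" where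
  "rem_estimate _ K M \<longleftrightarrow> (\<forall>(B::real \<Rightarrow> 'a \<Rightarrow> 'a \<Rightarrow> bool) S T \<alpha> \<beta> s c u0 v0 l0 v w e \<mu> v' w' e' \<mu>'.
     graded B S T \<longrightarrow> B K \<alpha> \<alpha> \<longrightarrow> B K \<beta> \<beta> \<longrightarrow> B K s s \<longrightarrow> B K c c \<longrightarrow> B K u0 u0 \<longrightarrow> B K v0 v0 \<longrightarrow>
     B K l0 l0 \<longrightarrow> S 1 v v' \<longrightarrow> S 1 w w' \<longrightarrow> S 1 e e' \<longrightarrow> T 1 \<mu> \<mu>' \<longrightarrow>
     T M (rem \<alpha> \<beta> s c u0 v0 l0 v w e \<mu>) (rem \<alpha> \<beta> s c u0 v0 l0 v' w' e' \<mu>'))"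

text \<open>The witness is found by unification with the bound of \<open>rem_graded\<close>. It
  depends on K only, so it is available before the relations, and with them theta, are
  chosen.\<close>

lemma rem_estimate_ex: "\<exists>M. rem_estimate TYPE('a::comm_ring_1) K M"
  unfolding rem_estimate_def rem_def quad_rem_def drive_rem_def Let_def
  by (intro exI allI impI) (rule graded.rem_graded; assumption)

lemma rem_estimateD:
  fixes B S T :: "real \<Rightarrow> 'a::comm_ring_1 \<Rightarrow> 'a \<Rightarrow> bool"
  assumes "rem_estimate TYPE('a) K M" and "graded B S T"
    and "B K \<alpha> \<alpha>" "B K \<beta> \<beta>" "B K s s" "B K c c" "B K u0 u0" "B K v0 v0" "B K l0 l0"
    and "S 1 v v'" "S 1 w w'" "S 1 e e'" "T 1 \<mu> \<mu>'"
  shows "T M (rem \<alpha> \<beta> s c u0 v0 l0 v w e \<mu>) (rem \<alpha> \<beta> s c u0 v0 l0 v' w' e' \<mu>')"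
  by (rule assms(1)[unfolded rem_estimate_def, rule_format, OF assms(2-)])

section \<open>A quadratically stable majorant\<close>

definition inv_sq :: "nat \<Rightarrow> real" where "inv_sq k = (if k = 0 then 0 else 1 / (real k)^2)"

lemma inv_sq_nonneg: "inv_sq k \<ge> 0" by (simp add: inv_sq_def)

text \<open>Induction on the sharper bound 2 - 1/k, using 1/(k+1)^2 \<le> 1/k - 1/(k+1).\<close>

lemma sum_inv_sq: "(\<Sum>i\<le>k. inv_sq i) \<le> 2"
proof -
  have "(\<Sum>i\<le>k. inv_sq i) \<le> 2 - (if k = 0 then 0 else 1 / real k)"
  proof (induction k)
    case (Suc k)
    have "1 / (real (Suc k))^2 \<le> (if k = 0 then 1 else 1 / real k - 1 / real (Suc k))"
    proof (cases "k = 0")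
      case False
      then have k: "real k > 0" by simp
      then have "1 / (real (Suc k))^2 \<le> 1 / (real k * real (Suc k))"
        by (intro divide_left_mono) (auto simp: power2_eq_square)
      also have "\<dots> = 1 / real k - 1 / real (Suc k)" using k by (simp add: field_simps)
      finally show ?thesis using False by simp
    qed simp
    with Suc show ?case by (cases "k = 0") (auto simp: inv_sq_def)
  qed (simp add: inv_sq_def)
  then show ?thesis by (rule order_trans) auto
qed

text \<open>For i + j = k, the inequality (i+j)^2 \<le> 2 (i^2 + j^2) gives 1/(i^2 j^2) \<le>
  (2/k^2) (1/i^2 + 1/j^2); summation yields 2 (2 + 2) = 8.\<close>

lemma inv_sq_convolution: "(\<Sum>i\<le>k. inv_sq i * inv_sq (k - i)) \<le> 8 * inv_sq k"
proof (cases "k = 0")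
  case False
  have "inv_sq i * inv_sq (k - i) \<le> 2 * inv_sq k * (inv_sq i + inv_sq (k - i))" if "i \<le> k" for i
  proof (cases "i = 0 \<or> i = k")
    case True
    then show ?thesis by (auto simp: inv_sq_def[of 0] intro!: mult_nonneg_nonneg add_nonneg_nonneg inv_sq_nonneg)
  next
    case f: False
    define x where "x = real i" define y where "y = real (k - i)"
    have xy: "x > 0" "y > 0" "real k = x + y" using f that by (auto simp: x_def y_def)
    have "(x + y)^2 \<le> 2 * (x^2 + y^2)" using sum_squares_bound[of x y] by (simp add: power2_sum)
    then have "(x + y)^2 / ((x + y)^2 * (x^2 * y^2)) \<le> 2 * (x^2 + y^2) / ((x + y)^2 * (x^2 * y^2))"
      using xy by (intro divide_right_mono) auto
    also have "(x + y)^2 / ((x + y)^2 * (x^2 * y^2)) = 1 / x^2 * (1 / y^2)" using xy by simp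
    also have "2 * (x^2 + y^2) / ((x + y)^2 * (x^2 * y^2)) = 2 * (1 / (x + y)^2) * (1 / x^2 + 1 / y^2)"
      using xy by (simp add: field_simps)
    finally show ?thesis using f that False by (simp add: inv_sq_def xy(3) flip: x_def y_def)
  qed
  then have "(\<Sum>i\<le>k. inv_sq i * inv_sq (k - i)) \<le> (\<Sum>i\<le>k. 2 * inv_sq k * (inv_sq i + inv_sq (k - i)))"
    by (intro sum_mono) auto
  also have "\<dots> = 2 * inv_sq k * ((\<Sum>i\<le>k. inv_sq i) + (\<Sum>i\<le>k. inv_sq (k - i)))"
    by (simp only: sum_distrib_left[symmetric] sum.distrib)
  also have "(\<Sum>i\<le>k. inv_sq (k - i)) = (\<Sum>i\<le>k. inv_sq i)"
    using sum.nat_diff_reindex[of inv_sq "Suc k"] by (simp add: lessThan_Suc_atMost)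
  also have "2 * inv_sq k * ((\<Sum>i\<le>k. inv_sq i) + (\<Sum>i\<le>k. inv_sq i)) \<le> 2 * inv_sq k * (2 + 2)"
    by (intro mult_left_mono add_mono sum_inv_sq mult_nonneg_nonneg inv_sq_nonneg) auto
  finally show ?thesis by simp
qed (simp add: inv_sq_def)

locale majorant =
  fixes \<theta> R :: real
  assumes \<theta>: "0 < \<theta>" "\<theta> \<le> 1" and R: "R > 0"
begin

text \<open>The divisor 8 compensates \<open>inv_sq_convolution\<close>. As
  \<open>inv_sq 0 = 0\<close>, only splittings into two positive indices contribute to the
  convolution square.\<close>

definition V :: "nat \<Rightarrow> real" where "V k = \<theta> / 8 * R ^ k * inv_sq k"

lemma V_nonneg: "V k \<ge> 0" using \<theta> R by (simp add: V_def inv_sq_nonneg)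
lemma V_0: "V 0 = 0" by (simp add: V_def inv_sq_def)
lemma V_le: "V k \<le> R ^ k"
proof -
  have "inv_sq k \<le> 1"
    using one_le_power[of "real k" 2] by (cases "k = 0") (auto simp: inv_sq_def divide_le_eq_1)
  then have "(\<theta> / 8 * R ^ k) * inv_sq k \<le> (1 * R ^ k) * 1"
    using \<theta> R by (intro mult_mono inv_sq_nonneg) auto
  then show ?thesis by (simp add: V_def)
qed

lemma V_convolution: "(\<Sum>i\<le>k. V i * V (k - i)) \<le> \<theta> * V k"
proof -
  have "V i * V (k - i) = (\<theta> / 8)^2 * R ^ k * (inv_sq i * inv_sq (k - i))" if "i \<le> k" for i
    using that power_add[of R i "k - i"] by (simp add: V_def power2_eq_square)
  then have "(\<Sum>i\<le>k. V i * V (k - i)) = (\<theta> / 8)^2 * R ^ k * (\<Sum>i\<le>k. inv_sq i * inv_sq (k - i))"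
    by (simp add: sum_distrib_left)
  also have "\<dots> \<le> (\<theta> / 8)^2 * R ^ k * (8 * inv_sq k)"
    using R by (intro mult_left_mono inv_sq_convolution) auto
  also have "\<dots> = \<theta> * V k" by (simp add: V_def power2_eq_square)
  finally show ?thesis .
qed

definition big :: "real \<Rightarrow> real fps \<Rightarrow> real fps \<Rightarrow> bool" where
  "big n x x' \<longleftrightarrow> n \<ge> 0 \<and> \<bar>fps_nth x 0\<bar> \<le> n \<and> (\<forall>k>0. \<bar>fps_nth x k\<bar> \<le> n * V k)"
definition small :: "real \<Rightarrow> real fps \<Rightarrow> real fps \<Rightarrow> bool" where
  "small n x x' \<longleftrightarrow> n \<ge> 0 \<and> fps_nth x 0 = 0 \<and> (\<forall>k>0. \<bar>fps_nth x k\<bar> \<le> n * V k)"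
text \<open>The extra factor \<theta> is what the product of two small series gains from
  \<open>V_convolution\<close>.\<close>

definition tiny :: "real \<Rightarrow> real fps \<Rightarrow> real fps \<Rightarrow> bool" where
  "tiny n x x' \<longleftrightarrow> n \<ge> 0 \<and> fps_nth x 0 = 0 \<and> (\<forall>k>0. \<bar>fps_nth x k\<bar> \<le> n * \<theta> * V k)"

text \<open>The two ends of the convolution involve the constant terms; the interior is controlled
  by \<open>V_convolution\<close>. These three contributions are the origin of the factor 3 in
  \<open>graded\<close>.\<close>

lemma mult_nth_bound:
  assumes x0: "\<bar>fps_nth x 0\<bar> \<le> a" and x: "\<And>j. j > 0 \<Longrightarrow> \<bar>fps_nth x j\<bar> \<le> m * V j"
    and y0: "\<bar>fps_nth y 0\<bar> \<le> b" and y: "\<And>j. j > 0 \<Longrightarrow> \<bar>fps_nth y j\<bar> \<le> n * V j"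
    and k: "k > 0" and mn: "m \<ge> 0" "n \<ge> 0"
  shows "\<bar>fps_nth (x * y) k\<bar> \<le> (a * n + b * m + m * n * \<theta>) * V k"
proof -
  have ab: "a \<ge> 0" "b \<ge> 0" using x0 y0 by linarith+
  have "\<bar>fps_nth (x * y) k\<bar> \<le> (\<Sum>i=0..k. \<bar>fps_nth x i\<bar> * \<bar>fps_nth y (k - i)\<bar>)"
    unfolding fps_mult_nth abs_mult[symmetric] by (rule sum_abs)
  also have "\<dots> \<le> (\<Sum>i=0..k. (if i = 0 then a * (n * V k) else 0) + (if i = k then m * V k * b else 0)
      + m * n * (V i * V (k - i)))"
  proof (rule sum_mono)
    fix i assume i: "i \<in> {0..k}"
    consider "i = 0" | "i = k" "i \<noteq> 0" | "i > 0" "i < k" using i by force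
    then show "\<bar>fps_nth x i\<bar> * \<bar>fps_nth y (k - i)\<bar> \<le> (if i = 0 then a * (n * V k) else 0)
        + (if i = k then m * V k * b else 0) + m * n * (V i * V (k - i))"
    proof cases
      case 1
      then show ?thesis using k x0 y[OF k] ab by (simp add: V_0 mult_mono)
    next
      case 2
      then show ?thesis using k x[OF k] y0 ab by (simp add: V_0 mult_mono mn V_nonneg)
    next
      case 3
      have "\<bar>fps_nth x i\<bar> * \<bar>fps_nth y (k - i)\<bar> \<le> (m * V i) * (n * V (k - i))"
        using 3 by (intro mult_mono x y mult_nonneg_nonneg mn V_nonneg) auto
      then show ?thesis using 3 by (simp add: mult_ac)
    qed
  qed
  also have "\<dots> = a * (n * V k) + m * V k * b + m * n * (\<Sum>i\<le>k. V i * V (k - i))"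
    using k by (simp add: sum.distrib sum_distrib_left atMost_atLeast0)
  also have "\<dots> \<le> a * (n * V k) + m * V k * b + m * n * (\<theta> * V k)"
    using mn by (intro add_left_mono mult_left_mono V_convolution) auto
  finally show ?thesis by (simp add: algebra_simps)
qed

lemma le_V: "a \<le> b \<Longrightarrow> x \<le> a * V k \<Longrightarrow> x \<le> b * V k"
  by (meson V_nonneg mult_right_mono order_trans)

sublocale graded big small tiny
proof
  fix m n :: real and x x' y y' :: "real fps"
  have th: "m * n * \<theta> \<le> m * n" if "m \<ge> 0" "n \<ge> 0" using that \<theta> by (simp add: mult_left_le)
  have th2: "m * n * \<theta> * \<theta> \<le> m * n * \<theta>" if "m \<ge> 0" "n \<ge> 0" using that \<theta> by (simp add: mult_left_le)
  have mn: "m * n \<ge> 0" "m * n * \<theta> \<ge> 0" if "m \<ge> 0" "n \<ge> 0" using that \<theta> by simp_all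
  show "big (3 * m * n) (x * y) (x' * y')" if "big m x x'" "big n y y'"
    unfolding big_def
  proof (intro conjI allI impI)
    have nn: "m \<ge> 0" "n \<ge> 0" using that by (auto simp: big_def small_def tiny_def)
    show "\<bar>fps_nth (x * y) 0\<bar> \<le> 3 * m * n"
    proof -
      have "\<bar>fps_nth (x * y) 0\<bar> \<le> m * n"
        using that by (auto simp: big_def abs_mult intro!: mult_mono)
      then show ?thesis using mn[OF nn] by linarith
    qed
    fix k :: nat assume "k > 0"
    then have "\<bar>fps_nth (x * y) k\<bar> \<le> (m * n + n * m + m * n * \<theta>) * V k"
      using that by (intro mult_nth_bound) (auto simp: big_def)
    then show "\<bar>fps_nth (x * y) k\<bar> \<le> 3 * m * n * V k"
      by (rule le_V[rotated]) (use th[OF nn] th2[OF nn] mn[OF nn] in \<open>simp add: algebra_simps\<close>)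
  qed (use that in \<open>auto simp: big_def\<close>)
  show "tiny (3 * m * n) (x * y) (x' * y')" if "small m x x'" "small n y y'"
    unfolding tiny_def
  proof (intro conjI allI impI)
    have nn: "m \<ge> 0" "n \<ge> 0" using that by (auto simp: big_def small_def tiny_def)
    fix k :: nat assume "k > 0"
    then have "\<bar>fps_nth (x * y) k\<bar> \<le> (0 * n + 0 * m + m * n * \<theta>) * V k"
      using that by (intro mult_nth_bound) (auto simp: small_def)
    then show "\<bar>fps_nth (x * y) k\<bar> \<le> 3 * m * n * \<theta> * V k"
      by (rule le_V[rotated]) (use th[OF nn] th2[OF nn] mn[OF nn] in \<open>simp add: algebra_simps\<close>)
  qed (use that in \<open>auto simp: small_def\<close>)
  show "small (3 * m * n) (x * y) (x' * y')" if "big m x x'" "small n y y'"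
    unfolding small_def
  proof (intro conjI allI impI)
    have nn: "m \<ge> 0" "n \<ge> 0" using that by (auto simp: big_def small_def tiny_def)
    fix k :: nat assume "k > 0"
    then have "\<bar>fps_nth (x * y) k\<bar> \<le> (m * n + 0 * m + m * n * \<theta>) * V k"
      using that by (intro mult_nth_bound) (auto simp: small_def big_def)
    then show "\<bar>fps_nth (x * y) k\<bar> \<le> 3 * m * n * V k"
      by (rule le_V[rotated]) (use th[OF nn] th2[OF nn] mn[OF nn] in \<open>simp add: algebra_simps\<close>)
  qed (use that in \<open>auto simp: small_def big_def\<close>)
  show "tiny (3 * m * n) (x * y) (x' * y')" if "big m x x'" "tiny n y y'"
    unfolding tiny_def
  proof (intro conjI allI impI)
    have nn: "m \<ge> 0" "n \<ge> 0" using that by (auto simp: big_def small_def tiny_def)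
    fix k :: nat assume "k > 0"
    then have "\<bar>fps_nth (x * y) k\<bar> \<le> (m * (n * \<theta>) + 0 * m + m * (n * \<theta>) * \<theta>) * V k"
      using that \<theta> by (intro mult_nth_bound) (auto simp: tiny_def big_def)
    then show "\<bar>fps_nth (x * y) k\<bar> \<le> 3 * m * n * \<theta> * V k"
      by (rule le_V[rotated]) (use th[OF nn] th2[OF nn] mn[OF nn] in \<open>simp add: algebra_simps\<close>)
  qed (use that in \<open>auto simp: tiny_def big_def\<close>)
  have tri: "\<bar>a + b\<bar> \<le> (m + n) * V k" "\<bar>a - b\<bar> \<le> (m + n) * V k"
    if "\<bar>a\<bar> \<le> m * V k" "\<bar>b\<bar> \<le> n * V k" for a b k m n
    using that by (auto simp: distrib_right)
  show "big (m + n) (x + y) (x' + y')" "big (m + n) (x - y) (x' - y')" if "big m x x'" "big n y y'"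
    using that by (auto simp: big_def intro!: tri)
  show "small (m + n) (x + y) (x' + y')" if "small m x x'" "small n y y'"
    using that by (auto simp: small_def intro!: tri)
  show "tiny (m + n) (x + y) (x' + y')" if "tiny m x x'" "tiny n y y'"
    using that tri[of _ "m * \<theta>" _ _ "n * \<theta>"] by (auto simp: tiny_def distrib_right)
  show "big m x x'" if "small m x x'" using that by (auto simp: big_def small_def)
  show "small m x x'" if "tiny m x x'"
    using that le_V[of "m * \<theta>" m] \<theta> by (auto simp: tiny_def small_def mult_left_le)
  show "big 1 1 1" using V_nonneg by (auto simp: big_def)
qed

end

section \<open>Lipschitz bounds\<close>

text \<open>Here \<theta> is the size of two perturbations and D a bound on their distance. The
  distance \<theta> D of a tiny pair carries the contraction factor for local uniqueness.\<close>

locale lipschitz_classes =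
  fixes \<theta> D :: real
  assumes \<theta>: "0 \<le> \<theta>" "\<theta> \<le> 1" and D: "D \<ge> 0"
begin

definition big :: "real \<Rightarrow> real \<Rightarrow> real \<Rightarrow> bool" where
  "big n x x' \<longleftrightarrow> n \<ge> 0 \<and> \<bar>x\<bar> \<le> n \<and> \<bar>x'\<bar> \<le> n \<and> \<bar>x - x'\<bar> \<le> n * D"
definition small :: "real \<Rightarrow> real \<Rightarrow> real \<Rightarrow> bool" where
  "small n x x' \<longleftrightarrow> n \<ge> 0 \<and> \<bar>x\<bar> \<le> n * \<theta> \<and> \<bar>x'\<bar> \<le> n * \<theta> \<and> \<bar>x - x'\<bar> \<le> n * D"
definition tiny :: "real \<Rightarrow> real \<Rightarrow> real \<Rightarrow> bool" where
  "tiny n x x' \<longleftrightarrow> n \<ge> 0 \<and> \<bar>x\<bar> \<le> n * \<theta> \<and> \<bar>x'\<bar> \<le> n * \<theta> \<and> \<bar>x - x'\<bar> \<le> n * (\<theta> * D)"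

lemma prod_diff:
  assumes "\<bar>x\<bar> \<le> a" "\<bar>y'\<bar> \<le> b" "\<bar>x - x'\<bar> \<le> (d1::real)" "\<bar>y - y'\<bar> \<le> d2"
  shows "\<bar>x * y - x' * y'\<bar> \<le> a * d2 + d1 * b"
proof -
  have "x * y - x' * y' = x * (y - y') + (x - x') * y'" by (simp add: algebra_simps)
  then have "\<bar>x * y - x' * y'\<bar> \<le> \<bar>x\<bar> * \<bar>y - y'\<bar> + \<bar>x - x'\<bar> * \<bar>y'\<bar>"
    by (metis abs_mult abs_triangle_ineq)
  also have "\<dots> \<le> a * d2 + d1 * b" using assms by (intro add_mono mult_mono) auto
  finally show ?thesis .
qed

lemma prod_abs: "\<bar>x\<bar> \<le> a \<Longrightarrow> \<bar>y\<bar> \<le> b \<Longrightarrow> \<bar>x * y\<bar> \<le> a * (b::real)"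
  unfolding abs_mult by (intro mult_mono) auto

sublocale graded big small tiny
proof
  fix m n x x' y y' :: real
  have th: "a * \<theta> \<le> a" if "a \<ge> 0" for a using that \<theta> by (simp add: mult_left_le)
  show "big (3 * m * n) (x * y) (x' * y')" if "big m x x'" "big n y y'"
  proof -
    have 1: "m * n \<ge> 0" "m * n * D \<ge> 0" using that D by (auto simp: big_def)
    have "\<bar>x * y\<bar> \<le> m * n" "\<bar>x' * y'\<bar> \<le> m * n"
      using that by (auto simp: big_def intro!: prod_abs)
    moreover have "\<bar>x * y - x' * y'\<bar> \<le> m * (n * D) + m * D * n"
      by (rule prod_diff) (use that in \<open>auto simp: big_def\<close>)
    moreover have "m * (n * D) + m * D * n = 2 * (m * n * D)" "3 * m * n * D = 3 * (m * n * D)"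
      "3 * m * n = 3 * (m * n)" by simp_all
    ultimately show ?thesis unfolding big_def using 1 by linarith
  qed
  show "tiny (3 * m * n) (x * y) (x' * y')" if "small m x x'" "small n y y'"
  proof -
    have 1: "m * n * \<theta> \<ge> 0" "m * n * \<theta> * D \<ge> 0" using that D \<theta> by (auto simp: small_def)
    moreover have "m * n * \<theta> * \<theta> \<le> m * n * \<theta>" by (rule th[OF 1(1)])
    ultimately show ?thesis
      using that prod_abs[of x "m * \<theta>" y "n * \<theta>"] prod_abs[of x' "m * \<theta>" y' "n * \<theta>"] 
        prod_diff[of x "m * \<theta>" y' "n * \<theta>" x' "m * D" y "n * D"]
      by (auto simp: small_def tiny_def algebra_simps)
  qed
  show "small (3 * m * n) (x * y) (x' * y')" if "big m x x'" "small n y y'"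
  proof -
    have 1: "m * n * D \<ge> 0" "m * n * \<theta> \<ge> 0" using that D \<theta> by (auto simp: small_def big_def)
    moreover have "m * n * D * \<theta> \<le> m * n * D" by (rule th[OF 1(1)])
    ultimately show ?thesis
      using that prod_abs[of x m y "n * \<theta>"] prod_abs[of x' m y' "n * \<theta>"] 
        prod_diff[of x m y' "n * \<theta>" x' "m * D" y "n * D"]
      by (auto simp: small_def big_def algebra_simps)
  qed
  show "tiny (3 * m * n) (x * y) (x' * y')" if "big m x x'" "tiny n y y'"
  proof -
    have 1: "m * n * \<theta> \<ge> 0" "m * n * \<theta> * D \<ge> 0" using that D \<theta> by (auto simp: tiny_def big_def)
    then show ?thesis
      using that prod_abs[of x m y "n * \<theta>"] prod_abs[of x' m y' "n * \<theta>"] 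
        prod_diff[of x m y' "n * \<theta>" x' "m * D" y "n * (\<theta> * D)"]
      by (auto simp: tiny_def big_def algebra_simps)
  qed
  show "big (m + n) (x + y) (x' + y')" "big (m + n) (x - y) (x' - y')" if "big m x x'" "big n y y'"
    using that by (auto simp: big_def distrib_right)
  show "small (m + n) (x + y) (x' + y')" if "small m x x'" "small n y y'"
    using that by (auto simp: small_def distrib_right)
  show "tiny (m + n) (x + y) (x' + y')" if "tiny m x x'" "tiny n y y'"
    using that by (auto simp: tiny_def distrib_right)
  show "big m x x'" if "small m x x'" using that th[of m] by (auto simp: big_def small_def)
  show "small m x x'" if "tiny m x x'"
  proof -
    have "m * D * \<theta> \<le> m * D" using that D by (intro th) (auto simp: tiny_def)
    then show ?thesis using that by (auto simp: tiny_def small_def mult_ac)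
  qed
  show "big 1 1 1" using D by (auto simp: big_def)
qed

end

section \<open>Dependence on low-order coefficients\<close>

text \<open>Tiny pairs agree one order further than small ones: in a product of two series without
  constant term, coefficient N involves only coefficients below N.\<close>

locale agreement =
  fixes N :: nat
  assumes N: "N > 0"
begin

definition big :: "real \<Rightarrow> real fps \<Rightarrow> real fps \<Rightarrow> bool" where
  "big n x x' \<longleftrightarrow> (\<forall>j<N. fps_nth x j = fps_nth x' j)"
definition small :: "real \<Rightarrow> real fps \<Rightarrow> real fps \<Rightarrow> bool" where
  "small n x x' \<longleftrightarrow> fps_nth x 0 = 0 \<and> (\<forall>j<N. fps_nth x j = fps_nth x' j)"
definition tiny :: "real \<Rightarrow> real fps \<Rightarrow> real fps \<Rightarrow> bool" where
  "tiny n x x' \<longleftrightarrow> fps_nth x 0 = 0 \<and> (\<forall>j\<le>N. fps_nth x j = fps_nth x' j)"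

sublocale graded big small tiny
proof
  fix m n :: real and x x' y y' :: "real fps"
  show "big (3 * m * n) (x * y) (x' * y')" if "big m x x'" "big n y y'"
    using that by (auto simp: big_def fps_mult_nth intro!: sum.cong)
  show "tiny (3 * m * n) (x * y) (x' * y')" if s: "small m x x'" "small n y y'"
    unfolding tiny_def
  proof (intro conjI allI impI)
    fix j assume j: "j \<le> N"
    have 0: "fps_nth x 0 = 0" "fps_nth x' 0 = 0" "fps_nth y 0 = 0" "fps_nth y' 0 = 0"
      using s N by (auto simp: small_def)
    show "fps_nth (x * y) j = fps_nth (x' * y') j"
      unfolding fps_mult_nth
    proof (rule sum.cong)
      fix i assume "i \<in> {0..j}"
      then consider "i = 0" | "i = j" | "i < N" "j - i < N" using j by force
      then show "fps_nth x i * fps_nth y (j - i) = fps_nth x' i * fps_nth y' (j - i)"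
        by cases (use s 0 in \<open>auto simp: small_def\<close>)
    qed simp
  qed (use s in \<open>auto simp: small_def\<close>)
  show "small (3 * m * n) (x * y) (x' * y')" if "big m x x'" "small n y y'"
    using that by (auto simp: small_def big_def fps_mult_nth intro!: sum.cong)
  show "tiny (3 * m * n) (x * y) (x' * y')" if s: "big m x x'" "tiny n y y'"
    unfolding tiny_def
  proof (intro conjI allI impI)
    fix j assume j: "j \<le> N"
    have 0: "fps_nth y 0 = 0" "fps_nth y' 0 = 0" using s by (auto simp: tiny_def)
    show "fps_nth (x * y) j = fps_nth (x' * y') j"
      unfolding fps_mult_nth
    proof (rule sum.cong)
      fix i assume "i \<in> {0..j}"
      then consider "i = j" | "i < N" using j by force
      then show "fps_nth x i * fps_nth y (j - i) = fps_nth x' i * fps_nth y' (j - i)"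
        by cases (use s 0 j in \<open>auto simp: tiny_def big_def\<close>)
    qed simp
  qed (use s in \<open>auto simp: tiny_def\<close>)
qed (auto simp: big_def small_def tiny_def)

end

section \<open>Trigonometric polynomials in the phase\<close>

text \<open>The first argument is the phase, the second the time; k bounds the degree in the phase.
  Generation by factors cos s and sin s, rather than by Fourier sums, suits rule induction for
  linear solving and for averaging.\<close>

inductive tp :: "real \<Rightarrow> nat \<Rightarrow> (real \<Rightarrow> real \<Rightarrow> real) \<Rightarrow> bool" for Q where
  tp_const: "continuous_on UNIV c \<Longrightarrow> (\<And>t. c (t + Q) = c t) \<Longrightarrow> tp Q k (\<lambda>s. c)"
| tp_add: "tp Q k f \<Longrightarrow> tp Q k g \<Longrightarrow> tp Q k (\<lambda>s t. f s t + g s t)"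
| tp_cos: "tp Q k f \<Longrightarrow> tp Q (Suc k) (\<lambda>s t. cos s * f s t)"
| tp_sin: "tp Q k f \<Longrightarrow> tp Q (Suc k) (\<lambda>s t. sin s * f s t)"

lemma tp_continuous: "tp Q k f \<Longrightarrow> continuous_on UNIV (f s)"
  by (induction rule: tp.induct) (auto intro!: continuous_intros)

lemma tp_periodic: "tp Q k f \<Longrightarrow> f s (t + Q) = f s t"
  by (induction rule: tp.induct) auto

lemma tp_continuous_phase: "tp Q k f \<Longrightarrow> continuous_on UNIV (\<lambda>s. f s t)"
  by (induction rule: tp.induct) (auto intro!: continuous_intros)

lemma tp_mono: "tp Q k f \<Longrightarrow> k \<le> l \<Longrightarrow> tp Q l f"
proof (induction arbitrary: l rule: tp.induct)
  case (tp_cos k f)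
  then show ?case by (metis Suc_le_D Suc_le_mono tp.tp_cos)
next
  case (tp_sin k f)
  then show ?case by (metis Suc_le_D Suc_le_mono tp.tp_sin)
qed (auto intro: tp.intros)

lemma tp_mult_const:
  assumes "tp Q k f" "continuous_on UNIV c" "\<And>t. c (t + Q) = c t"
  shows "tp Q k (\<lambda>s t. c t * f s t)"
  using assms(1)
proof induction
  case (tp_const d k)
  then show ?case using assms(2,3) by (intro tp.tp_const continuous_intros) auto
next
  case (tp_add k f g)
  from tp.tp_add[OF tp_add.IH] show ?case by (simp add: distrib_left)
next
  case (tp_cos k f)
  from tp.tp_cos[OF tp_cos.IH] show ?case by (simp add: mult.left_commute)
next
  case (tp_sin k f)
  from tp.tp_sin[OF tp_sin.IH] show ?case by (simp add: mult.left_commute)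
qed

lemma tp_mult: "tp Q j f \<Longrightarrow> tp Q k g \<Longrightarrow> tp Q (j + k) (\<lambda>s t. f s t * g s t)"
proof (induction rule: tp.induct)
  case (tp_const c j)
  then have "tp Q k (\<lambda>s t. c t * g s t)" by (intro tp_mult_const)
  then show ?case by (rule tp_mono) simp
next
  case (tp_add j f f')
  from tp.tp_add[OF tp_add.IH(1,2)] tp_add.prems show ?case by (simp add: distrib_right)
next
  case (tp_cos j f)
  from tp.tp_cos[OF tp_cos.IH] tp_cos.prems show ?case by (simp add: mult.assoc)
next
  case (tp_sin j f)
  from tp.tp_sin[OF tp_sin.IH] tp_sin.prems show ?case by (simp add: mult.assoc)
qed

lemma tp_uminus: "tp Q k f \<Longrightarrow> tp Q k (\<lambda>s t. - f s t)"
  using tp_mult_const[of Q k f "\<lambda>_. -1"] by simp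

lemma tp_diff: "tp Q k f \<Longrightarrow> tp Q k g \<Longrightarrow> tp Q k (\<lambda>s t. f s t - g s t)"
  using tp_add[OF _ tp_uminus, of Q k f g] by simp

lemma tp_number: "tp Q k (\<lambda>s t. c)"
  by (rule tp_const) auto

lemma tp_sum: "(\<And>i. i \<in> I \<Longrightarrow> tp Q k (f i)) \<Longrightarrow> tp Q k (\<lambda>s t. \<Sum>i\<in>I. f i s t)"
  by (induction I rule: infinite_finite_induct) (auto intro: tp_number tp_add)

text \<open>The sum over the shifts is constant because every harmonic that occurs has order
  below \<open>N\<close> in absolute value, so that its sum over the \<open>N\<close>-th roots of unity vanishes.\<close>

lemma tp_average_const:
  fixes N :: nat and p :: int and l :: int and \<sigma> :: real
  defines "\<sigma> \<equiv> 2 * pi * p / N"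
  assumes "tp Q k f" and N: "N > 0" and cop: "coprime p (int N)"
  shows "\<bar>l\<bar> + int k < int N \<Longrightarrow>
    (\<Sum>n<N. cis (of_int l * (s + n * \<sigma>)) * of_real (f (s + n * \<sigma>) t))
     = (\<Sum>n<N. cis (of_int l * (n * \<sigma>)) * of_real (f (n * \<sigma>) t))"
  using assms(2)
proof (induction arbitrary: l)
  case (tp_const c k)
  show ?case
  proof (cases "l = 0")
    case False
    define z where "z = cis (of_int l * \<sigma>)"
    have "z ^ N = cis (2 * pi * of_int (l * p))"
    proof -
      have "real N * (of_int l * \<sigma>) = 2 * pi * of_int (l * p)" using N by (simp add: \<sigma>_def)
      then show ?thesis by (simp only: z_def Complex.DeMoivre)
    qed
    also have "\<dots> = 1" by (rule cis_multiple_2pi) simp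
    finally have zN: "z ^ N = 1" .
    \<comment> \<open>If z = 1, then l p is a multiple of N, so N divides l by coprimality, against
      0 < |l| < N.\<close>
    have "z \<noteq> 1"
    proof
      assume "z = 1"
      then have "cos (of_int l * \<sigma>) = 1" by (simp add: z_def complex_eq_iff)
      then obtain j :: int where "of_int l * \<sigma> = of_int j * 2 * pi" by (auto simp: cos_one_2pi_int)
      then have "real_of_int (l * p) = real_of_int (j * int N)"
        using N by (simp add: \<sigma>_def field_simps)
      then have "l * p = j * int N" by linarith
      then have "int N dvd l * p" by simp
      then have "int N dvd l" using cop by (metis coprime_commute coprime_dvd_mult_left_iff)
      then have "int N \<le> \<bar>l\<bar>" using False dvd_imp_le_int by force
      then show False using tp_const by simp
    qed
    then have 0: "(\<Sum>n<N. z ^ n) = 0" using geometric_sum[of z N] zN by simp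
    have "(\<Sum>n<N. cis (of_int l * (x + n * \<sigma>)) * of_real (c t)) = cis (of_int l * x) * of_real (c t) * (\<Sum>n<N. z ^ n)" for x
      by (simp add: sum_distrib_left z_def Complex.DeMoivre distrib_left mult_ac flip: cis_mult)
    from this[of s] this[of 0] show ?thesis by (simp add: 0)
  qed simp
next
  case (tp_add k f g)
  then show ?case by (simp add: distrib_left sum.distrib)
next
  case (tp_cos k f)
  \<comment> \<open>A factor cos moves the harmonic l by one in either direction while the degree
    drops by one, so |l| + k < N is preserved. The factor sin below behaves in the same way.\<close>
  have e: "cis (of_int l * x) * of_real (cos x * y) =
     (cis (of_int (l + 1) * x) * of_real y + cis (of_int (l - 1) * x) * of_real y) / 2" for x y
  proof -
    have "cis (of_int (l + 1) * x) = cis (of_int l * x) * cis x" "cis (of_int (l - 1) * x) = cis (of_int l * x) * cis (- x)"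
      by (simp_all add: cis_mult algebra_simps)
    moreover have "cis x + cis (- x) = 2 * of_real (cos x)" by (simp add: complex_eq_iff)
    moreover have "a * b * d + a * b' * d = a * (b + b') * d" for a b b' d :: complex by (simp add: algebra_simps)
    ultimately show ?thesis by simp
  qed
  have "\<bar>l + 1\<bar> + int k < int N" "\<bar>l - 1\<bar> + int k < int N" using tp_cos.prems by auto
  then show ?case unfolding e sum_divide_distrib[symmetric] sum.distrib
    by (simp only: tp_cos.IH)
next
  case (tp_sin k f)
  have e: "cis (of_int l * x) * of_real (sin x * y) =
     (cis (of_int (l + 1) * x) * of_real y - cis (of_int (l - 1) * x) * of_real y) / (2 * \<i>)" for x y
  proof -
    have "cis (of_int (l + 1) * x) = cis (of_int l * x) * cis x" "cis (of_int (l - 1) * x) = cis (of_int l * x) * cis (- x)"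
      by (simp_all add: cis_mult algebra_simps)
    moreover have "cis x - cis (- x) = 2 * \<i> * of_real (sin x)" by (simp add: complex_eq_iff)
    moreover have "a * b * d - a * b' * d = a * (b - b') * d" for a b b' d :: complex by (simp add: algebra_simps)
    ultimately show ?thesis by (simp add: mult.left_commute[of "cis (of_int l * x)" "\<i>"])
  qed
  have "\<bar>l + 1\<bar> + int k < int N" "\<bar>l - 1\<bar> + int k < int N" using tp_sin.prems by auto
  then show ?case unfolding e sum_divide_distrib[symmetric] sum_subtractf
    by (simp only: tp_sin.IH)
qed

text \<open>By invariance all N summands are equal, so the case l = 0 of
  \<open>tp_average_const\<close> compares N f(s) with N f(0).\<close>

lemma tp_constant:
  fixes N :: nat and p :: int
  assumes tp: "tp Q k f" and N: "k < N" and cop: "coprime p (int N)"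
    and inv: "\<And>s. f (s + 2 * pi * p / N) t = f s t"
  shows "f s t = f 0 t"
proof -
  define \<sigma> where "\<sigma> = 2 * pi * p / N"
  have inv_n: "f (s + real n * \<sigma>) t = f s t" for n :: nat and s
  proof (induction n)
    case (Suc n)
    then show ?case using inv[of "s + real n * \<sigma>", folded \<sigma>_def] by (simp add: algebra_simps)
  qed simp
  have "(\<Sum>n<N. cis (of_int 0 * (s + n * \<sigma>)) * of_real (f (s + n * \<sigma>) t))
     = (\<Sum>n<N. cis (of_int 0 * (n * \<sigma>)) * of_real (f (n * \<sigma>) t))"
    unfolding \<sigma>_def using tp N cop by (intro tp_average_const) auto
  then have "of_nat N * complex_of_real (f s t) = of_nat N * complex_of_real (f 0 t)"
    using inv_n[of s] inv_n[of 0] by simp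
  then show ?thesis using N by simp
qed

text \<open>A filtration compatible with products: sin and cos of the shifted time have degree 1 and
  enter only with a factor \<open>fps_X\<close>.\<close>

definition graded_tp :: "real \<Rightarrow> (real \<Rightarrow> real \<Rightarrow> real fps) \<Rightarrow> bool" where
  "graded_tp Q A \<longleftrightarrow> (\<forall>j. tp Q j (\<lambda>s t. fps_nth (A s t) j))"

lemma graded_tp_const:
  assumes "continuous_on UNIV c" "\<And>t. c (t + Q) = c t"
  shows "graded_tp Q (\<lambda>s t. fps_const (c t))"
  unfolding graded_tp_def
proof
  fix j show "tp Q j (\<lambda>s t. fps_nth (fps_const (c t)) j)"
    using assms by (cases "j = 0") (auto intro: tp_const)
qed

lemma graded_tp_number: "graded_tp Q (\<lambda>s t. fps_const c)"
  by (rule graded_tp_const) auto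

lemma graded_tp_numeral: "graded_tp Q (\<lambda>s t. numeral n)" "graded_tp Q (\<lambda>s t. 1)"
  using graded_tp_number[of Q "numeral n"] graded_tp_number[of Q 1]
  by (simp_all add: numeral_fps_const[symmetric])

lemma graded_tp_add: "graded_tp Q A \<Longrightarrow> graded_tp Q A' \<Longrightarrow> graded_tp Q (\<lambda>s t. A s t + A' s t)"
  by (auto simp: graded_tp_def intro: tp_add)

lemma graded_tp_diff: "graded_tp Q A \<Longrightarrow> graded_tp Q A' \<Longrightarrow> graded_tp Q (\<lambda>s t. A s t - A' s t)"
  by (auto simp: graded_tp_def intro: tp_diff)

lemma graded_tp_mult: "graded_tp Q A \<Longrightarrow> graded_tp Q A' \<Longrightarrow> graded_tp Q (\<lambda>s t. A s t * A' s t)"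
  unfolding graded_tp_def fps_mult_nth
proof (intro allI tp_sum)
  fix j i :: nat assume "\<forall>j. tp Q j (\<lambda>s t. fps_nth (A s t) j)" "\<forall>j. tp Q j (\<lambda>s t. fps_nth (A' s t) j)" "i \<in> {0..j}"
  then show "tp Q j (\<lambda>s t. fps_nth (A s t) i * fps_nth (A' s t) (j - i))"
    using tp_mult[of Q i "\<lambda>s t. fps_nth (A s t) i" "j - i" "\<lambda>s t. fps_nth (A' s t) (j - i)"] by simp
qed

lemma graded_tp_X_mult:
  assumes "tp Q 1 f" shows "graded_tp Q (\<lambda>s t. fps_X * fps_const (f s t))"
  unfolding graded_tp_def
proof
  fix j show "tp Q j (\<lambda>s t. fps_nth (fps_X * fps_const (f s t)) j)"
    using assms by (cases "j = 1") (auto intro: tp_number)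
qed

text \<open>Moves the factor \<mu> onto S and C, where it pays for their degree in the
  phase.\<close>

lemma rem_alt:
  "rem \<alpha> \<beta> S C u0 v0 l0 v w e \<mu> =
    quad_rem \<alpha> \<beta> u0 v0 l0 v w e + drive_rem (\<mu> * S) (\<mu> * C) (u0 + v) (v0 + w) (l0 + e)"
  by (simp add: rem_def drive_rem_def algebra_simps)

lemma graded_tp_rem:
  assumes Q: "Q = 2 * pi * real p"
    and u0: "continuous_on UNIV u0" "\<And>t. u0 (t + Q) = u0 t" and v0: "continuous_on UNIV v0" "\<And>t. v0 (t + Q) = v0 t"
    and A: "graded_tp Q v" "graded_tp Q w" "graded_tp Q e"
  shows "graded_tp Q (\<lambda>s t. rem (fps_const \<alpha>) (fps_const \<beta>) (fps_const (sin (t + s))) (fps_const (cos (t + s)))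
     (fps_const (u0 t)) (fps_const (v0 t)) (fps_const l0) (v s t) (w s t) (e s t) fps_X)"
proof -
  have per: "sin (t + Q) = sin t" "cos (t + Q) = cos t" for t
    using sin.plus_of_nat[of t p] cos.plus_of_nat[of t p] by (simp_all add: Q mult_ac)
  have sc: "tp Q 0 (\<lambda>s t. sin t)" "tp Q 0 (\<lambda>s t. cos t)"
    by (intro tp_const continuous_intros per)+
  have "tp Q 1 (\<lambda>s t. cos s * sin t + sin s * cos t)" "tp Q 1 (\<lambda>s t. cos s * cos t - sin s * sin t)"
    using sc by (auto intro!: tp_add tp_diff tp_cos tp_sin simp: One_nat_def)
  then have S: "tp Q 1 (\<lambda>s t. sin (t + s))" "tp Q 1 (\<lambda>s t. cos (t + s))"
    by (simp_all add: sin_add cos_add mult.commute add.commute)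
  show ?thesis
    unfolding rem_alt unfolding quad_rem_def drive_rem_def Let_def
    by (intro graded_tp_add graded_tp_diff graded_tp_mult graded_tp_X_mult graded_tp_number graded_tp_numeral
        graded_tp_const[OF u0] graded_tp_const[OF v0] A S)
qed

text \<open>The solution operator acts on the time variable only, so it commutes with sums and with
  factors cos s, sin s and preserves the degree; \<open>solves_lin_eps\<close> identifies the
  parameter of each combined solution.\<close>

lemma (in floquet) tp_solve:
  assumes "tp Q k \<phi>"
  shows "\<exists>w x. tp Q k w \<and> tp Q k x \<and> (\<forall>s. solves_lin (\<phi> s) (eps (\<phi> s)) (w s) (x s))
     \<and> tp Q k (\<lambda>s t. eps (\<phi> s))"
  using assms
proof induction
  case (tp_const c k)
  obtain K where K: "\<And>t. \<bar>c t\<bar> \<le> K" using periodic_bounded[of c Q] tp_const Q by metis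
  then obtain w x where w: "solves_lin c (eps c) w x" using solution_bound_ex tp_const unfolding solution_bound_def by blast
  then have "continuous_on UNIV w" "continuous_on UNIV x"
    by (auto simp: solves_lin_def intro: derivs_imp_cont)
  moreover have "w (t + Q) = w t" "x (t + Q) = x t" for t
    using w periodic_deriv[of w x Q 1] by (auto simp: solves_lin_def)
  ultimately have "tp Q k (\<lambda>s. w)" "tp Q k (\<lambda>s. x)" by (auto intro: tp.tp_const)
  then show ?case using w tp_number by blast
next
  case (tp_add k f g)
  then obtain w x w' x' where *: "tp Q k w" "tp Q k x" "\<And>s. solves_lin (f s) (eps (f s)) (w s) (x s)"
    "tp Q k w'" "tp Q k x'" "\<And>s. solves_lin (g s) (eps (g s)) (w' s) (x' s)" by blast
  let ?h = "\<lambda>s t. f s t + g s t"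
  have sol: "solves_lin (?h s) (eps (f s) + eps (g s)) (\<lambda>t. w s t + w' s t) (\<lambda>t. x s t + x' s t)" for s
    by (rule solves_lin_add) (use * in auto)
  then have e: "eps (?h s) = eps (f s) + eps (g s)" for s
    by (intro solves_lin_eps[symmetric, OF _ sol] continuous_intros tp_continuous[OF tp_add.hyps(1)] tp_continuous[OF tp_add.hyps(2)])
  show ?case
    by (rule exI[of _ "\<lambda>s t. w s t + w' s t"], rule exI[of _ "\<lambda>s t. x s t + x' s t"])
       (use * sol tp_add in \<open>auto simp: e intro!: tp.tp_add\<close>)
next
  case (tp_cos k f)
  then obtain w x where *: "tp Q k w" "tp Q k x" "\<And>s. solves_lin (f s) (eps (f s)) (w s) (x s)" by blast
  have sol: "solves_lin (\<lambda>t. cos s * f s t) (cos s * eps (f s)) (\<lambda>t. cos s * w s t) (\<lambda>t. cos s * x s t)" for s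
    by (rule solves_lin_cmult) (use * in auto)
  then have e: "eps (\<lambda>t. cos s * f s t) = cos s * eps (f s)" for s
    by (intro solves_lin_eps[symmetric, OF _ sol] continuous_intros tp_continuous[OF tp_cos.hyps])
  show ?case
    by (rule exI[of _ "\<lambda>s t. cos s * w s t"], rule exI[of _ "\<lambda>s t. cos s * x s t"])
       (use * sol tp_cos in \<open>auto simp: e intro!: tp.tp_cos\<close>)
next
  case (tp_sin k f)
  then obtain w x where *: "tp Q k w" "tp Q k x" "\<And>s. solves_lin (f s) (eps (f s)) (w s) (x s)" by blast
  have sol: "solves_lin (\<lambda>t. sin s * f s t) (sin s * eps (f s)) (\<lambda>t. sin s * w s t) (\<lambda>t. sin s * x s t)" for s
    by (rule solves_lin_cmult) (use * in auto)
  then have e: "eps (\<lambda>t. sin s * f s t) = sin s * eps (f s)" for s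
    by (intro solves_lin_eps[symmetric, OF _ sol] continuous_intros tp_continuous[OF tp_sin.hyps])
  show ?case
    by (rule exI[of _ "\<lambda>s t. sin s * w s t"], rule exI[of _ "\<lambda>s t. sin s * x s t"])
       (use * sol tp_sin in \<open>auto simp: e intro!: tp.tp_sin\<close>)
qed

section \<open>Convergence of the perturbation series\<close>

lemma h_fun_fps: "h_fun (fps_const \<beta>) (fps_const u) = fps_const (h_fun \<beta> u)"
  and k_fun_fps: "k_fun (fps_const \<alpha>) (fps_const \<beta>) (fps_const u) = fps_const (k_fun \<alpha> \<beta> u)"
  for \<alpha> \<beta> u :: "'a::comm_ring_1"
  by (simp_all add: h_fun_def k_fun_def numeral_fps_const fps_const_power flip: fps_const_1_eq_1)

lemma fps_of_poly_E_expr: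
  "fps_of_poly (E_expr a b S C u du ddu l m) =
    E_expr (fps_of_poly a) (fps_of_poly b) (fps_of_poly S) (fps_of_poly C) (fps_of_poly u)
      (fps_of_poly du) (fps_of_poly ddu) (fps_of_poly l) (fps_of_poly m)"
  by (simp add: E_expr_def h_fun_def k_fun_def fps_of_poly_add fps_of_poly_diff fps_of_poly_mult fps_of_poly_power)

text \<open>For increments without constant term, \<open>E_expr_split\<close> separates by order:
  the unperturbed equation enters at order 0 only, and the linear part acts on each coefficient by
  itself.\<close>

lemma E_expr_nth:
  assumes "fps_nth v 0 = 0" "fps_nth w 0 = 0" "fps_nth e 0 = 0" "fps_nth x 0 = 0"
  shows "fps_nth (E_expr (fps_const \<alpha>) (fps_const \<beta>) S C (fps_const u0 + v) (fps_const v0 + w)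
      (fps_const a + x) (fps_const l0 + e) m) n =
    (if n = 0 then a + l0 * h_fun \<beta> u0 * v0 + l0^2 * k_fun \<alpha> \<beta> u0 else 0)
    + (fps_nth x n + l0 * h_fun \<beta> u0 * fps_nth w n
       + (l0 * (6 * \<beta> * u0) * v0 + l0^2 * (\<alpha> - \<beta> + 3 * \<beta> * u0^2)) * fps_nth v n
       + (v0 * h_fun \<beta> u0 + 2 * l0 * k_fun \<alpha> \<beta> u0) * fps_nth e n)
    + fps_nth (rem (fps_const \<alpha>) (fps_const \<beta>) S C (fps_const u0) (fps_const v0) (fps_const l0) v w e m) n"
proof -
  have base: "fps_const a + fps_const l0 * h_fun (fps_const \<beta>) (fps_const u0) * fps_const v0
     + (fps_const l0)^2 * k_fun (fps_const \<alpha>) (fps_const \<beta>) (fps_const u0)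
     = fps_const (a + l0 * h_fun \<beta> u0 * v0 + l0^2 * k_fun \<alpha> \<beta> u0)"
    by (simp add: h_fun_fps k_fun_fps fps_const_power)
  have c1: "fps_const l0 * (6 * fps_const \<beta> * fps_const u0) * fps_const v0 +
      (fps_const l0)^2 * (fps_const \<alpha> - fps_const \<beta> + 3 * fps_const \<beta> * (fps_const u0)^2)
     = fps_const (l0 * (6 * \<beta> * u0) * v0 + l0^2 * (\<alpha> - \<beta> + 3 * \<beta> * u0^2))"
    by (simp add: numeral_fps_const fps_const_power)
  have c2: "fps_const v0 * h_fun (fps_const \<beta>) (fps_const u0) + 2 * fps_const l0 * k_fun (fps_const \<alpha>) (fps_const \<beta>) (fps_const u0)
     = fps_const (v0 * h_fun \<beta> u0 + 2 * l0 * k_fun \<alpha> \<beta> u0)"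
    by (simp add: h_fun_fps k_fun_fps numeral_fps_const)
  have c3: "fps_const l0 * h_fun (fps_const \<beta>) (fps_const u0) * w = fps_const (l0 * h_fun \<beta> u0) * w"
    by (simp add: h_fun_fps)
  show ?thesis
    unfolding E_expr_split base c1 c2 c3 mult.commute[of e "fps_const _"]
    by (simp add: fps_mult_left_const_nth)
qed

lemma Poly_eq_fps:
  "fps_of_poly (Poly xs) = Abs_fps (nth_default 0 xs)"
  by (rule fps_ext) simp

lemma series_has_derivative:
  fixes f f' :: "nat \<Rightarrow> real \<Rightarrow> real"
  assumes d: "\<And>n t. (f n has_real_derivative f' n t) (at t)"
    and b: "\<And>n t. \<bar>f' n t\<bar> \<le> M n" and M: "summable M" and s: "\<And>t. summable (\<lambda>n. f n t)"
  shows "((\<lambda>t. \<Sum>n. f n t) has_real_derivative (\<Sum>n. f' n t)) (at t)"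
proof (rule has_field_derivative_series'(2)[where S=UNIV and ?x0.0=0])
  have "uniform_limit UNIV (\<lambda>n x. \<Sum>i<n. f' i x) (\<lambda>x. \<Sum>i. f' i x) sequentially"
    by (rule Weierstrass_m_test[OF _ M]) (use b in auto)
  then show "uniformly_convergent_on UNIV (\<lambda>n x. \<Sum>i<n. f' i x)"
    by (auto simp: uniformly_convergent_on_def)
qed (use d s in auto)

section \<open>Formal coefficients of the recursion\<close>

context driven
begin

abbreviation rem_at where
  "rem_at \<tau> t U V G \<equiv> rem (fps_const \<alpha>) (fps_const \<beta>) (fps_const (sin (t + \<tau>))) (fps_const (cos (t + \<tau>)))
     (fps_const (u t)) (fps_const (v t)) (fps_const c) U V G fps_X"

lemma coefficients_bounded:
  obtains K where "K \<ge> 0" "\<bar>\<alpha>\<bar> \<le> K" "\<bar>\<beta>\<bar> \<le> K" "\<bar>c\<bar> \<le> K" "\<And>x. \<bar>sin x\<bar> \<le> K" "\<And>x. \<bar>cos x\<bar> \<le> K"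
    "\<And>t. \<bar>u t\<bar> \<le> K" "\<And>t. \<bar>v t\<bar> \<le> K"
proof -
  obtain K0 where K0: "K0 > 0" "\<And>t. \<bar>u t\<bar> \<le> K0" "\<And>t. \<bar>v t\<bar> \<le> K0" using bounded_uv by blast
  show ?thesis
    by (rule that[of "K0 + \<bar>\<alpha>\<bar> + \<bar>\<beta>\<bar> + c + 1"])
       (use K0 c in \<open>auto intro: order_trans[OF K0(2)] order_trans[OF K0(3)]
          order_trans[OF abs_sin_le_one] order_trans[OF abs_cos_le_one]\<close>)
qed

text \<open>M is fixed before \<theta> and R, so \<theta> can later be chosen against M. The lower
  bound on \<open>\<theta> * majorant.V \<theta> R 1\<close> makes \<open>fps_X\<close>, which
  stands for \<mu>, a tiny series.\<close>

definition remainder_bound where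
  "remainder_bound M \<longleftrightarrow> (\<forall>\<theta> R \<tau> t U V G n. majorant \<theta> R \<longrightarrow> \<theta> * majorant.V \<theta> R 1 \<ge> 1 \<longrightarrow> n > 0 \<longrightarrow>
     fps_nth U 0 = 0 \<longrightarrow> fps_nth V 0 = 0 \<longrightarrow> fps_nth G 0 = 0 \<longrightarrow>
     (\<forall>k. \<bar>fps_nth U k\<bar> \<le> majorant.V \<theta> R k) \<longrightarrow> (\<forall>k. \<bar>fps_nth V k\<bar> \<le> majorant.V \<theta> R k) \<longrightarrow>
     (\<forall>k. \<bar>fps_nth G k\<bar> \<le> majorant.V \<theta> R k) \<longrightarrow>
     \<bar>fps_nth (rem_at \<tau> t U V G) n\<bar> \<le> M * \<theta> * majorant.V \<theta> R n)"

lemma remainder_bound_ex: "\<exists>M>0. remainder_bound M"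
proof -
  obtain K where K: "K \<ge> 0" "\<bar>\<alpha>\<bar> \<le> K" "\<bar>\<beta>\<bar> \<le> K" "\<bar>c\<bar> \<le> K" "\<And>x. \<bar>sin x\<bar> \<le> K" "\<And>x. \<bar>cos x\<bar> \<le> K"
    "\<And>t. \<bar>u t\<bar> \<le> K" "\<And>t. \<bar>v t\<bar> \<le> K" by (rule coefficients_bounded) blast
  obtain M where M: "rem_estimate TYPE(real fps) K M" using rem_estimate_ex by blast
  show ?thesis
    unfolding remainder_bound_def
  proof (intro exI[of _ "\<bar>M\<bar> + 1"] conjI allI impI)
    fix \<theta> R \<tau> t :: real and vf wf ef :: "real fps" and n :: nat
    assume maj: "majorant \<theta> R" and X: "\<theta> * majorant.V \<theta> R 1 \<ge> 1" and n: "n > 0"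
      and z: "fps_nth vf 0 = 0" "fps_nth wf 0 = 0" "fps_nth ef 0 = 0"
      and b: "\<forall>k. \<bar>fps_nth vf k\<bar> \<le> majorant.V \<theta> R k" "\<forall>k. \<bar>fps_nth wf k\<bar> \<le> majorant.V \<theta> R k" "\<forall>k. \<bar>fps_nth ef k\<bar> \<le> majorant.V \<theta> R k"
    interpret m: majorant \<theta> R by (rule maj)
    have const: "m.big K (fps_const x) (fps_const x)" if "\<bar>x\<bar> \<le> K" for x
      unfolding m.big_def by (simp add: that K(1) mult_nonneg_nonneg[OF K(1) m.V_nonneg])
    have "m.tiny 1 fps_X fps_X" unfolding m.tiny_def
    proof (intro conjI allI impI)
      fix k :: nat show "\<bar>fps_nth fps_X k\<bar> \<le> 1 * \<theta> * m.V k" 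
      proof (cases "k = 1")
        case True
        then show ?thesis using X by simp
      next
        case False
        have "0 \<le> \<theta> * m.V k" by (intro mult_nonneg_nonneg m.V_nonneg) (use m.\<theta> in simp)
        then show ?thesis using False by simp
      qed
    qed auto
    then have "m.tiny M (rem_at \<tau> t vf wf ef) 
       (rem_at \<tau> t vf wf ef)"
      using b z K
      by (intro rem_estimateD[OF M, of m.big m.small m.tiny] m.graded_axioms const) (auto simp: m.small_def)
    then have "\<bar>fps_nth (rem_at \<tau> t vf wf ef) n\<bar> \<le> M * \<theta> * m.V n"
      using n by (simp add: m.tiny_def)
    also have "\<dots> \<le> (\<bar>M\<bar> + 1) * \<theta> * m.V n"
      using m.\<theta> m.V_nonneg by (intro mult_right_mono) auto
    finally show "\<bar>fps_nth (rem_at \<tau> t vf wf ef) n\<bar> \<le> (\<bar>M\<bar> + 1) * \<theta> * m.V n" .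
  qed simp
qed

abbreviation L where "L \<tau> n \<equiv> prefix_list \<alpha> \<beta> p \<rho> \<Omega>\<^sub>0 u W \<tau> n"
definition ec where "ec n \<tau> = fst (L \<tau> n ! n)"
definition uc where "uc n \<tau> = snd (L \<tau> n ! n)"
definition vc where "vc n \<tau> = deriv (uc n \<tau>)"

lemma length_L: "length (L \<tau> n) = Suc n"
  by (induction n) (auto simp: Let_def)

lemma L_eq: "L \<tau> n = map (\<lambda>j. (ec j \<tau>, uc j \<tau>)) [0..<Suc n]"
proof (induction n)
  case (Suc n)
  have "L \<tau> (Suc n) ! Suc n = (ec (Suc n) \<tau>, uc (Suc n) \<tau>)" by (simp only: ec_def uc_def prod.collapse)
  moreover have "L \<tau> (Suc n) = L \<tau> n @ [L \<tau> (Suc n) ! Suc n]"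
    using length_L[of \<tau> n] by (simp add: Let_def nth_append del: prefix_list.simps(1))
  ultimately have "L \<tau> (Suc n) = L \<tau> n @ [(ec (Suc n) \<tau>, uc (Suc n) \<tau>)]" by (simp only:)
  also have "\<dots> = map (\<lambda>j. (ec j \<tau>, uc j \<tau>)) [0..<Suc (Suc n)]" unfolding Suc by (simp del: prefix_list.simps)
  finally show ?case .
qed (simp add: ec_def uc_def)

lemma ec_0: "ec 0 \<tau> = c" and uc_0: "uc 0 \<tau> = u" and vc_0: "vc 0 \<tau> = v"
  by (simp_all add: ec_def uc_def vc_def inv_c deriv_u)

lemma ec_Suc: "ec (Suc n) \<tau> = fl.eps (Xi \<alpha> \<beta> \<tau> (L \<tau> n))"
  and uc_Suc: "uc (Suc n) \<tau> = u_of \<alpha> \<beta> p \<rho> \<Omega>\<^sub>0 u W \<tau> (L \<tau> n)"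
  using length_L[of \<tau> n] by (simp_all add: ec_def uc_def Let_def nth_append eps_of_eq)

definition vf where "vf n \<tau> t = Abs_fps (\<lambda>j. if 0 < j \<and> j < n then uc j \<tau> t else 0)"
definition wf where "wf n \<tau> t = Abs_fps (\<lambda>j. if 0 < j \<and> j < n then vc j \<tau> t else 0)"
definition ef where "ef n \<tau> t = Abs_fps (\<lambda>j. if 0 < j \<and> j < n then ec j \<tau> else 0)" for t :: real

definition xi where "xi n \<tau> t = fps_nth (rem_at \<tau> t (vf n \<tau> t) (wf n \<tau> t) (ef n \<tau> t)) n"

text \<open>The polynomials stop at degree n, so the linear part contributes nothing at order n + 1
  and only the remainder is left.\<close>

lemma Xi_eq: "Xi \<alpha> \<beta> \<tau> (L \<tau> n) t = xi (Suc n) \<tau> t"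
proof -
  define af where "af = Abs_fps (\<lambda>j. if 0 < j \<and> j < Suc n then deriv (vc j \<tau>) t else 0)"
  have P: "fps_of_poly (Poly (map g [0..<Suc n])) = fps_const (g 0) + Abs_fps (\<lambda>j. if 0 < j \<and> j < Suc n then g j else 0)" for g :: "nat \<Rightarrow> real"
    unfolding Poly_eq_fps by (rule fps_ext) (auto simp: nth_default_def less_Suc_eq simp del: upt_Suc)
  have "Xi \<alpha> \<beta> \<tau> (L \<tau> n) t = fps_nth (E_expr (fps_const \<alpha>) (fps_const \<beta>) (fps_const (sin (t + \<tau>))) (fps_const (cos (t + \<tau>)))
     (fps_const (u t) + vf (Suc n) \<tau> t) (fps_const (v t) + wf (Suc n) \<tau> t) (fps_const (deriv v t) + af) (fps_const c + ef (Suc n) \<tau> t) fps_X) (Suc n)"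
    unfolding Xi_def length_L unfolding L_eq map_map o_def case_prod_conv fst_conv
    by (subst fps_of_poly_nth[symmetric])
       (simp only: fps_of_poly_E_expr P fps_of_poly_const fps_of_poly_fps_X vf_def wf_def ef_def af_def uc_0 deriv_u ec_0 vc_def)
  also have "\<dots> = xi (Suc n) \<tau> t"
    by (subst E_expr_nth) (auto simp: vf_def wf_def ef_def af_def xi_def)
  finally show ?thesis .
qed

text \<open>Strong induction: lower coefficients of bounded degree make the truncated series
  \<open>graded_tp\<close>, so xi n has degree n. Then \<open>tp_solve\<close> passes the degree on
  to a solution, which uniqueness identifies with the recursively defined one.\<close>

lemma coefficients:
  "tp Q n (\<lambda>\<tau>. uc n \<tau>) \<and> tp Q n (\<lambda>\<tau>. vc n \<tau>) \<and> tp Q n (\<lambda>\<tau> t. ec n \<tau>) \<and>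
   (n > 0 \<longrightarrow> tp Q n (xi n) \<and> (\<forall>\<tau>. fl.solves_lin (xi n \<tau>) (ec n \<tau>) (uc n \<tau>) (vc n \<tau>)))"
proof (induction n rule: less_induct)
  case (less n)
  show ?case
  proof (cases n)
    case 0
    then show ?thesis by (auto simp: ec_0 uc_0 vc_0 per_q intro!: tp_const cont_u cont_v)
  next
    case (Suc m)
    have tp_if: "tp Q j (\<lambda>\<tau> t. if P then f \<tau> t else 0)" if "P \<Longrightarrow> tp Q j f" for P j f
      by (cases P) (simp_all add: that tp_number)
    have "graded_tp Q (vf n)" "graded_tp Q (wf n)" "graded_tp Q (ef n)"
      using less unfolding graded_tp_def vf_def wf_def ef_def fps_nth_Abs_fps by (auto intro!: tp_if)
    then have xi: "tp Q n (xi n)"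
      using graded_tp_rem[OF refl cont_u per_q(1) cont_v per_q(2)] by (simp add: graded_tp_def xi_def[abs_def])
    from fl.tp_solve[OF xi] obtain w x where wx: "tp Q n w" "tp Q n x"
      "\<And>\<tau>. fl.solves_lin (xi n \<tau>) (fl.eps (xi n \<tau>)) (w \<tau>) (x \<tau>)" "tp Q n (\<lambda>\<tau> t. fl.eps (xi n \<tau>))" by blast
    have Xi: "Xi \<alpha> \<beta> \<tau> (L \<tau> m) = xi n \<tau>" for \<tau> using Xi_eq Suc by auto
    have ec: "ec n \<tau> = fl.eps (xi n \<tau>)" for \<tau> by (simp add: Suc ec_Suc Xi[unfolded Suc])
    have uc: "uc n \<tau> = w \<tau>" for \<tau>
      unfolding Suc uc_Suc by (rule u_of_eq) (use wx(3) Xi Suc in simp)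
    have "(w \<tau> has_real_derivative x \<tau> t) (at t)" for \<tau> t using wx(3)[of \<tau>] by (simp add: fl.solves_lin_def)
    then have "deriv (w \<tau>) = x \<tau>" for \<tau> using DERIV_imp_deriv by blast
    then have vc: "vc n \<tau> = x \<tau>" for \<tau> by (simp add: vc_def uc)
    show ?thesis using wx xi ec uc vc by simp
  qed
qed

text \<open>The full and the truncated series agree below order n. Since the remainder is tiny in
  the sense of \<open>agreement\<close>, its coefficient of order n is the same for both.\<close>

lemma xi_full:
  assumes n: "n > 0"
  shows "fps_nth (rem_at \<tau> t (Abs_fps (\<lambda>j. if j = 0 then 0 else uc j \<tau> t)) (Abs_fps (\<lambda>j. if j = 0 then 0 else vc j \<tau> t)) (Abs_fps (\<lambda>j. if j = 0 then 0 else ec j \<tau>))) n = xi n \<tau> t"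
proof -
  interpret a: agreement n by unfold_locales (rule n)
  obtain M where M: "rem_estimate TYPE(real fps) 0 M" using rem_estimate_ex by blast
  have "a.tiny M (rem_at \<tau> t (Abs_fps (\<lambda>j. if j = 0 then 0 else uc j \<tau> t)) (Abs_fps (\<lambda>j. if j = 0 then 0 else vc j \<tau> t)) (Abs_fps (\<lambda>j. if j = 0 then 0 else ec j \<tau>)))
     (rem_at \<tau> t (vf n \<tau> t) (wf n \<tau> t) (ef n \<tau> t))"
    by (intro rem_estimateD[OF M, of a.big a.small a.tiny] a.graded_axioms)
       (auto simp: a.big_def a.small_def a.tiny_def vf_def wf_def ef_def)
  then show ?thesis by (simp add: a.tiny_def xi_def)
qed

end

section \<open>Geometric growth of the coefficients and the formal solution\<close>

context driven
begin

definition geometric_bound where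
  "geometric_bound R \<longleftrightarrow> R > 0 \<and> (\<forall>n>0. \<forall>\<tau> t. \<bar>uc n \<tau> t\<bar> \<le> R ^ n \<and> \<bar>vc n \<tau> t\<bar> \<le> R ^ n \<and>
     \<bar>ec n \<tau>\<bar> \<le> R ^ n \<and> \<bar>xi n \<tau> t\<bar> \<le> R ^ n)"

lemma geometric_bound_ex: "\<exists>R. geometric_bound R"
proof -
  obtain Ms where Ms: "Ms > 0" and "fl.solution_bound Ms" using fl.solution_bound_ex by blast
  note sol = this(2)[unfolded fl.solution_bound_def, rule_format]
  obtain M where M: "M > 0" and "remainder_bound M" using remainder_bound_ex by blast
  note rem = this(2)[unfolded remainder_bound_def, rule_format]
  \<comment> \<open>M \<theta> \<le> 1 keeps xi below V, and Ms M \<theta> \<le> 1 does the same for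
    the solution and the parameter, so the induction reproduces its hypothesis.\<close>
  define \<theta> where "\<theta> = min 1 (min (1 / M) (1 / (Ms * M)))"
  \<comment> \<open>The value with \<theta> V(1) = 1, as V(1) = \<theta> R/8.\<close>
  define R where "R = 8 / \<theta>^2"
  have th: "0 < \<theta>" "\<theta> \<le> 1" "\<theta> \<le> 1 / M" "\<theta> \<le> 1 / (Ms * M)" using M Ms by (auto simp: \<theta>_def)
  then have th': "M * \<theta> \<le> 1" "Ms * (M * \<theta>) \<le> 1" using M Ms by (simp_all add: field_simps)
  have R: "R > 0" using th by (simp add: R_def)
  interpret m: majorant \<theta> R using th R by unfold_locales auto
  have "\<theta> * m.V 1 = 1" unfolding m.V_def inv_sq_def using th by (simp add: R_def power2_eq_square)
  then have one: "\<theta> * m.V 1 \<ge> 1" by simp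
  have main: "n > 0 \<longrightarrow> (\<forall>\<tau> t. \<bar>uc n \<tau> t\<bar> \<le> m.V n \<and> \<bar>vc n \<tau> t\<bar> \<le> m.V n \<and> \<bar>ec n \<tau>\<bar> \<le> m.V n \<and> \<bar>xi n \<tau> t\<bar> \<le> m.V n)" for n
  proof (induction n rule: less_induct)
    case (less n)
    show ?case
    proof (intro impI allI)
      fix \<tau> t assume n: "n > 0"
      have xi: "\<bar>xi n \<tau> t\<bar> \<le> M * \<theta> * m.V n" for t
        unfolding xi_def using less m.V_nonneg n
        by (intro rem m.majorant_axioms one) (auto simp: vf_def wf_def ef_def)
      have C: "tp Q n (xi n)" "fl.solves_lin (xi n \<tau>) (ec n \<tau>) (uc n \<tau>) (vc n \<tau>)"
        using coefficients[of n] n by auto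
      have cont: "continuous_on UNIV (xi n \<tau>)" using tp_continuous[OF C(1)] .
      obtain w x where wx: "fl.solves_lin (xi n \<tau>) (fl.eps (xi n \<tau>)) w x" "\<bar>fl.eps (xi n \<tau>)\<bar> \<le> Ms * (M * \<theta> * m.V n)"
        "\<And>t. \<bar>w t\<bar> \<le> Ms * (M * \<theta> * m.V n)" "\<And>t. \<bar>x t\<bar> \<le> Ms * (M * \<theta> * m.V n)"
        using sol[OF cont tp_periodic[OF C(1)] xi] by blast
      have e: "ec n \<tau> = fl.eps (xi n \<tau>)" by (rule fl.solves_lin_eps[OF cont C(2)])
      have eq: "uc n \<tau> t = w t" "vc n \<tau> t = x t" using fl.solves_lin_unique[OF C(2)[unfolded e] wx(1)] by auto
      have "Ms * (M * \<theta> * m.V n) = (Ms * (M * \<theta>)) * m.V n" by simp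
      also have "\<dots> \<le> 1 * m.V n" by (intro mult_right_mono th' m.V_nonneg)
      finally have le: "Ms * (M * \<theta> * m.V n) \<le> m.V n" by simp
      have le2: "M * \<theta> * m.V n \<le> 1 * m.V n" by (intro mult_right_mono th' m.V_nonneg)
      show "\<bar>uc n \<tau> t\<bar> \<le> m.V n \<and> \<bar>vc n \<tau> t\<bar> \<le> m.V n \<and> \<bar>ec n \<tau>\<bar> \<le> m.V n \<and> \<bar>xi n \<tau> t\<bar> \<le> m.V n"
        unfolding e eq using order_trans[OF wx(2) le] order_trans[OF wx(3) le] order_trans[OF wx(4) le] xi[of t] le2
        by auto
    qed
  qed
  have "geometric_bound R"
    unfolding geometric_bound_def using R main m.V_le by (meson order_trans)
  then show ?thesis ..
qed

text \<open>Coefficients of the second derivative, solved for in the equation of the orbit at order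
  0 and in the linear recursion equation beyond.\<close>

definition ac where
  "ac n \<tau> t = (if n = 0 then - (F t * v t + c^2 * k_fun \<alpha> \<beta> (u t))
     else - (F t * vc n \<tau> t + B t * uc n \<tau> t + ec n \<tau> * fl.chi t + xi n \<tau> t))"

lemma dc: "(uc n \<tau> has_real_derivative vc n \<tau> t) (at t)" "(vc n \<tau> has_real_derivative ac n \<tau> t) (at t)"
proof -
  have "(uc n \<tau> has_real_derivative vc n \<tau> t) (at t) \<and> (vc n \<tau> has_real_derivative ac n \<tau> t) (at t)"
  proof (cases "n = 0")
    case True
    then show ?thesis using du dv by (simp add: uc_0 vc_0 ac_def)
  next
    case False
    then show ?thesis using coefficients[of n] by (auto simp: ac_def fl.solves_lin_def)
  qed
  then show "(uc n \<tau> has_real_derivative vc n \<tau> t) (at t)" "(vc n \<tau> has_real_derivative ac n \<tau> t) (at t)" by auto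
qed

lemma vc_at_0: "vc n \<tau> 0 = 0"
  using coefficients[of n] v0 by (cases "n = 0") (auto simp: vc_0 fl.solves_lin_def)

lemma per_c: "uc n \<tau> (t + Q) = uc n \<tau> t" "vc n \<tau> (t + Q) = vc n \<tau> t"
  using coefficients[of n] tp_periodic by blast+

text \<open>For n > 0 the definition of \<open>ac\<close> cancels the linear part against xi n,
  which by \<open>xi_full\<close> is also the coefficient formed from the full series; order 0 is
  the equation of the orbit.\<close>

lemma formal_equation:
  "E_expr (fps_const \<alpha>) (fps_const \<beta>) (fps_const (sin (t + \<tau>))) (fps_const (cos (t + \<tau>)))
    (Abs_fps (\<lambda>n. uc n \<tau> t)) (Abs_fps (\<lambda>n. vc n \<tau> t)) (Abs_fps (\<lambda>n. ac n \<tau> t)) (Abs_fps (\<lambda>n. ec n \<tau>)) fps_X = 0"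
proof (rule fps_ext)
  fix n
  define U where "U = Abs_fps (\<lambda>j. if j = 0 then 0 else uc j \<tau> t)"
  define V where "V = Abs_fps (\<lambda>j. if j = 0 then 0 else vc j \<tau> t)"
  define A where "A = Abs_fps (\<lambda>j. if j = 0 then 0 else ac j \<tau> t)"
  define G where "G = Abs_fps (\<lambda>j. if j = 0 then 0 else ec j \<tau>)"
  have eqs: "Abs_fps (\<lambda>n. uc n \<tau> t) = fps_const (u t) + U" "Abs_fps (\<lambda>n. vc n \<tau> t) = fps_const (v t) + V"
    "Abs_fps (\<lambda>n. ac n \<tau> t) = fps_const (ac 0 \<tau> t) + A" "Abs_fps (\<lambda>n. ec n \<tau>) = fps_const c + G"
    by (rule fps_ext, simp add: U_def V_def A_def G_def uc_0 vc_0 ec_0)+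
  have z: "fps_nth U 0 = 0" "fps_nth V 0 = 0" "fps_nth A 0 = 0" "fps_nth G 0 = 0"
    by (simp_all add: U_def V_def A_def G_def)
  show "fps_nth (E_expr (fps_const \<alpha>) (fps_const \<beta>) (fps_const (sin (t + \<tau>))) (fps_const (cos (t + \<tau>)))
    (Abs_fps (\<lambda>n. uc n \<tau> t)) (Abs_fps (\<lambda>n. vc n \<tau> t)) (Abs_fps (\<lambda>n. ac n \<tau> t)) (Abs_fps (\<lambda>n. ec n \<tau>)) fps_X) n = fps_nth 0 n"
  proof (cases "n = 0")
    case True
    then show ?thesis
      unfolding eqs E_expr_nth[OF z(1,2,4,3)]
      by (simp add: z ac_def F_def rem_def quad_rem_def Let_def)
  next
    case False
    then have x: "fps_nth (rem_at \<tau> t U V G) n = xi n \<tau> t"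
      unfolding U_def V_def G_def by (intro xi_full) auto
    show ?thesis
      unfolding eqs E_expr_nth[OF z(1,2,4,3)] x
      using False by (simp add: U_def V_def A_def G_def ac_def chi_eq chi_def F_def B_def algebra_simps)
  qed
qed

end

section \<open>From formal to convergent series\<close>

lemma fps_conv_radius_gt:
  fixes f :: "real fps"
  assumes b: "\<And>n. \<bar>fps_nth f n\<bar> \<le> K * R ^ n" and R: "R > 0" and \<mu>: "\<bar>\<mu>\<bar> * R < 1"
  shows "ereal (norm \<mu>) < fps_conv_radius f"
proof -
  have "\<bar>\<mu>\<bar> < 1 / R" using R \<mu> by (simp add: field_simps)
  then obtain z where z: "\<bar>\<mu>\<bar> < z" "z < 1 / R" using dense by blast
  have "summable (\<lambda>n. K * (R * z) ^ n)"
    using z R by (intro summable_mult summable_geometric) (auto simp: field_simps abs_mult)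
  then have "summable (\<lambda>n. fps_nth f n * z ^ n)"
  proof (rule summable_comparison_test')
    fix n
    have "norm (fps_nth f n * z ^ n) = \<bar>fps_nth f n\<bar> * z ^ n" using z by (simp add: abs_mult power_abs)
    also have "\<dots> \<le> K * R ^ n * z ^ n" using z by (intro mult_right_mono b) auto
    finally show "norm (fps_nth f n * z ^ n) \<le> K * (R * z) ^ n" by (simp add: power_mult_distrib)
  qed
  then have "ereal (norm z) \<le> fps_conv_radius f" unfolding fps_conv_radius_def by (rule conv_radius_geI)
  moreover have "ereal (norm \<mu>) < ereal (norm z)" using z by simp
  ultimately show ?thesis by (rule less_le_trans[rotated])
qed

lemma eval_fps_E_expr:
  fixes a b S C m :: "real fps"
  assumes "ereal (norm z) < fps_conv_radius u" "ereal (norm z) < fps_conv_radius du"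
    "ereal (norm z) < fps_conv_radius ddu" "ereal (norm z) < fps_conv_radius l"
  shows "eval_fps (E_expr (fps_const \<alpha>) (fps_const \<beta>) (fps_const s) (fps_const c) u du ddu l fps_X) z =
    E_expr \<alpha> \<beta> s c (eval_fps u z) (eval_fps du z) (eval_fps ddu z) (eval_fps l z) z"
proof -
  \<comment> \<open>Radius and value are carried together, since evaluation respects sums and
    products inside the disc of convergence.\<close>
  let ?G = "\<lambda>f g. ereal (norm z) < fps_conv_radius f \<and> eval_fps f z = g"
  have add: "?G (f + f') (g + g')" if "?G f g" "?G f' g'" for f f' g g'
    using that fps_conv_radius_add[of f f'] by (auto simp: eval_fps_add min_le_iff_disj intro: less_le_trans)
  have diff: "?G (f - f') (g - g')" if "?G f g" "?G f' g'" for f f' g g'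
    using that fps_conv_radius_diff[of f f'] by (auto simp: eval_fps_diff min_le_iff_disj intro: less_le_trans)
  have mult: "?G (f * f') (g * g')" if "?G f g" "?G f' g'" for f f' g g'
    using that fps_conv_radius_mult[of f f'] by (auto simp: eval_fps_mult min_le_iff_disj intro: less_le_trans)
  have const: "?G (fps_const x) x" "?G fps_X z" "?G 1 1" "?G (numeral n) (numeral n)" for x n by auto
  have "?G (E_expr (fps_const \<alpha>) (fps_const \<beta>) (fps_const s) (fps_const c) u du ddu l fps_X)
    (E_expr \<alpha> \<beta> s c (eval_fps u z) (eval_fps du z) (eval_fps ddu z) (eval_fps l z) z)"
    unfolding E_expr_def h_fun_def k_fun_def power2_eq_square power3_eq_cube
    by (intro add diff mult const) (use assms in auto)
  then show ?thesis by simp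
qed

text \<open>With |\<mu>| R \<le> 1/2 a geometric tail is at most twice its first term.\<close>

lemma suminf_tail_bound:
  fixes a :: "nat \<Rightarrow> real"
  assumes b: "\<And>n. n \<ge> N \<Longrightarrow> \<bar>a n\<bar> \<le> K * R ^ n" and R: "R > 0" and K: "K \<ge> 0" and \<mu>: "\<bar>\<mu>\<bar> * R \<le> 1 / 2"
  shows "summable (\<lambda>n. \<mu> ^ n * a n)" and "\<bar>(\<Sum>n. \<mu> ^ n * a n) - (\<Sum>n<N. \<mu> ^ n * a n)\<bar> \<le> 2 * K * R ^ N * \<bar>\<mu>\<bar> ^ N"
proof -
  define x where "x = \<bar>\<mu>\<bar> * R"
  have x: "0 \<le> x" "x \<le> 1/2" using R \<mu> by (auto simp: x_def)
  have g: "summable (\<lambda>n. K * x ^ N * x ^ n)" using x by (intro summable_mult summable_geometric) auto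
  have le: "norm (\<mu> ^ (n + N) * a (n + N)) \<le> K * x ^ N * x ^ n" for n
  proof -
    have "norm (\<mu> ^ (n + N) * a (n + N)) = \<bar>\<mu>\<bar> ^ (n + N) * \<bar>a (n + N)\<bar>" by (simp add: abs_mult power_abs)
    also have "\<dots> \<le> \<bar>\<mu>\<bar> ^ (n + N) * (K * R ^ (n + N))" by (intro mult_left_mono b) auto
    finally show ?thesis by (simp add: x_def power_mult_distrib power_add mult_ac)
  qed
  have s: "summable (\<lambda>n. \<mu> ^ (n + N) * a (n + N))" by (rule summable_comparison_test'[OF g]) (use le in auto)
  then show sum: "summable (\<lambda>n. \<mu> ^ n * a n)" using summable_iff_shift[of "\<lambda>n. \<mu> ^ n * a n" N] by simp
  have "(\<Sum>n. \<mu> ^ n * a n) - (\<Sum>n<N. \<mu> ^ n * a n) = (\<Sum>n. \<mu> ^ (n + N) * a (n + N))"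
    using suminf_split_initial_segment[OF sum, of N] by simp
  then have "\<bar>(\<Sum>n. \<mu> ^ n * a n) - (\<Sum>n<N. \<mu> ^ n * a n)\<bar> \<le> (\<Sum>n. K * x ^ N * x ^ n)"
    using norm_suminf_le[OF le g] by simp
  also have "\<dots> = K * x ^ N * (1 / (1 - x))" using x by (subst suminf_mult) (auto simp: suminf_geometric intro: summable_geometric)
  also have "\<dots> \<le> K * x ^ N * 2" using x K by (intro mult_left_mono) (auto simp: field_simps)
  finally show "\<bar>(\<Sum>n. \<mu> ^ n * a n) - (\<Sum>n<N. \<mu> ^ n * a n)\<bar> \<le> 2 * K * R ^ N * \<bar>\<mu>\<bar> ^ N"
    by (simp add: x_def power_mult_distrib mult_ac)
qed

context driven
begin

definition us where "us \<mu> \<tau> t = (\<Sum>n. \<mu> ^ n * uc n \<tau> t)"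
definition vs where "vs \<mu> \<tau> t = (\<Sum>n. \<mu> ^ n * vc n \<tau> t)"
definition acs where "acs \<mu> \<tau> t = (\<Sum>n. \<mu> ^ n * ac n \<tau> t)"
definition ls where "ls \<mu> \<tau> = (\<Sum>n. \<mu> ^ n * ec n \<tau>)"

text \<open>K absorbs the coefficients of order 0, which \<open>geometric_bound\<close> omits, and
  the coefficient functions of the linear equation that determines \<open>ac\<close>.\<close>

lemma total_bounds:
  assumes "geometric_bound R"
  obtains K where "K > 0" "\<And>n \<tau> t. \<bar>uc n \<tau> t\<bar> \<le> K * R ^ n" "\<And>n \<tau> t. \<bar>vc n \<tau> t\<bar> \<le> K * R ^ n"
    "\<And>n \<tau>. \<bar>ec n \<tau>\<bar> \<le> K * R ^ n" "\<And>n \<tau> t. \<bar>ac n \<tau> t\<bar> \<le> K * R ^ n"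
proof -
  obtain K0 where K0: "K0 > 0" "\<And>t. \<bar>u t\<bar> \<le> K0" "\<And>t. \<bar>v t\<bar> \<le> K0" using bounded_uv by blast
  have cg: "continuous_on UNIV (\<lambda>t. \<bar>F t\<bar> + \<bar>B t\<bar> + \<bar>fl.chi t\<bar> + \<bar>F t * v t + c^2 * k_fun \<alpha> \<beta> (u t)\<bar>)"
    unfolding k_fun_def by (intro continuous_intros cont_F cont_B fl.cont_chi cont_v cont_u)
  obtain K1 where K1: "K1 > 0" "\<And>t. \<bar>\<bar>F t\<bar> + \<bar>B t\<bar> + \<bar>fl.chi t\<bar> + \<bar>F t * v t + c^2 * k_fun \<alpha> \<beta> (u t)\<bar>\<bar> \<le> K1"
    by (rule periodic_bounded[OF _ Q_pos cg]) (auto simp: per_q per_B_q fl.per_chi)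
  have K1': "\<bar>F t\<bar> + \<bar>B t\<bar> + \<bar>fl.chi t\<bar> \<le> K1" "\<bar>F t * v t + c^2 * k_fun \<alpha> \<beta> (u t)\<bar> \<le> K1" for t
    using K1(2)[of t] by linarith+
  define K where "K = K0 + K1 + c + 1"
  have R: "R > 0" and g: "\<And>n \<tau> t. n > 0 \<Longrightarrow> \<bar>uc n \<tau> t\<bar> \<le> R ^ n \<and> \<bar>vc n \<tau> t\<bar> \<le> R ^ n \<and> \<bar>ec n \<tau>\<bar> \<le> R ^ n \<and> \<bar>xi n \<tau> t\<bar> \<le> R ^ n"
    using assms by (auto simp: geometric_bound_def)
  have K: "K \<ge> 1" "K \<ge> K0" "K \<ge> K1" "K \<ge> c" "K \<ge> K1 + 1" using K0 K1 c by (auto simp: K_def)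
  have le: "R ^ n \<le> K * R ^ n" for n using K R by simp
  show ?thesis
  proof (rule that[of K])
    show "K > 0" using K by simp
    fix n \<tau> t
    show "\<bar>uc n \<tau> t\<bar> \<le> K * R ^ n" "\<bar>vc n \<tau> t\<bar> \<le> K * R ^ n" "\<bar>ec n \<tau>\<bar> \<le> K * R ^ n"
      using g[of n \<tau> t] le[of n] K0(2)[of t] K0(3)[of t] K c
      by (cases "n = 0", auto simp: uc_0 vc_0 ec_0)+
    show "\<bar>ac n \<tau> t\<bar> \<le> K * R ^ n"
    proof (cases "n = 0")
      case True
      then show ?thesis using K1'(2)[of t] K by (simp add: ac_def)
    next
      case False
      have g': "\<bar>uc n \<tau> t\<bar> \<le> R ^ n" "\<bar>vc n \<tau> t\<bar> \<le> R ^ n" "\<bar>ec n \<tau>\<bar> \<le> R ^ n" "\<bar>xi n \<tau> t\<bar> \<le> R ^ n"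
        using g[of n] False by auto
      have "\<bar>ac n \<tau> t\<bar> \<le> \<bar>F t\<bar> * \<bar>vc n \<tau> t\<bar> + \<bar>B t\<bar> * \<bar>uc n \<tau> t\<bar> + \<bar>fl.chi t\<bar> * \<bar>ec n \<tau>\<bar> + \<bar>xi n \<tau> t\<bar>"
        using False by (simp add: ac_def abs_mult[symmetric] mult.commute[of "ec n \<tau>"])
      also have "\<dots> \<le> \<bar>F t\<bar> * R ^ n + \<bar>B t\<bar> * R ^ n + \<bar>fl.chi t\<bar> * R ^ n + R ^ n"
        by (intro add_mono mult_left_mono g') auto
      also have "\<dots> = (\<bar>F t\<bar> + \<bar>B t\<bar> + \<bar>fl.chi t\<bar> + 1) * R ^ n" by (simp add: distrib_right)
      also have "\<dots> \<le> K * R ^ n" using K1'(1)[of t] K R by (intro mult_right_mono) auto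
      finally show ?thesis .
    qed
  qed
qed

lemma series_solution:
  assumes gb: "geometric_bound R" and \<mu>: "\<bar>\<mu>\<bar> * R \<le> 1 / 2"
  shows "(us \<mu> \<tau> has_real_derivative vs \<mu> \<tau> t) (at t)"
    and "(vs \<mu> \<tau> has_real_derivative acs \<mu> \<tau> t) (at t)"
    and "E_expr \<alpha> \<beta> (sin (t + \<tau>)) (cos (t + \<tau>)) (us \<mu> \<tau> t) (vs \<mu> \<tau> t) (acs \<mu> \<tau> t) (ls \<mu> \<tau>) \<mu> = 0"
    and "us \<mu> \<tau> (t + Q) = us \<mu> \<tau> t" and "vs \<mu> \<tau> 0 = 0"
    and "summable (\<lambda>n. \<mu> ^ n * uc n \<tau> t)" and "summable (\<lambda>n. \<mu> ^ n * ec n \<tau>)"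
    and "\<bar>us \<mu> \<tau> t - u t\<bar> \<le> 2 * R * \<bar>\<mu>\<bar>" and "\<bar>vs \<mu> \<tau> t - v t\<bar> \<le> 2 * R * \<bar>\<mu>\<bar>"
    and "\<bar>ls \<mu> \<tau> - c\<bar> \<le> 2 * R * \<bar>\<mu>\<bar>"
    and "continuous_on UNIV (ls \<mu>)"
proof -
  have R: "R > 0" using gb by (simp add: geometric_bound_def)
  obtain K where K: "K > 0" "\<And>n \<tau> t. \<bar>uc n \<tau> t\<bar> \<le> K * R ^ n" "\<And>n \<tau> t. \<bar>vc n \<tau> t\<bar> \<le> K * R ^ n"
    "\<And>n \<tau>. \<bar>ec n \<tau>\<bar> \<le> K * R ^ n" "\<And>n \<tau> t. \<bar>ac n \<tau> t\<bar> \<le> K * R ^ n"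
    using total_bounds[OF gb] by blast
  note K0 = less_imp_le[OF K(1)]
  have s: "summable (\<lambda>n. \<mu> ^ n * uc n \<tau> t)" "summable (\<lambda>n. \<mu> ^ n * vc n \<tau> t)" "summable (\<lambda>n. \<mu> ^ n * ac n \<tau> t)" "summable (\<lambda>n. \<mu> ^ n * ec n \<tau>)" for t \<tau>
    by (rule suminf_tail_bound(1)[where N=0, OF _ R K0 \<mu>], use K in blast)+
  show "summable (\<lambda>n. \<mu> ^ n * uc n \<tau> t)" "summable (\<lambda>n. \<mu> ^ n * ec n \<tau>)" by (rule s)+
  have geo: "summable (\<lambda>n. K * (\<bar>\<mu>\<bar> * R) ^ n)" using \<mu> R by (intro summable_mult summable_geometric) auto
  have tm: "\<bar>\<mu> ^ n * a\<bar> \<le> K * (\<bar>\<mu>\<bar> * R) ^ n" if "\<bar>a\<bar> \<le> K * R ^ n" for n a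
  proof -
    have "\<bar>\<mu>\<bar> ^ n * \<bar>a\<bar> \<le> \<bar>\<mu>\<bar> ^ n * (K * R ^ n)" by (intro mult_left_mono that) auto
    then show ?thesis by (simp add: abs_mult power_abs power_mult_distrib mult_ac)
  qed
  show "(us \<mu> \<tau> has_real_derivative vs \<mu> \<tau> t) (at t)"
    unfolding us_def[abs_def] vs_def
    by (rule series_has_derivative[OF _ _ geo s(1)]) (intro DERIV_cmult dc tm K)+
  show "(vs \<mu> \<tau> has_real_derivative acs \<mu> \<tau> t) (at t)"
    unfolding vs_def[abs_def] acs_def
    by (rule series_has_derivative[OF _ _ geo s(2)]) (intro DERIV_cmult dc tm K)+
  show "us \<mu> \<tau> (t + Q) = us \<mu> \<tau> t" by (simp add: us_def per_c)
  show "vs \<mu> \<tau> 0 = 0" by (simp add: vs_def vc_at_0)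
  have lt: "\<bar>\<mu>\<bar> * R < 1" using \<mu> by simp
  have ev: "us \<mu> \<tau> t = eval_fps (Abs_fps (\<lambda>n. uc n \<tau> t)) \<mu>" "vs \<mu> \<tau> t = eval_fps (Abs_fps (\<lambda>n. vc n \<tau> t)) \<mu>"
    "acs \<mu> \<tau> t = eval_fps (Abs_fps (\<lambda>n. ac n \<tau> t)) \<mu>" "ls \<mu> \<tau> = eval_fps (Abs_fps (\<lambda>n. ec n \<tau>)) \<mu>"
    by (simp_all add: us_def vs_def acs_def ls_def eval_fps_def mult.commute)
  have r: "ereal (norm \<mu>) < fps_conv_radius (Abs_fps a)" if "\<And>n. \<bar>a n\<bar> \<le> K * R ^ n" for a
    by (rule fps_conv_radius_gt[OF _ R lt, where K=K]) (simp add: that)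
  show "E_expr \<alpha> \<beta> (sin (t + \<tau>)) (cos (t + \<tau>)) (us \<mu> \<tau> t) (vs \<mu> \<tau> t) (acs \<mu> \<tau> t) (ls \<mu> \<tau>) \<mu> = 0"
    unfolding ev eval_fps_E_expr[OF r[OF K(2)] r[OF K(3)] r[OF K(5)] r[OF K(4)], symmetric] formal_equation by simp
  have g: "\<And>n \<tau> t. n \<ge> 1 \<Longrightarrow> \<bar>uc n \<tau> t\<bar> \<le> 1 * R ^ n \<and> \<bar>vc n \<tau> t\<bar> \<le> 1 * R ^ n \<and> \<bar>ec n \<tau>\<bar> \<le> 1 * R ^ n"
    using gb by (auto simp: geometric_bound_def)
  \<comment> \<open>The tail from N = 1 is the deviation from the order-zero term, here and in the
    next two bounds.\<close>
  show "\<bar>us \<mu> \<tau> t - u t\<bar> \<le> 2 * R * \<bar>\<mu>\<bar>"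
    using suminf_tail_bound(2)[where N=1 and K=1 and a="\<lambda>n. uc n \<tau> t", OF _ R _ \<mu>] g by (simp add: us_def uc_0)
  show "\<bar>vs \<mu> \<tau> t - v t\<bar> \<le> 2 * R * \<bar>\<mu>\<bar>"
    using suminf_tail_bound(2)[where N=1 and K=1 and a="\<lambda>n. vc n \<tau> t", OF _ R _ \<mu>] g by (simp add: vs_def vc_0)
  show "\<bar>ls \<mu> \<tau> - c\<bar> \<le> 2 * R * \<bar>\<mu>\<bar>"
    using suminf_tail_bound(2)[where N=1 and K=1 and a="\<lambda>n. ec n \<tau>", OF _ R _ \<mu>] g by (simp add: ls_def ec_0)
  have cont_ec: "continuous_on UNIV (\<lambda>\<tau>. ec n \<tau>)" for n
    using tp_continuous_phase[of Q n "\<lambda>\<tau> t. ec n \<tau>"] coefficients[of n] by blast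
  have "uniform_limit UNIV (\<lambda>n \<tau>. \<Sum>i<n. \<mu> ^ i * ec i \<tau>) (\<lambda>\<tau>. \<Sum>i. \<mu> ^ i * ec i \<tau>) sequentially"
    by (rule Weierstrass_m_test[OF _ geo]) (use tm[OF K(4)] in auto)
  then show "continuous_on UNIV (ls \<mu>)"
    unfolding ls_def[abs_def]
    by (rule uniform_limit_theorem[rotated]) (auto intro!: always_eventually continuous_on_sum continuous_on_mult_left cont_ec)
qed

lemma D_series_eq:
  assumes gb: "geometric_bound R" and \<mu>: "\<bar>\<mu>\<bar> * R \<le> 1 / 2"
  shows "summable (\<lambda>k. \<mu> ^ Suc k * D_coeff \<alpha> \<beta> p \<rho> \<Omega>\<^sub>0 u W (Suc k) \<tau>)"
    and "D_series \<alpha> \<beta> p \<rho> \<Omega>\<^sub>0 u W \<tau> \<mu> = ls \<mu> \<tau> - c"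
proof -
  have "eps_of \<alpha> \<beta> p \<rho> \<Omega>\<^sub>0 u W \<tau> (L \<tau> k) = ec (Suc k) \<tau>" for k by (simp add: ec_Suc eps_of_eq)
  then have D: "D_coeff \<alpha> \<beta> p \<rho> \<Omega>\<^sub>0 u W (Suc k) \<tau> = s * ec (Suc k) \<tau>" for k
    using s_pos by (simp add: D_coeff_def eps_of_def A_const_eq field_simps)
  have sum: "summable (\<lambda>n. \<mu> ^ n * ec n \<tau>)" by (rule series_solution(7)[OF gb \<mu>])
  then have sum': "summable (\<lambda>k. \<mu> ^ Suc k * ec (Suc k) \<tau>)" by (subst summable_Suc_iff)
  have e: "\<mu> ^ Suc k * D_coeff \<alpha> \<beta> p \<rho> \<Omega>\<^sub>0 u W (Suc k) \<tau> = s * (\<mu> ^ Suc k * ec (Suc k) \<tau>)" for k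
    unfolding D by (simp add: mult_ac)
  show "summable (\<lambda>k. \<mu> ^ Suc k * D_coeff \<alpha> \<beta> p \<rho> \<Omega>\<^sub>0 u W (Suc k) \<tau>)"
    unfolding e by (intro summable_mult sum')
  show "D_series \<alpha> \<beta> p \<rho> \<Omega>\<^sub>0 u W \<tau> \<mu> = ls \<mu> \<tau> - c"
    unfolding D_series_def e A_const_eq suminf_mult[OF sum'] ls_def suminf_split_head[OF sum]
    using s_pos by (simp add: ec_0)
qed

lemma u_series_eq:
  assumes gb: "geometric_bound R" and \<mu>: "\<bar>\<mu>\<bar> * R \<le> 1 / 2"
  shows "summable (\<lambda>k. \<mu> ^ Suc k * u_coeff \<alpha> \<beta> p \<rho> \<Omega>\<^sub>0 u W (Suc k) \<tau> t)"
    and "u_series \<alpha> \<beta> p \<rho> \<Omega>\<^sub>0 u W \<tau> \<mu> t = us \<mu> \<tau> t"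
proof -
  have U: "u_coeff \<alpha> \<beta> p \<rho> \<Omega>\<^sub>0 u W (Suc k) \<tau> = uc (Suc k) \<tau>" for k by (simp add: uc_Suc u_coeff_def)
  have sum: "summable (\<lambda>n. \<mu> ^ n * uc n \<tau> t)" by (rule series_solution(6)[OF gb \<mu>])
  then show "summable (\<lambda>k. \<mu> ^ Suc k * u_coeff \<alpha> \<beta> p \<rho> \<Omega>\<^sub>0 u W (Suc k) \<tau> t)" unfolding U by (subst summable_Suc_iff)
  show "u_series \<alpha> \<beta> p \<rho> \<Omega>\<^sub>0 u W \<tau> \<mu> t = us \<mu> \<tau> t"
    unfolding u_series_def U us_def suminf_split_head[OF sum] by (simp add: uc_0)
qed

end

section \<open>Local uniqueness and the width of the locking interval\<close>

text \<open>The equation, forcing included, is odd in u at a fixed phase; a reflected solution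
  therefore keeps its phase.\<close>

lemma E_expr_uminus: "E_expr \<alpha> \<beta> S C (- u) (- du) (- ddu) l \<mu> = - E_expr \<alpha> \<beta> S C u du ddu l \<mu>"
  by (simp add: E_expr_def h_fun_def k_fun_def algebra_simps power3_eq_cube)

lemma lipschitz_of_deriv_bound:
  fixes f f' :: "real \<Rightarrow> real"
  assumes "\<And>t. (f has_real_derivative f' t) (at t)" "\<And>t. \<bar>f' t\<bar> \<le> K"
  shows "\<bar>f x - f y\<bar> \<le> K * \<bar>x - y\<bar>"
  using field_differentiable_bound[of UNIV f f' K x y] assms
  by (auto intro: has_field_derivative_at_within)

context driven
begin

lemma deriv_eq_c: "- (F t * v t + c^2 * k_fun \<alpha> \<beta> (u t)) + c * h_fun \<beta> (u t) * v t + c^2 * k_fun \<alpha> \<beta> (u t) = 0"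
  by (simp add: F_def)

text \<open>The condition v1 0 = 0 fixes the time translation, which for \<mu> = 0 would move u
  within its own orbit.\<close>

definition near_solution where
  "near_solution d \<mu> \<tau> u1 v1 a1 l1 \<longleftrightarrow>
     (\<forall>t. (u1 has_real_derivative v1 t) (at t)) \<and> (\<forall>t. (v1 has_real_derivative a1 t) (at t)) \<and>
     (\<forall>t. E_expr \<alpha> \<beta> (sin (t + \<tau>)) (cos (t + \<tau>)) (u1 t) (v1 t) (a1 t) l1 \<mu> = 0) \<and>
     (\<forall>t. u1 (t + Q) = u1 t) \<and> v1 0 = 0 \<and>
     (\<forall>t. \<bar>u1 t - u t\<bar> \<le> d) \<and> (\<forall>t. \<bar>v1 t - v t\<bar> \<le> d) \<and> \<bar>l1 - c\<bar> \<le> d"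

text \<open>The difference of two solutions solves the linear problem with the difference of their
  remainders as source. This source is at most a constant times d times the distance, so the
  solution operator contracts for small d.\<close>

lemma local_uniqueness:
  "\<exists>d>0. \<forall>\<mu> \<tau> u1 v1 a1 l1 u2 v2 a2 l2. \<bar>\<mu>\<bar> \<le> d \<longrightarrow>
     near_solution d \<mu> \<tau> u1 v1 a1 l1 \<longrightarrow> near_solution d \<mu> \<tau> u2 v2 a2 l2 \<longrightarrow> l1 = l2"
proof -
  obtain Ms where Ms: "Ms > 0" and "fl.solution_bound Ms" using fl.solution_bound_ex by blast
  note sol = this(2)[unfolded fl.solution_bound_def, rule_format]
  obtain K where K: "K \<ge> 0" "\<bar>\<alpha>\<bar> \<le> K" "\<bar>\<beta>\<bar> \<le> K" "\<bar>c\<bar> \<le> K" "\<And>x. \<bar>sin x\<bar> \<le> K" "\<And>x. \<bar>cos x\<bar> \<le> K"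
    "\<And>t. \<bar>u t\<bar> \<le> K" "\<And>t. \<bar>v t\<bar> \<le> K" by (rule coefficients_bounded) blast
  obtain M where M: "rem_estimate TYPE(real) K M" using rem_estimate_ex by blast
  \<comment> \<open>Chosen so that Ms (|M| + 1) d \<le> 1/2, the contraction factor in
    \<open>halve\<close>.\<close>
  define d where "d = min 1 (1 / (2 * Ms * (\<bar>M\<bar> + 1)))"
  have d: "0 < d" "d \<le> 1" "d \<le> 1 / (2 * Ms * (\<bar>M\<bar> + 1))" using Ms by (auto simp: d_def)
  then have "d * (2 * Ms * (\<bar>M\<bar> + 1)) \<le> 1" using Ms by (subst (asm) pos_le_divide_eq) auto
  then have MsM: "Ms * (\<bar>M\<bar> + 1) * d \<le> 1 / 2" by (simp add: mult_ac)
  show ?thesis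
  proof (rule exI[of _ d], intro conjI allI impI)
    show "d > 0" by (rule d)
    fix \<mu> \<tau> l1 l2 :: real and u1 v1 a1 u2 v2 a2 :: "real \<Rightarrow> real"
    assume \<mu>: "\<bar>\<mu>\<bar> \<le> d" and 1: "near_solution d \<mu> \<tau> u1 v1 a1 l1" and 2: "near_solution d \<mu> \<tau> u2 v2 a2 l2"
    define r where "r v' w e t = rem \<alpha> \<beta> (sin (t + \<tau>)) (cos (t + \<tau>)) (u t) (v t) c (v' t) (w t) e \<mu>"
      for v' w :: "real \<Rightarrow> real" and e t
    define \<phi> where "\<phi> t = r (\<lambda>t. u1 t - u t) (\<lambda>t. v1 t - v t) (l1 - c) t - r (\<lambda>t. u2 t - u t) (\<lambda>t. v2 t - v t) (l2 - c) t" for t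
    have eq: "a' t = - (F t * v t + c^2 * k_fun \<alpha> \<beta> (u t)) - (F t * (v' t - v t) + B t * (u' t - u t) + (l - c) * fl.chi t
        + r (\<lambda>t. u' t - u t) (\<lambda>t. v' t - v t) (l - c) t)"
      if "near_solution d \<mu> \<tau> u' v' a' l" for u' v' a' l t
    proof -
      have "0 = E_expr \<alpha> \<beta> (sin (t + \<tau>)) (cos (t + \<tau>)) (u t + (u' t - u t)) (v t + (v' t - v t))
        (- (F t * v t + c^2 * k_fun \<alpha> \<beta> (u t)) + (a' t + (F t * v t + c^2 * k_fun \<alpha> \<beta> (u t)))) (c + (l - c)) \<mu>"
        using that by (simp add: near_solution_def)
      then show ?thesis
        unfolding E_expr_split deriv_eq_c by (simp add: r_def F_def B_def chi_eq chi_def algebra_simps)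
    qed
    have cont: "continuous_on UNIV u'" "continuous_on UNIV v'" "v' (t + Q) = v' t"
      if "near_solution d \<mu> \<tau> u' v' a' l" for u' v' a' l t
      using that derivs_imp_cont[of u' v'] derivs_imp_cont[of v' a'] periodic_deriv[of u' v' Q 1]
      by (auto simp: near_solution_def)
    have cont_r: "continuous_on UNIV (r (\<lambda>t. u' t - u t) (\<lambda>t. v' t - v t) (l - c))"
      if "near_solution d \<mu> \<tau> u' v' a' l" for u' v' a' l
      unfolding r_def[abs_def] rem_def quad_rem_def drive_rem_def Let_def
      by (intro continuous_intros cont_u cont_v cont[OF that])
    have per_r: "r (\<lambda>t. u' t - u t) (\<lambda>t. v' t - v t) (l - c) (t + Q) = r (\<lambda>t. u' t - u t) (\<lambda>t. v' t - v t) (l - c) t"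
      if "near_solution d \<mu> \<tau> u' v' a' l" for u' v' a' l t
    proof -
      have "sin (t + Q + \<tau>) = sin (t + \<tau>)" "cos (t + Q + \<tau>) = cos (t + \<tau>)"
        using sin.plus_of_nat[of "t + \<tau>" p] cos.plus_of_nat[of "t + \<tau>" p] by (simp_all add: algebra_simps)
      moreover have "u' (t + Q) = u' t" using that by (simp add: near_solution_def)
      ultimately show ?thesis unfolding r_def per_q cont(3)[OF that] by simp
    qed
    have c\<phi>: "continuous_on UNIV \<phi>" unfolding \<phi>_def[abs_def]
      by (intro continuous_on_diff cont_r[OF 1] cont_r[OF 2])
    have p\<phi>: "\<phi> (t + Q) = \<phi> t" for t unfolding \<phi>_def per_r[OF 1] per_r[OF 2] ..
    define e where "e = l1 - l2"
    have lin: "fl.solves_lin \<phi> e (\<lambda>t. u1 t - u2 t) (\<lambda>t. v1 t - v2 t)"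
      unfolding fl.solves_lin_def
    proof (intro conjI allI)
      fix t
      show "((\<lambda>t. u1 t - u2 t) has_real_derivative v1 t - v2 t) (at t)"
        using 1 2 by (intro DERIV_diff) (auto simp: near_solution_def)
      have "((\<lambda>t. v1 t - v2 t) has_real_derivative a1 t - a2 t) (at t)"
        using 1 2 by (intro DERIV_diff) (auto simp: near_solution_def)
      moreover have "a1 t - a2 t = - (F t * (v1 t - v2 t) + B t * (u1 t - u2 t) + e * fl.chi t + \<phi> t)"
        unfolding eq[OF 1] eq[OF 2] by (simp add: e_def \<phi>_def algebra_simps)
      ultimately show "((\<lambda>t. v1 t - v2 t) has_real_derivative
          - (F t * (v1 t - v2 t) + B t * (u1 t - u2 t) + e * fl.chi t + \<phi> t)) (at t)" by simp
    qed (use 1 2 in \<open>auto simp: near_solution_def\<close>)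
    have halve: "(\<forall>t. \<bar>u1 t - u2 t\<bar> \<le> D / 2 \<and> \<bar>v1 t - v2 t\<bar> \<le> D / 2) \<and> \<bar>e\<bar> \<le> D / 2"
      if D: "D \<ge> 0" "\<forall>t. \<bar>u1 t - u2 t\<bar> \<le> D \<and> \<bar>v1 t - v2 t\<bar> \<le> D" "\<bar>e\<bar> \<le> D" for D
    proof -
      interpret lc: lipschitz_classes d D using d D by unfold_locales auto
      have \<phi>b: "\<bar>\<phi> t\<bar> \<le> (\<bar>M\<bar> + 1) * d * D" for t
      proof -
        have "lc.tiny M (r (\<lambda>t. u1 t - u t) (\<lambda>t. v1 t - v t) (l1 - c) t) (r (\<lambda>t. u2 t - u t) (\<lambda>t. v2 t - v t) (l2 - c) t)"
          unfolding r_def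
        proof (rule rem_estimateD[OF M lc.graded_axioms])
          have const: "lc.big K x x" if "\<bar>x\<bar> \<le> K" for x using that K(1) D by (simp add: lc.big_def)
          show "lc.big K \<alpha> \<alpha>" "lc.big K \<beta> \<beta>" "lc.big K (sin (t + \<tau>)) (sin (t + \<tau>))" "lc.big K (cos (t + \<tau>)) (cos (t + \<tau>))"
            "lc.big K (u t) (u t)" "lc.big K (v t) (v t)" "lc.big K c c" by (intro const K)+
          show "lc.small 1 (u1 t - u t) (u2 t - u t)" "lc.small 1 (v1 t - v t) (v2 t - v t)" "lc.small 1 (l1 - c) (l2 - c)"
            using 1 2 D by (auto simp: lc.small_def near_solution_def e_def)
          show "lc.tiny 1 \<mu> \<mu>" using \<mu> d D by (simp add: lc.tiny_def)
        qed
        then have "\<bar>\<phi> t\<bar> \<le> M * (d * D)" by (simp add: lc.tiny_def \<phi>_def)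
        also have "\<dots> \<le> (\<bar>M\<bar> + 1) * (d * D)" using d D by (intro mult_right_mono) auto
        finally show ?thesis by simp
      qed
      obtain w x where wx: "fl.solves_lin \<phi> (fl.eps \<phi>) w x" "\<bar>fl.eps \<phi>\<bar> \<le> Ms * ((\<bar>M\<bar> + 1) * d * D)"
        "\<And>t. \<bar>w t\<bar> \<le> Ms * ((\<bar>M\<bar> + 1) * d * D) \<and> \<bar>x t\<bar> \<le> Ms * ((\<bar>M\<bar> + 1) * d * D)"
        using sol[OF c\<phi> p\<phi> \<phi>b] by blast
      have e: "e = fl.eps \<phi>" by (rule fl.solves_lin_eps[OF c\<phi> lin])
      have un: "u1 t - u2 t = w t \<and> v1 t - v2 t = x t" for t
        using fl.solves_lin_unique[OF lin[unfolded e] wx(1)] .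
      have "Ms * ((\<bar>M\<bar> + 1) * d * D) = (Ms * (\<bar>M\<bar> + 1) * d) * D" by simp
      also have "\<dots> \<le> 1 / 2 * D" by (intro mult_right_mono MsM D)
      finally have "Ms * ((\<bar>M\<bar> + 1) * d * D) \<le> D / 2" by simp
      then show ?thesis unfolding un[THEN conjunct1] un[THEN conjunct2] using wx(2,3) e
        by (meson order_trans)
    qed
    \<comment> \<open>The start 2 d is the triangle inequality through u, v and c; each application
      of \<open>halve\<close> gains a factor 1/2.\<close>
    have it: "(\<forall>t. \<bar>u1 t - u2 t\<bar> \<le> 2 * d / 2 ^ n \<and> \<bar>v1 t - v2 t\<bar> \<le> 2 * d / 2 ^ n) \<and> \<bar>e\<bar> \<le> 2 * d / 2 ^ n" for n :: nat
    proof (induction n)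
      case 0
      have b: "\<bar>u1 t - u t\<bar> \<le> d" "\<bar>u2 t - u t\<bar> \<le> d" "\<bar>v1 t - v t\<bar> \<le> d" "\<bar>v2 t - v t\<bar> \<le> d" for t
        using 1 2 by (auto simp: near_solution_def)
      have "\<bar>u1 t - u2 t\<bar> \<le> 2 * d" "\<bar>v1 t - v2 t\<bar> \<le> 2 * d" for t
        using b[of t] by linarith+
      moreover have "\<bar>l1 - c\<bar> \<le> d" "\<bar>l2 - c\<bar> \<le> d" using 1 2 by (auto simp: near_solution_def)
      then have "\<bar>l1 - l2\<bar> \<le> 2 * d" by linarith
      ultimately show ?case by (simp add: e_def)
    next
      case (Suc n)
      then show ?case using halve[of "2 * d / 2 ^ n"] d by simp
    qed
    have "(\<lambda>n. 2 * d / 2 ^ n) \<longlonglongrightarrow> 0"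
      using LIMSEQ_divide_realpow_zero[of 2 "2 * d"] by simp
    then have "\<bar>e\<bar> \<le> 0" by (rule LIMSEQ_le_const) (use it in blast)
    then show "l1 = l2" by (simp add: e_def)
  qed
qed

text \<open>The solution shifted by \<sigma> has velocity only O(\<mu>) at time 0. As v crosses 0
  there with slope a0 < 0, a further shift \<delta> makes it vanish, and
  \<open>local_uniqueness\<close> at phase \<tau> + \<sigma> + \<delta> equates the two
  parameters.\<close>

lemma phase_shift:
  assumes gb: "geometric_bound R" and sg: "sg = 1 \<or> sg = -1" and sym: "\<And>t. u (t + \<sigma>) = sg * u t"
  shows "\<exists>C>0. \<exists>\<mu>1>0. \<forall>\<mu> \<tau>. \<bar>\<mu>\<bar> \<le> \<mu>1 \<longrightarrow> (\<exists>\<delta>. \<bar>\<delta>\<bar> \<le> C * \<bar>\<mu>\<bar> \<and> ls \<mu> (\<tau> + \<sigma> + \<delta>) = ls \<mu> \<tau>)"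
proof -
  have R: "R > 0" using gb by (simp add: geometric_bound_def)
  have symv: "v (t + \<sigma>) = sg * v t" for t by (rule periodic_deriv[OF du sym])
  have sg2: "sg * sg = 1" using sg by auto
  define A where "A t = - (F t * v t + c^2 * k_fun \<alpha> \<beta> (u t))" for t
  have A0: "A 0 = a0" by (simp add: A_def v0 a0_def)
  have contA: "continuous_on UNIV A"
    unfolding A_def[abs_def] k_fun_def by (intro continuous_intros cont_F cont_v cont_u)
  obtain Ka where Ka: "Ka > 0" "\<And>t. \<bar>A t\<bar> \<le> Ka"
    using periodic_bounded[of A P] P contA by (auto simp: A_def per per_v per_F)
  obtain K0 where K0: "K0 > 0" "\<And>t. \<bar>u t\<bar> \<le> K0" "\<And>t. \<bar>v t\<bar> \<le> K0" using bounded_uv by blast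
  have "isCont A 0" using contA by (simp add: continuous_on_eq_continuous_at)
  then have "\<exists>r'>0. \<forall>x. dist x 0 < r' \<longrightarrow> dist (A x) (A 0) < - a0 / 2"
    using a0 unfolding continuous_at_eps_delta by (metis divide_pos_pos neg_0_less_iff_less zero_less_numeral)
  then obtain r' where r': "r' > 0" "\<And>x. \<bar>x\<bar> < r' \<Longrightarrow> \<bar>A x - a0\<bar> < - a0 / 2"
    unfolding A0 dist_real_def by auto
  define r where "r = r' / 2"
  have r: "r > 0" using r' by (simp add: r_def)
  have Ar: "A x \<le> a0 / 2" if "\<bar>x\<bar> \<le> r" for x
  proof -
    have "\<bar>x\<bar> < r'" using that r'(1) by (simp add: r_def)
    from r'(2)[OF this] show "A x \<le> a0 / 2" by linarith
  qed
  \<comment> \<open>On [-r, r] the acceleration is at most a0/2, so v lies below the line of slope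
    a0/2 to the right of 0 and above it to the left.\<close>
  have slope: "v y \<le> a0 / 2 * y" "v (- y) \<ge> - (a0 / 2 * y)" if y: "0 \<le> y" "y \<le> r" for y
  proof -
    define g where "g t = v t - a0 / 2 * t" for t
    have dg: "(g has_real_derivative A t - a0 / 2) (at t)" for t
      unfolding g_def A_def by (rule derivative_eq_intros dv refl)+ simp
    have "g y \<le> g 0" using y Ar by (intro DERIV_nonpos_imp_nonincreasing[of 0 y g]) (auto intro!: exI dg)
    moreover have "g 0 \<le> g (- y)" using y Ar by (intro DERIV_nonpos_imp_nonincreasing[of "- y" 0 g]) (auto intro!: exI dg)
    ultimately show "v y \<le> a0 / 2 * y" "v (- y) \<ge> - (a0 / 2 * y)" by (simp_all add: g_def v0)
  qed
  \<comment> \<open>At distance C |\<mu>| from 0 that line has height 2 R |\<mu>|, the error bound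
    of the velocity series, so the perturbed velocity has opposite weak signs at the two
    ends.\<close>
  define C where "C = 4 * R / (- a0)"
  have C: "C > 0" "a0 / 2 * C = - 2 * R" using R a0 by (auto simp: C_def field_simps)
  obtain d where d: "d > 0" and uniq: "\<And>\<mu> \<tau> u1 v1 a1 l1 u2 v2 a2 l2. \<bar>\<mu>\<bar> \<le> d \<Longrightarrow>
     near_solution d \<mu> \<tau> u1 v1 a1 l1 \<Longrightarrow> near_solution d \<mu> \<tau> u2 v2 a2 l2 \<Longrightarrow> l1 = l2"
    using local_uniqueness by blast
  \<comment> \<open>H |\<mu>| dominates the series error 2 R |\<mu>| plus the displacement of u or v
    under \<delta>, with Lipschitz constants K0 and Ka; the summand 1 covers |\<mu>| itself.\<close>
  define H where "H = 2 * R + max K0 Ka * C + 1"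
  have H: "H > 0" "2 * R + K0 * C \<le> H" "2 * R + Ka * C \<le> H" "2 * R \<le> H" "1 \<le> H"
  proof -
    have "K0 * C \<le> max K0 Ka * C" "Ka * C \<le> max K0 Ka * C" "0 \<le> max K0 Ka * C"
      using C K0 Ka by (auto intro!: mult_right_mono mult_nonneg_nonneg simp: le_max_iff_disj)
    then show "H > 0" "2 * R + K0 * C \<le> H" "2 * R + Ka * C \<le> H" "2 * R \<le> H" "1 \<le> H"
      using R unfolding H_def by linarith+
  qed
  define \<mu>1 where "\<mu>1 = min (d / H) (min (r / C) (1 / (2 * R)))"
  have \<mu>1: "\<mu>1 > 0" using d H r C R by (simp add: \<mu>1_def)
  show ?thesis
  proof (rule exI[of _ C], rule conjI[OF C(1)], rule exI[of _ \<mu>1], rule conjI[OF \<mu>1], intro allI impI)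
    fix \<mu> \<tau> assume \<mu>: "\<bar>\<mu>\<bar> \<le> \<mu>1"
    have m: "H * \<bar>\<mu>\<bar> \<le> d" "C * \<bar>\<mu>\<bar> \<le> r" "\<bar>\<mu>\<bar> * R \<le> 1 / 2"
      using \<mu> H C R by (auto simp: \<mu>1_def field_simps)
    have near: "x * \<bar>\<mu>\<bar> \<le> d" if "x \<le> H" for x using mult_right_mono[OF that, of "\<bar>\<mu>\<bar>"] m by simp
    note S = series_solution[OF gb m(3)]
    define y where "y = C * \<bar>\<mu>\<bar>"
    have y: "0 \<le> y" "y \<le> r" using C m by (auto simp: y_def)
    have ay: "a0 / 2 * y = - (2 * R * \<bar>\<mu>\<bar>)" using C(2) by (simp add: y_def flip: mult.assoc)
    have bd: "\<bar>sg * vs \<mu> \<tau> (t + \<sigma>) - v t\<bar> \<le> 2 * R * \<bar>\<mu>\<bar>" for t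
    proof -
      have "sg * vs \<mu> \<tau> (t + \<sigma>) - v t = sg * (vs \<mu> \<tau> (t + \<sigma>) - v (t + \<sigma>))"
        unfolding symv using sg by (auto simp: algebra_simps)
      then show ?thesis using S(9)[of \<tau> "t + \<sigma>"] sg by (auto simp: abs_mult)
    qed
    have cv: "continuous_on {- y..y} (\<lambda>t. sg * vs \<mu> \<tau> (t + \<sigma>))"
      by (intro continuous_intros continuous_on_compose2[OF derivs_imp_cont[OF S(2)]]) auto
    have "sg * vs \<mu> \<tau> (y + \<sigma>) \<le> 0" using bd[of y] slope(1)[OF y] ay by linarith
    moreover have "0 \<le> sg * vs \<mu> \<tau> (- y + \<sigma>)" using bd[of "- y"] slope(2)[OF y] ay by linarith
    ultimately obtain \<delta> where \<delta>: "- y \<le> \<delta>" "\<delta> \<le> y" "sg * vs \<mu> \<tau> (\<delta> + \<sigma>) = 0"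
      using IVT2'[of "\<lambda>t. sg * vs \<mu> \<tau> (t + \<sigma>)" y 0 "- y"] y cv by auto
    have dl: "\<bar>\<delta>\<bar> \<le> C * \<bar>\<mu>\<bar>" using \<delta> by (simp add: y_def abs_le_iff)
    define h where "h = \<sigma> + \<delta>"
    have n2: "near_solution d \<mu> (\<tau> + h) (us \<mu> (\<tau> + h)) (vs \<mu> (\<tau> + h)) (acs \<mu> (\<tau> + h)) (ls \<mu> (\<tau> + h))"
      unfolding near_solution_def using S near[OF H(4)] by (meson order_trans)
    have shift_close: "\<bar>sg * x' - f t\<bar> \<le> d"
      if x': "\<bar>x' - f (t + h)\<bar> \<le> 2 * R * \<bar>\<mu>\<bar>" and f: "\<And>t. f (t + \<sigma>) = sg * f t"
        and lip: "\<bar>f (t + \<delta>) - f t\<bar> \<le> Kf * \<bar>t + \<delta> - t\<bar>" and Kf: "Kf \<ge> 0" "2 * R + Kf * C \<le> H" for x' f t Kf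
    proof -
      have "f (t + h) = sg * f (t + \<delta>)" using f[of "t + \<delta>"] by (simp add: h_def add_ac)
      then have "sg * x' - f t = sg * (x' - f (t + h)) + (f (t + \<delta>) - f t)" using sg by (auto simp: algebra_simps)
      moreover have "\<bar>sg * (x' - f (t + h))\<bar> = \<bar>x' - f (t + h)\<bar>" using sg by (auto simp: abs_mult)
      moreover have "Kf * \<bar>t + \<delta> - t\<bar> \<le> Kf * (C * \<bar>\<mu>\<bar>)" using dl Kf by (intro mult_left_mono) auto
      ultimately have "\<bar>sg * x' - f t\<bar> \<le> 2 * R * \<bar>\<mu>\<bar> + Kf * (C * \<bar>\<mu>\<bar>)"
        using x' lip abs_triangle_ineq[of "sg * (x' - f (t + h))" "f (t + \<delta>) - f t"] by linarith
      also have "\<dots> = (2 * R + Kf * C) * \<bar>\<mu>\<bar>" by (simp add: distrib_right)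
      finally have "\<bar>sg * x' - f t\<bar> \<le> (2 * R + Kf * C) * \<bar>\<mu>\<bar>" .
      then show ?thesis using near[OF Kf(2)] by linarith
    qed
    have n1: "near_solution d \<mu> (\<tau> + h) (\<lambda>t. sg * us \<mu> \<tau> (t + h)) (\<lambda>t. sg * vs \<mu> \<tau> (t + h)) (\<lambda>t. sg * acs \<mu> \<tau> (t + h)) (ls \<mu> \<tau>)"
      unfolding near_solution_def
    proof (intro conjI allI)
      fix t
      show "((\<lambda>t. sg * us \<mu> \<tau> (t + h)) has_real_derivative sg * vs \<mu> \<tau> (t + h)) (at t)"
        by (rule DERIV_cmult) (use S(1)[of \<tau> "t + h"] in \<open>simp add: DERIV_shift\<close>)
      show "((\<lambda>t. sg * vs \<mu> \<tau> (t + h)) has_real_derivative sg * acs \<mu> \<tau> (t + h)) (at t)"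
        by (rule DERIV_cmult) (use S(2)[of \<tau> "t + h"] in \<open>simp add: DERIV_shift\<close>)
      have e: "E_expr \<alpha> \<beta> (sin (t + (\<tau> + h))) (cos (t + (\<tau> + h))) (us \<mu> \<tau> (t + h)) (vs \<mu> \<tau> (t + h)) (acs \<mu> \<tau> (t + h)) (ls \<mu> \<tau>) \<mu> = 0"
        using S(3)[of "t + h" \<tau>] by (simp only: add_ac)
      show "E_expr \<alpha> \<beta> (sin (t + (\<tau> + h))) (cos (t + (\<tau> + h))) (sg * us \<mu> \<tau> (t + h)) (sg * vs \<mu> \<tau> (t + h)) (sg * acs \<mu> \<tau> (t + h)) (ls \<mu> \<tau>) \<mu> = 0"
        using sg
      proof
        assume "sg = - 1" then show ?thesis using e by (simp only: mult_minus1 E_expr_uminus minus_zero)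
      next
        assume "sg = 1" then show ?thesis using e by (simp only: mult_1)
      qed
      show "sg * us \<mu> \<tau> (t + Q + h) = sg * us \<mu> \<tau> (t + h)"
        using S(4)[of \<tau> "t + h"] by (simp add: add_ac)
      show "\<bar>sg * us \<mu> \<tau> (t + h) - u t\<bar> \<le> d"
        by (rule shift_close[OF S(8) sym lipschitz_of_deriv_bound[OF du K0(3)] less_imp_le[OF K0(1)] H(2)])
      show "\<bar>sg * vs \<mu> \<tau> (t + h) - v t\<bar> \<le> d"
        by (rule shift_close[OF S(9) symv lipschitz_of_deriv_bound[OF dv[folded A_def] Ka(2)] less_imp_le[OF Ka(1)] H(3)])
      show "\<bar>ls \<mu> \<tau> - c\<bar> \<le> d" using S(10)[of \<tau>] near[OF H(4)] by linarith
      show "sg * vs \<mu> \<tau> (0 + h) = 0" using \<delta>(3) by (simp add: h_def add_ac)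
    qed
    have "\<bar>\<mu>\<bar> \<le> d" using near[OF H(5)] by simp
    from uniq[OF this n1 n2] have "ls \<mu> \<tau> = ls \<mu> (\<tau> + h)" .
    then show "\<exists>\<delta>. \<bar>\<delta>\<bar> \<le> C * \<bar>\<mu>\<bar> \<and> ls \<mu> (\<tau> + \<sigma> + \<delta>) = ls \<mu> \<tau>"
      using dl by (intro exI[of _ \<delta>]) (simp add: h_def add_ac)
  qed
qed

lemma coefficients_constant:
  fixes N :: nat and pz :: int
  assumes cop: "coprime pz (int N)" and sg: "sg = 1 \<or> sg = -1"
    and sym: "\<And>t. u (t + 2 * pi * pz / N) = sg * u t"
  shows "0 < m \<Longrightarrow> m < N \<Longrightarrow> ec m \<tau> = ec m 0"
proof (induction m arbitrary: \<tau> rule: less_induct)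
  case (less m)
  define \<sigma> where "\<sigma> = 2 * pi * pz / N"
  obtain R where gb: "geometric_bound R" using geometric_bound_ex by blast
  have R: "R > 0" using gb by (simp add: geometric_bound_def)
  obtain C \<mu>1 where C: "C > 0" "\<mu>1 > 0" and sh: "\<And>\<mu> \<tau>. \<bar>\<mu>\<bar> \<le> \<mu>1 \<Longrightarrow> \<exists>\<delta>. \<bar>\<delta>\<bar> \<le> C * \<bar>\<mu>\<bar> \<and> ls \<mu> (\<tau> + \<sigma> + \<delta>) = ls \<mu> \<tau>"
    using phase_shift[OF gb sg sym, folded \<sigma>_def] by blast
  have cont: "continuous_on UNIV (\<lambda>\<tau>. ec m \<tau>)"
    using tp_continuous_phase[of Q m "\<lambda>\<tau> t. ec m \<tau>"] coefficients[of m] by blast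
  have inv: "ec m (\<tau> + \<sigma>) = ec m \<tau>" for \<tau>
  proof -
    define \<mu>2 where "\<mu>2 = min \<mu>1 (1 / (2 * R))"
    have \<mu>2: "\<mu>2 > 0" using C R by (simp add: \<mu>2_def)
    \<comment> \<open>The shift is known only as some number for each parameter value, so the limit
      is taken along a sequence with selected shifts \<delta> n.\<close>
    define \<mu> where "\<mu> n = \<mu>2 / real (Suc n)" for n
    have \<mu>n: "0 < \<mu> n" "\<mu> n \<le> \<mu>2" for n using \<mu>2 by (auto simp: \<mu>_def field_simps)
    have lim\<mu>: "\<mu> \<longlonglongrightarrow> 0" unfolding \<mu>_def by (rule LIMSEQ_Suc[OF lim_const_over_n])
    have "\<exists>\<delta>. \<bar>\<delta>\<bar> \<le> C * \<bar>\<mu> n\<bar> \<and> ls (\<mu> n) (\<tau> + \<sigma> + \<delta>) = ls (\<mu> n) \<tau>" for n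
      using \<mu>n[of n] by (intro sh) (auto simp: \<mu>2_def)
    then obtain \<delta> where \<delta>: "\<And>n. \<bar>\<delta> n\<bar> \<le> C * \<bar>\<mu> n\<bar>" "\<And>n. ls (\<mu> n) (\<tau> + \<sigma> + \<delta> n) = ls (\<mu> n) \<tau>" by metis
    have bound: "\<bar>ec m (\<tau> + \<sigma> + \<delta> n) - ec m \<tau>\<bar> \<le> 4 * R ^ Suc m * \<mu> n" for n
    proof -
      have mR: "\<bar>\<mu> n\<bar> * R \<le> 1 / 2" using \<mu>n[of n] R by (auto simp: \<mu>2_def field_simps)
      have tail: "\<bar>ls (\<mu> n) \<tau>' - (\<Sum>i<Suc m. \<mu> n ^ i * ec i \<tau>')\<bar> \<le> 2 * 1 * R ^ Suc m * \<bar>\<mu> n\<bar> ^ Suc m" for \<tau>'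
        unfolding ls_def by (rule suminf_tail_bound(2)[OF _ R _ mR]) (use gb in \<open>auto simp: geometric_bound_def\<close>)
      have "(\<Sum>i<m. \<mu> n ^ i * ec i (\<tau> + \<sigma> + \<delta> n)) = (\<Sum>i<m. \<mu> n ^ i * ec i \<tau>)"
      proof (rule sum.cong)
        fix i assume "i \<in> {..<m}"
        then have "ec i x = ec i 0" for x using less.IH[of i] less.prems by (cases "i = 0") (auto simp: ec_0)
        then show "\<mu> n ^ i * ec i (\<tau> + \<sigma> + \<delta> n) = \<mu> n ^ i * ec i \<tau>" by metis
      qed simp
      \<comment> \<open>Terms below m cancel and both tails are of order m + 1, so after division by
        \<mu>^m the two values of the m-th coefficient differ by O(\<mu>).\<close>
      then have "\<bar>\<mu> n ^ m * (ec m (\<tau> + \<sigma> + \<delta> n) - ec m \<tau>)\<bar> \<le> 4 * R ^ Suc m * \<bar>\<mu> n\<bar> ^ Suc m"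
        using tail[of "\<tau> + \<sigma> + \<delta> n"] tail[of \<tau>] \<delta>(2)[of n] by (simp add: right_diff_distrib abs_le_iff)
      then have "\<mu> n ^ m * \<bar>ec m (\<tau> + \<sigma> + \<delta> n) - ec m \<tau>\<bar> \<le> \<mu> n ^ m * (4 * R ^ Suc m * \<mu> n)"
        using \<mu>n(1)[of n] by (simp add: abs_mult mult_ac)
      then show ?thesis using \<mu>n(1)[of n] by (simp only: mult_le_cancel_left_pos zero_less_power)
    qed
    have "\<delta> \<longlonglongrightarrow> 0"
    proof (rule Lim_null_comparison)
      show "\<forall>\<^sub>F n in sequentially. norm (\<delta> n) \<le> C * \<mu> n"
      proof (intro always_eventually allI)
        fix n show "norm (\<delta> n) \<le> C * \<mu> n" using \<delta>(1)[of n] \<mu>n(1)[of n] by simp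
      qed
      show "(\<lambda>n. C * \<mu> n) \<longlonglongrightarrow> 0" using tendsto_mult_left[OF lim\<mu>, of C] by simp
    qed
    then have lim: "(\<lambda>n. \<tau> + \<sigma> + \<delta> n) \<longlonglongrightarrow> \<tau> + \<sigma>" using tendsto_add[OF tendsto_const, of \<delta> 0 sequentially "\<tau> + \<sigma>"] by simp
    have "(\<lambda>n. ec m (\<tau> + \<sigma> + \<delta> n)) \<longlonglongrightarrow> ec m (\<tau> + \<sigma>)"
      by (rule continuous_on_tendsto_compose[OF cont lim]) auto
    moreover have "(\<lambda>n. ec m (\<tau> + \<sigma> + \<delta> n) - ec m \<tau>) \<longlonglongrightarrow> 0"
    proof (rule Lim_null_comparison)
      show "\<forall>\<^sub>F n in sequentially. norm (ec m (\<tau> + \<sigma> + \<delta> n) - ec m \<tau>) \<le> 4 * R ^ Suc m * \<mu> n"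
        using bound by auto
      show "(\<lambda>n. 4 * R ^ Suc m * \<mu> n) \<longlonglongrightarrow> 0" using tendsto_mult_left[OF lim\<mu>, of "4 * R ^ Suc m"] by simp
    qed
    then have "(\<lambda>n. ec m (\<tau> + \<sigma> + \<delta> n)) \<longlonglongrightarrow> ec m \<tau>" by (simp add: LIM_zero_iff)
    ultimately show ?thesis by (rule LIMSEQ_unique)
  qed
  show ?case
  proof (rule tp_constant[where f="\<lambda>\<tau> t. ec m \<tau>"])
    show "tp Q m (\<lambda>\<tau> t. ec m \<tau>)" using coefficients[of m] by blast
    show "ec m (\<tau> + 2 * pi * real_of_int pz / real N) = ec m \<tau>" for \<tau> by (rule inv[unfolded \<sigma>_def])
  qed (use less.prems cop in auto)
qed

text \<open>Coefficients below order N are constant in the phase, so only the two tails can differ,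
  each at most 2 R^N |\<mu>|^N.\<close>

lemma width_bound:
  fixes N :: nat and pz :: int
  assumes cop: "coprime pz (int N)" and sg: "sg = 1 \<or> sg = -1"
    and sym: "\<And>t. u (t + 2 * pi * pz / N) = sg * u t" and N: "N > 0"
    and gb: "geometric_bound R" and \<mu>: "\<bar>\<mu>\<bar> * R \<le> 1 / 2"
  shows "\<bar>ls \<mu> \<tau> - ls \<mu> \<tau>'\<bar> \<le> 4 * R ^ N * \<bar>\<mu>\<bar> ^ N"
proof -
  have R: "R > 0" using gb by (simp add: geometric_bound_def)
  have tail: "\<bar>ls \<mu> x - (\<Sum>i<N. \<mu> ^ i * ec i x)\<bar> \<le> 2 * 1 * R ^ N * \<bar>\<mu>\<bar> ^ N" for x
    unfolding ls_def by (rule suminf_tail_bound(2)[OF _ R _ \<mu>]) (use gb N in \<open>auto simp: geometric_bound_def\<close>)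
  have "(\<Sum>i<N. \<mu> ^ i * ec i x) = (\<Sum>i<N. \<mu> ^ i * ec i 0)" for x
  proof (rule sum.cong)
    fix i assume "i \<in> {..<N}"
    then show "\<mu> ^ i * ec i x = \<mu> ^ i * ec i 0"
      using coefficients_constant[OF cop sg sym, of i x] by (cases "i = 0") (auto simp: ec_0)
  qed simp
  note eq = this
  show ?thesis using tail[of \<tau>] tail[of \<tau>'] unfolding eq[of \<tau>] eq[of \<tau>'] by linarith
qed

end

section \<open>The locking interval\<close>

context driven
begin

lemma us_solves_driven:
  assumes gb: "geometric_bound R" and \<mu>: "\<bar>\<mu>\<bar> * R \<le> 1 / 2" and \<omega>: "1 / \<omega> = ls \<mu> \<tau>"
  shows "solves_driven \<alpha> \<beta> \<tau> \<omega> \<mu> (us \<mu> \<tau>)"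
proof -
  note S = series_solution[OF gb \<mu>]
  have d: "deriv (us \<mu> \<tau>) = vs \<mu> \<tau>" "deriv (vs \<mu> \<tau>) = acs \<mu> \<tau>"
    using S(1,2) DERIV_imp_deriv by blast+
  show ?thesis
    unfolding solves_driven_def solves_ode2_def d \<omega> real_differentiable_def
    using S(1-3) by blast
qed

text \<open>The last two terms keep the perturbed solution positive at 0 and negative somewhere, hence not constant.\<close>

definition \<mu>_bound where
  "\<mu>_bound R = min (1 / (2 * R)) (min (c / (4 * R)) (min (u 0 / (2 * R)) (SOME y. y > 0 \<and> (\<exists>t. u t < 0 \<and> 2 * R * y \<le> - u t))))"

lemma \<mu>_bound_pos:
  assumes gb: "geometric_bound R"
  shows "\<mu>_bound R > 0"
    and "\<bar>\<mu>\<bar> < \<mu>_bound R \<Longrightarrow> \<bar>\<mu>\<bar> * R \<le> 1 / 2"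
    and "\<bar>\<mu>\<bar> < \<mu>_bound R \<Longrightarrow> c / 2 \<le> ls \<mu> \<tau>"
    and "\<bar>\<mu>\<bar> < \<mu>_bound R \<Longrightarrow> \<not> us \<mu> \<tau> constant_on UNIV"
proof -
  define y where "y = (SOME y. y > 0 \<and> (\<exists>t. u t < 0 \<and> 2 * R * y \<le> - u t))"
  have R: "R > 0" using gb by (simp add: geometric_bound_def)
  obtain b where b: "u b < 0" using descending_branch[OF v0 u0] by blast
  have "\<exists>y. y > 0 \<and> (\<exists>t. u t < 0 \<and> 2 * R * y \<le> - u t)"
    by (rule exI[of _ "- u b / (2 * R)"]) (use b R in \<open>auto simp: field_simps intro!: exI[of _ b]\<close>)
  then have y: "y > 0 \<and> (\<exists>t. u t < 0 \<and> 2 * R * y \<le> - u t)" unfolding y_def by (rule someI_ex)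
  then obtain t where t: "u t < 0" "2 * R * y \<le> - u t" by blast
  have eq: "\<mu>_bound R = min (1 / (2 * R)) (min (c / (4 * R)) (min (u 0 / (2 * R)) y))"
    by (simp add: \<mu>_bound_def y_def)
  show "\<mu>_bound R > 0" using R c u0 y by (simp add: eq)
  assume \<mu>: "\<bar>\<mu>\<bar> < \<mu>_bound R"
  \<comment> \<open>In turn: convergence, the lower bound c/2 for 1/omega, and positivity of the
    perturbed solution at 0.\<close>
  have m: "\<bar>\<mu>\<bar> * R \<le> 1 / 2" "2 * R * \<bar>\<mu>\<bar> \<le> c / 2" "2 * R * \<bar>\<mu>\<bar> < u 0"
    using \<mu> R by (auto simp: eq field_simps)
  show "\<bar>\<mu>\<bar> * R \<le> 1 / 2" by (rule m)
  note S = series_solution[OF gb m(1)]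
  show "c / 2 \<le> ls \<mu> \<tau>" using S(10)[of \<tau>] m(2) by linarith
  have "2 * R * \<bar>\<mu>\<bar> < 2 * R * y" using \<mu> R by (simp add: eq)
  then have "us \<mu> \<tau> t < 0" using S(8)[of \<tau> t] t by linarith
  moreover have "us \<mu> \<tau> 0 > 0" using S(8)[of \<tau> 0] m(3) by linarith
  ultimately show "\<not> us \<mu> \<tau> constant_on UNIV" by (auto simp: constant_on_def) (metis less_asym)
qed

context
  fixes R \<mu> :: real
  assumes gb: "geometric_bound R" and \<mu>: "\<bar>\<mu>\<bar> < \<mu>_bound R"
begin

abbreviation (input) D where "D \<tau> \<equiv> D_series \<alpha> \<beta> p \<rho> \<Omega>\<^sub>0 u W \<tau> \<mu>"

lemma \<mu>R: "\<bar>\<mu>\<bar> * R \<le> 1 / 2" by (rule \<mu>_bound_pos(2)[OF gb \<mu>])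

lemma D_eq: "D \<tau> = ls \<mu> \<tau> - c" by (rule D_series_eq(2)[OF gb \<mu>R])

lemma D_extrema:
  obtains a b where "a \<in> {0..2 * pi}" "b \<in> {0..2 * pi}" "\<And>t. t \<in> {0..2 * pi} \<Longrightarrow> D a \<le> D t"
    "\<And>t. t \<in> {0..2 * pi} \<Longrightarrow> D t \<le> D b"
proof -
  have cont: "continuous_on {0..2 * pi} (ls \<mu>)"
    using series_solution(11)[OF gb \<mu>R] by (rule continuous_on_subset) simp
  have "\<exists>b\<in>{0..2 * pi}. \<forall>t\<in>{0..2 * pi}. ls \<mu> t \<le> ls \<mu> b"
    by (rule continuous_attains_sup[OF _ _ cont]) auto
  moreover have "\<exists>a\<in>{0..2 * pi}. \<forall>t\<in>{0..2 * pi}. ls \<mu> a \<le> ls \<mu> t"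
    by (rule continuous_attains_inf[OF _ _ cont]) auto
  ultimately show ?thesis using that unfolding D_eq by auto
qed

lemma omega_bounds:
  assumes "a \<in> {0..2 * pi}" "b \<in> {0..2 * pi}" "\<And>t. t \<in> {0..2 * pi} \<Longrightarrow> D a \<le> D t"
    "\<And>t. t \<in> {0..2 * pi} \<Longrightarrow> D t \<le> D b"
  shows "omega_min \<alpha> \<beta> p \<rho> \<Omega>\<^sub>0 u W \<mu> = 1 / ls \<mu> b" and "omega_max \<alpha> \<beta> p \<rho> \<Omega>\<^sub>0 u W \<mu> = 1 / ls \<mu> a"
proof -
  have "eps_max \<alpha> \<beta> p \<rho> \<Omega>\<^sub>0 u W \<mu> = D b" unfolding eps_max_def
    by (rule Greatest_equality) (use assms in auto)
  moreover have "eps_min \<alpha> \<beta> p \<rho> \<Omega>\<^sub>0 u W \<mu> = D a" unfolding eps_min_def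
    by (rule Least_equality) (use assms in auto)
  moreover have "\<rho> * \<Omega>\<^sub>0 = 1 / c" by (simp add: c_eq)
  moreover have "1 / c / (1 + 1 / c * (y - c)) = 1 / y" for y using c by (simp add: field_simps)
  ultimately show "omega_min \<alpha> \<beta> p \<rho> \<Omega>\<^sub>0 u W \<mu> = 1 / ls \<mu> b" "omega_max \<alpha> \<beta> p \<rho> \<Omega>\<^sub>0 u W \<mu> = 1 / ls \<mu> a"
    by (simp_all only: omega_min_def omega_max_def D_eq)
qed

text \<open>Both end frequencies are reciprocals of values of \<open>ls\<close>, so 1/omega lies
  between two values of a continuous function on [0, 2 pi], and the intermediate value theorem
  supplies the phase.\<close>

lemma locked_solution:
  assumes \<omega>: "omega_min \<alpha> \<beta> p \<rho> \<Omega>\<^sub>0 u W \<mu> \<le> \<omega>" "\<omega> \<le> omega_max \<alpha> \<beta> p \<rho> \<Omega>\<^sub>0 u W \<mu>"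
  shows "\<exists>\<tau>\<^sub>0\<in>{0..2 * pi}. \<exists>u. solves_driven \<alpha> \<beta> \<tau>\<^sub>0 \<omega> \<mu> u \<and> periodic_fun_simple u Q \<and> \<not> u constant_on UNIV"
proof -
  obtain a b where ab: "a \<in> {0..2 * pi}" "b \<in> {0..2 * pi}" "\<And>t. t \<in> {0..2 * pi} \<Longrightarrow> D a \<le> D t"
    "\<And>t. t \<in> {0..2 * pi} \<Longrightarrow> D t \<le> D b" by (rule D_extrema) blast
  have pos: "ls \<mu> x > 0" for x using \<mu>_bound_pos(3)[OF gb \<mu>, of x] c by linarith
  have \<omega>': "1 / ls \<mu> b \<le> \<omega>" "\<omega> \<le> 1 / ls \<mu> a" using \<omega> omega_bounds[OF ab] by auto
  have "\<omega> > 0" using \<omega>'(1) pos[of b] by (meson divide_pos_pos less_le_trans zero_less_one)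
  then have mem: "1 / \<omega> \<in> {ls \<mu> a..ls \<mu> b}"
    using \<omega>' pos[of a] pos[of b] by (auto simp: field_simps)
  have "connected (ls \<mu> ` {0..2 * pi})"
    using series_solution(11)[OF gb \<mu>R] by (intro connected_continuous_image) (auto intro: continuous_on_subset)
  then have "{ls \<mu> a..ls \<mu> b} \<subseteq> ls \<mu> ` {0..2 * pi}"
    using ab(1,2) by (intro connected_contains_Icc) auto
  then obtain \<tau> where \<tau>: "\<tau> \<in> {0..2 * pi}" "1 / \<omega> = ls \<mu> \<tau>" using mem by auto
  show ?thesis
    using \<tau>(1) us_solves_driven[OF gb \<mu>R \<tau>(2)] series_solution(4)[OF gb \<mu>R] \<mu>_bound_pos(4)[OF gb \<mu>]
    unfolding periodic_fun_simple_iff by blast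
qed

text \<open>The difference of the reciprocals is the width in \<open>ls\<close> divided by a product
  that is at least (c/2)^2, whence 4 becomes 16/c^2.\<close>

lemma locking_width:
  fixes N :: nat and pz :: int
  assumes cop: "coprime pz (int N)" and sg: "sg = 1 \<or> sg = -1"
    and sym: "\<And>t. u (t + 2 * pi * pz / N) = sg * u t" and N: "N > 0"
  shows "\<bar>omega_max \<alpha> \<beta> p \<rho> \<Omega>\<^sub>0 u W \<mu> - omega_min \<alpha> \<beta> p \<rho> \<Omega>\<^sub>0 u W \<mu>\<bar> \<le> 16 * R ^ N / c^2 * \<bar>\<mu> ^ N\<bar>"
proof -
  obtain a b where ab: "a \<in> {0..2 * pi}" "b \<in> {0..2 * pi}" "\<And>t. t \<in> {0..2 * pi} \<Longrightarrow> D a \<le> D t"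
    "\<And>t. t \<in> {0..2 * pi} \<Longrightarrow> D t \<le> D b" by (rule D_extrema) blast
  have ge: "ls \<mu> x \<ge> c / 2" for x by (rule \<mu>_bound_pos(3)[OF gb \<mu>])
  have pos: "ls \<mu> x > 0" for x using ge[of x] c by linarith
  have "1 / ls \<mu> a - 1 / ls \<mu> b = (ls \<mu> b - ls \<mu> a) / (ls \<mu> a * ls \<mu> b)"
    using pos[of a] pos[of b] by (simp add: field_simps)
  then have "\<bar>1 / ls \<mu> a - 1 / ls \<mu> b\<bar> = \<bar>ls \<mu> b - ls \<mu> a\<bar> / (ls \<mu> a * ls \<mu> b)"
    using pos[of a] pos[of b] by (simp add: abs_mult)
  also have "\<dots> \<le> (4 * R ^ N * \<bar>\<mu>\<bar> ^ N) / (c / 2 * (c / 2))"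
  proof (rule frac_le)
    show "\<bar>ls \<mu> b - ls \<mu> a\<bar> \<le> 4 * R ^ N * \<bar>\<mu>\<bar> ^ N" by (rule width_bound[OF cop sg sym N gb \<mu>R])
    show "0 \<le> 4 * R ^ N * \<bar>\<mu>\<bar> ^ N" using gb by (simp add: geometric_bound_def)
    show "c / 2 * (c / 2) \<le> ls \<mu> a * ls \<mu> b" using c pos[of a] by (intro mult_mono ge) auto
  qed (use c in simp)
  finally show ?thesis
    using omega_bounds[OF ab] by (simp add: power_abs power2_eq_square field_simps)
qed

end

lemma width_bigo:
  fixes N :: nat and pz :: int
  assumes cop: "coprime pz (int N)" and sg: "sg = 1 \<or> sg = -1"
    and sym: "\<And>t. u (t + 2 * pi * pz / N) = sg * u t" and N: "N > 0"
  shows "(\<lambda>\<mu>. omega_max \<alpha> \<beta> p \<rho> \<Omega>\<^sub>0 u W \<mu> - omega_min \<alpha> \<beta> p \<rho> \<Omega>\<^sub>0 u W \<mu>) \<in> O[at 0](\<lambda>\<mu>. \<mu> ^ N)"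
proof -
  obtain R where gb: "geometric_bound R" using geometric_bound_ex by blast
  show ?thesis
  proof (rule bigoI[where c="16 * R ^ N / c^2"])
    show "\<forall>\<^sub>F \<mu> in at 0. norm (omega_max \<alpha> \<beta> p \<rho> \<Omega>\<^sub>0 u W \<mu> - omega_min \<alpha> \<beta> p \<rho> \<Omega>\<^sub>0 u W \<mu>)
        \<le> 16 * R ^ N / c^2 * norm (\<mu> ^ N)"
      unfolding eventually_at real_norm_def using locking_width[OF gb _ cop sg sym N] \<mu>_bound_pos(1)[OF gb]
      by (intro exI[of _ "\<mu>_bound R"]) (auto simp: dist_real_def)
  qed
qed

end

theorem mainTheorem1:
  fixes \<alpha> \<beta> T\<^sub>0 \<rho> \<Omega>\<^sub>0 :: real
    and p q :: nat
    and C :: "(real \<times> real) set"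
    and u\<^sub>0 :: "real \<Rightarrow> real"
    and W :: "real \<Rightarrow> real^2^2"
  assumes "\<alpha> > \<beta>" and "\<beta> > 1"
    and "p > 0" and "q > 0" and "coprime p q"
    and "\<rho> = real p / real q"
    and "limit_cycle \<alpha> \<beta> T\<^sub>0 C"
    and "\<Omega>\<^sub>0 = 2 * pi / T\<^sub>0"
    and "solves_ode2 (\<lambda>\<tau> x dx ddx. ddx + f_fun \<beta> \<rho> \<Omega>\<^sub>0 x * dx + g_fun \<alpha> \<beta> \<rho> \<Omega>\<^sub>0 x) u\<^sub>0"
    and "\<forall>\<tau>. (u\<^sub>0 \<tau>, \<rho> * \<Omega>\<^sub>0 * deriv u\<^sub>0 \<tau>) \<in> C"
    and "periodic_fun_simple u\<^sub>0 (2 * pi * \<rho>)"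
    and "deriv u\<^sub>0 0 = 0" and "u\<^sub>0 0 > 0"
    and "fundamental_matrix (linearization \<alpha> \<beta> \<rho> \<Omega>\<^sub>0 u\<^sub>0) W"
  shows "\<exists>\<mu>\<^sub>0>0.
    (\<forall>\<mu>. \<bar>\<mu>\<bar> < \<mu>\<^sub>0 \<longrightarrow>
      (\<forall>\<tau>\<^sub>0.
         summable (\<lambda>k. \<mu> ^ Suc k * D_coeff \<alpha> \<beta> p \<rho> \<Omega>\<^sub>0 u\<^sub>0 W (Suc k) \<tau>\<^sub>0) \<and>
         (\<forall>\<tau>. summable (\<lambda>k. \<mu> ^ Suc k * u_coeff \<alpha> \<beta> p \<rho> \<Omega>\<^sub>0 u\<^sub>0 W (Suc k) \<tau>\<^sub>0 \<tau>)) \<and>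
         periodic_fun_simple (u_series \<alpha> \<beta> p \<rho> \<Omega>\<^sub>0 u\<^sub>0 W \<tau>\<^sub>0 \<mu>) (2 * pi * real p) \<and>
         (\<exists>\<omega>>0. 1 / \<omega> = 1 / (\<rho> * \<Omega>\<^sub>0) + D_series \<alpha> \<beta> p \<rho> \<Omega>\<^sub>0 u\<^sub>0 W \<tau>\<^sub>0 \<mu> \<and>
            solves_driven \<alpha> \<beta> \<tau>\<^sub>0 \<omega> \<mu> (u_series \<alpha> \<beta> p \<rho> \<Omega>\<^sub>0 u\<^sub>0 W \<tau>\<^sub>0 \<mu>))) \<and>
      (\<exists>s\<in>{0..2 * pi}. \<forall>t\<in>{0..2 * pi}.
         D_series \<alpha> \<beta> p \<rho> \<Omega>\<^sub>0 u\<^sub>0 W t \<mu> \<le> D_series \<alpha> \<beta> p \<rho> \<Omega>\<^sub>0 u\<^sub>0 W s \<mu>) \<and>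
      (\<exists>s\<in>{0..2 * pi}. \<forall>t\<in>{0..2 * pi}.
         D_series \<alpha> \<beta> p \<rho> \<Omega>\<^sub>0 u\<^sub>0 W s \<mu> \<le> D_series \<alpha> \<beta> p \<rho> \<Omega>\<^sub>0 u\<^sub>0 W t \<mu>) \<and>
      (\<forall>\<omega>. omega_min \<alpha> \<beta> p \<rho> \<Omega>\<^sub>0 u\<^sub>0 W \<mu> \<le> \<omega> \<and> \<omega> \<le> omega_max \<alpha> \<beta> p \<rho> \<Omega>\<^sub>0 u\<^sub>0 W \<mu> \<longrightarrow>
         (\<exists>\<tau>\<^sub>0\<in>{0..2 * pi}. \<exists>u.
            solves_driven \<alpha> \<beta> \<tau>\<^sub>0 \<omega> \<mu> u \<and> periodic_fun_simple u (2 * pi * real p) \<and>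
            \<not> u constant_on UNIV))) \<and>
    (even p \<longrightarrow>
       (\<lambda>\<mu>. omega_max \<alpha> \<beta> p \<rho> \<Omega>\<^sub>0 u\<^sub>0 W \<mu> - omega_min \<alpha> \<beta> p \<rho> \<Omega>\<^sub>0 u\<^sub>0 W \<mu>) \<in> O[at 0](\<lambda>\<mu>. \<mu> ^ q)) \<and>
    (odd p \<longrightarrow>
       (\<lambda>\<mu>. omega_max \<alpha> \<beta> p \<rho> \<Omega>\<^sub>0 u\<^sub>0 W \<mu> - omega_min \<alpha> \<beta> p \<rho> \<Omega>\<^sub>0 u\<^sub>0 W \<mu>) \<in> O[at 0](\<lambda>\<mu>. \<mu> ^ (2 * q)))"
proof -
  obtain x where x: "solves_ode2 (\<lambda>t u du ddu. ddu + h_fun \<beta> u * du + k_fun \<alpha> \<beta> u) x"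
    and T: "T\<^sub>0 > 0" "periodic_fun_simple x T\<^sub>0" "\<And>s. 0 < s \<Longrightarrow> s < T\<^sub>0 \<Longrightarrow> \<not> periodic_fun_simple x s"
    and C: "C = range (\<lambda>t. (x t, deriv x t))"
    using assms(7) unfolding limit_cycle_def closed_orbit_def by blast
  have \<rho>: "\<rho> > 0" and \<Omega>: "\<Omega>\<^sub>0 > 0" using assms(3,4,6,8) T by auto
  define c where "c = 1 / (\<rho> * \<Omega>\<^sub>0)"
  define P where "P = 2 * pi * \<rho>"
  define v where "v = deriv u\<^sub>0"
  have c: "c > 0" and P: "P > 0" using \<rho> \<Omega> by (auto simp: c_def P_def)
  have cP: "c * P = T\<^sub>0" using \<rho> T(1) by (simp add: c_def P_def assms(8))
  have ode: "lienard c \<alpha> \<beta> u\<^sub>0 v"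
    unfolding lienard_def
  proof (intro conjI allI)
    fix t
    show "(u\<^sub>0 has_real_derivative v t) (at t)"
      using assms(9) by (simp add: solves_ode2_def v_def DERIV_deriv_iff_real_differentiable)
    have "f_fun \<beta> \<rho> \<Omega>\<^sub>0 (u\<^sub>0 t) = c * h_fun \<beta> (u\<^sub>0 t)" "g_fun \<alpha> \<beta> \<rho> \<Omega>\<^sub>0 (u\<^sub>0 t) = c^2 * k_fun \<alpha> \<beta> (u\<^sub>0 t)"
      by (simp_all add: f_fun_def g_fun_def c_def power_divide power_mult_distrib)
    moreover have "deriv v t + f_fun \<beta> \<rho> \<Omega>\<^sub>0 (u\<^sub>0 t) * v t + g_fun \<alpha> \<beta> \<rho> \<Omega>\<^sub>0 (u\<^sub>0 t) = 0"
      using assms(9) by (simp add: solves_ode2_def v_def)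
    ultimately have "deriv v t + c * h_fun \<beta> (u\<^sub>0 t) * v t + c^2 * k_fun \<alpha> \<beta> (u\<^sub>0 t) = 0"
      by (simp only:)
    then have "deriv v t = - (c * h_fun \<beta> (u\<^sub>0 t) * v t + c^2 * k_fun \<alpha> \<beta> (u\<^sub>0 t))" by linarith
    moreover have "(v has_real_derivative deriv v t) (at t)"
      using assms(9) by (simp add: solves_ode2_def v_def DERIV_deriv_iff_real_differentiable)
    ultimately show "(v has_real_derivative - (c * h_fun \<beta> (u\<^sub>0 t) * v t + c^2 * k_fun \<alpha> \<beta> (u\<^sub>0 t))) (at t)" by simp
  qed
  interpret driven \<alpha> \<beta> c P u\<^sub>0 v \<rho> \<Omega>\<^sub>0 p q W
    by unfold_locales
      (use assms c P ode in \<open>auto simp: c_def P_def v_def periodic_fun_simple_iff\<close>)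
  \<comment> \<open>Both u0 and the rescaled x solve the same equation and share a point of C, so u0
    is x with time scaled by c and translated. A period s < P of u0 would be a period c s < T0 of
    x.\<close>
  have minimal: "\<exists>t. u\<^sub>0 (t + s) \<noteq> u\<^sub>0 t" if s: "0 < s" "s < P" for s
  proof (rule ccontr)
    assume "\<nexists>t. u\<^sub>0 (t + s) \<noteq> u\<^sub>0 t"
    then have pers: "u\<^sub>0 (t + s) = u\<^sub>0 t" for t by blast
    have dx: "(x has_real_derivative deriv x t) (at t)"
      "(deriv x has_real_derivative - (h_fun \<beta> (x t) * deriv x t + k_fun \<alpha> \<beta> (x t))) (at t)" for t
    proof -
      show "(x has_real_derivative deriv x t) (at t)"
        using x by (simp add: solves_ode2_def DERIV_deriv_iff_real_differentiable)
      have "deriv (deriv x) t + h_fun \<beta> (x t) * deriv x t + k_fun \<alpha> \<beta> (x t) = 0"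
        using x by (simp add: solves_ode2_def)
      then have "deriv (deriv x) t = - (h_fun \<beta> (x t) * deriv x t + k_fun \<alpha> \<beta> (x t))" by linarith
      moreover have "(deriv x has_real_derivative deriv (deriv x) t) (at t)"
        using x by (simp add: solves_ode2_def DERIV_deriv_iff_real_differentiable)
      ultimately show "(deriv x has_real_derivative - (h_fun \<beta> (x t) * deriv x t + k_fun \<alpha> \<beta> (x t))) (at t)" by simp
    qed
    have px: "x (t + T\<^sub>0) = x t" "deriv x (t + T\<^sub>0) = deriv x t" for t
      using T(2) periodic_deriv[OF dx(1), of T\<^sub>0 1 t] by (auto simp: periodic_fun_simple_iff)
    obtain K1 where K1: "\<And>t. \<bar>x t\<bar> \<le> K1"
      using periodic_bounded[of x T\<^sub>0] px(1) T(1) derivs_imp_cont[OF dx(1)] by metis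
    obtain K2 where K2: "\<And>t. \<bar>deriv x t\<bar> \<le> K2"
      using periodic_bounded[of "deriv x" T\<^sub>0] px(2) T(1) derivs_imp_cont[OF dx(2)] by metis
    obtain K3 where K3: "K3 > 0" "\<And>t. \<bar>u\<^sub>0 t\<bar> \<le> K3" "\<And>t. \<bar>v t\<bar> \<le> K3" using bounded_uv by blast
    obtain t1 where t1: "u\<^sub>0 0 = x t1" "\<rho> * \<Omega>\<^sub>0 * deriv u\<^sub>0 0 = deriv x t1"
      using assms(10) unfolding C by blast
    have v1: "v 0 = c * deriv x (c * 0 + t1)"
      using t1(2) \<rho> \<Omega> by (simp add: v_def c_def assms(12))
    have lin: "((\<lambda>t. c * t + t1) has_real_derivative c) (at t)" for t
      by (auto intro!: derivative_eq_intros)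
    have y: "lienard c \<alpha> \<beta> (\<lambda>t. x (c * t + t1)) (\<lambda>t. c * deriv x (c * t + t1))"
      unfolding lienard_def
    proof (intro conjI allI)
      fix t
      show "((\<lambda>t. x (c * t + t1)) has_real_derivative c * deriv x (c * t + t1)) (at t)"
        using DERIV_chain2[OF dx(1) lin[of t]] by (simp add: mult.commute)
      show "((\<lambda>t. c * deriv x (c * t + t1)) has_real_derivative
          - (c * h_fun \<beta> (x (c * t + t1)) * (c * deriv x (c * t + t1)) + c^2 * k_fun \<alpha> \<beta> (x (c * t + t1)))) (at t)"
        using DERIV_cmult[OF DERIV_chain2[OF dx(2) lin[of t]], of c]
        by (simp add: algebra_simps power2_eq_square)
    qed
    define M where "M = K3 + K1 + c * K2"
    have nn: "K1 \<ge> 0" "c * K2 \<ge> 0" using K1[of 0] K2[of 0] c by auto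
    have ux: "u\<^sub>0 t = x (c * t + t1)" for t
    proof -
      have "u\<^sub>0 t = x (c * t + t1) \<and> v t = c * deriv x (c * t + t1)"
      proof (rule lienard_unique[OF ode y, where M=M and ?t0.0=0])
        show "\<bar>u\<^sub>0 t\<bar> \<le> M" "\<bar>v t\<bar> \<le> M" for t using K3(2)[of t] K3(3)[of t] nn by (auto simp: M_def)
        show "\<bar>x (c * t + t1)\<bar> \<le> M" for t using K1[of "c * t + t1"] K3(1) nn by (simp add: M_def)
        have "\<bar>c * deriv x z\<bar> \<le> c * K2" for z using K2[of z] c by (simp add: abs_mult)
        then show "\<bar>c * deriv x (c * t + t1)\<bar> \<le> M" for t using K3(1) nn by (smt (verit) M_def)
      qed (use t1 v1 in auto)
      then show ?thesis ..
    qed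
    have "x (z + c * s) = x z" for z
    proof -
      have "c * ((z - t1) / c + s) + t1 = z + c * s" "c * ((z - t1) / c) + t1 = z"
        using c by (simp_all add: distrib_left)
      then show ?thesis using pers[of "(z - t1) / c"] unfolding ux by (simp only:)
    qed
    then have "periodic_fun_simple x (c * s)" by (simp add: periodic_fun_simple_iff)
    moreover have "0 < c * s" "c * s < T\<^sub>0" using s c unfolding cP[symmetric] by auto
    ultimately show False using T(3) by blast
  qed
  obtain R where gb: "geometric_bound R" using geometric_bound_ex by blast
  show ?thesis
  proof (rule exI[of _ "\<mu>_bound R"], intro conjI allI impI)
    show "\<mu>_bound R > 0" by (rule \<mu>_bound_pos(1)[OF gb])
    have cop: "coprime (int p) (int q)" using assms(5) by simp
    show "(\<lambda>\<mu>. omega_max \<alpha> \<beta> p \<rho> \<Omega>\<^sub>0 u\<^sub>0 W \<mu> - omega_min \<alpha> \<beta> p \<rho> \<Omega>\<^sub>0 u\<^sub>0 W \<mu>) \<in> O[at 0](\<lambda>\<mu>. \<mu> ^ q)"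
    \<comment> \<open>The shift 2 pi p/q is the full orbit period P.\<close>
    proof (rule width_bigo[OF cop, of 1])
      show "u\<^sub>0 (t + 2 * pi * real_of_int (int p) / real q) = 1 * u\<^sub>0 t" for t
        using per[of t] by (simp add: P_def assms(6))
    qed (use assms(4) in auto)
    show "(\<lambda>\<mu>. omega_max \<alpha> \<beta> p \<rho> \<Omega>\<^sub>0 u\<^sub>0 W \<mu> - omega_min \<alpha> \<beta> p \<rho> \<Omega>\<^sub>0 u\<^sub>0 W \<mu>) \<in> O[at 0](\<lambda>\<mu>. \<mu> ^ (2 * q))"
      if "odd p"
    \<comment> \<open>The shift 2 pi p/(2q) is the half period P/2, under which u0 changes
      sign.\<close>
    proof (rule width_bigo[where sg="-1"])
      show "coprime (int p) (int (2 * q))" using cop that by simp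
      show "u\<^sub>0 (t + 2 * pi * real_of_int (int p) / real (2 * q)) = - 1 * u\<^sub>0 t" for t
        using half_period_antisymmetry[OF minimal, of t] by (simp add: P_def assms(6))
    qed (use assms(4) in auto)
    fix \<mu> assume \<mu>: "\<bar>\<mu>\<bar> < \<mu>_bound R"
    note m = \<mu>_bound_pos(2)[OF gb \<mu>]
    show "summable (\<lambda>k. \<mu> ^ Suc k * D_coeff \<alpha> \<beta> p \<rho> \<Omega>\<^sub>0 u\<^sub>0 W (Suc k) \<tau>\<^sub>0)" for \<tau>\<^sub>0
      by (rule D_series_eq(1)[OF gb m])
    show "summable (\<lambda>k. \<mu> ^ Suc k * u_coeff \<alpha> \<beta> p \<rho> \<Omega>\<^sub>0 u\<^sub>0 W (Suc k) \<tau>\<^sub>0 \<tau>)" for \<tau>\<^sub>0 \<tau>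
      by (rule u_series_eq(1)[OF gb m])
    have us: "u_series \<alpha> \<beta> p \<rho> \<Omega>\<^sub>0 u\<^sub>0 W \<tau>\<^sub>0 \<mu> = us \<mu> \<tau>\<^sub>0" for \<tau>\<^sub>0
      using u_series_eq(2)[OF gb m] by blast
    show "periodic_fun_simple (u_series \<alpha> \<beta> p \<rho> \<Omega>\<^sub>0 u\<^sub>0 W \<tau>\<^sub>0 \<mu>) (2 * pi * real p)" for \<tau>\<^sub>0
      unfolding us periodic_fun_simple_iff using series_solution(4)[OF gb m] by blast
    show "\<exists>\<omega>>0. 1 / \<omega> = 1 / (\<rho> * \<Omega>\<^sub>0) + D_series \<alpha> \<beta> p \<rho> \<Omega>\<^sub>0 u\<^sub>0 W \<tau>\<^sub>0 \<mu> \<and>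
            solves_driven \<alpha> \<beta> \<tau>\<^sub>0 \<omega> \<mu> (u_series \<alpha> \<beta> p \<rho> \<Omega>\<^sub>0 u\<^sub>0 W \<tau>\<^sub>0 \<mu>)" for \<tau>\<^sub>0
    proof (intro exI[of _ "1 / ls \<mu> \<tau>\<^sub>0"] conjI)
      show "1 / ls \<mu> \<tau>\<^sub>0 > 0" using \<mu>_bound_pos(3)[OF gb \<mu>, of \<tau>\<^sub>0] c by auto
      show "1 / (1 / ls \<mu> \<tau>\<^sub>0) = 1 / (\<rho> * \<Omega>\<^sub>0) + D_series \<alpha> \<beta> p \<rho> \<Omega>\<^sub>0 u\<^sub>0 W \<tau>\<^sub>0 \<mu>"
        unfolding D_series_eq(2)[OF gb m] by (simp add: c_def)
      show "solves_driven \<alpha> \<beta> \<tau>\<^sub>0 (1 / ls \<mu> \<tau>\<^sub>0) \<mu> (u_series \<alpha> \<beta> p \<rho> \<Omega>\<^sub>0 u\<^sub>0 W \<tau>\<^sub>0 \<mu>)"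
        unfolding us by (rule us_solves_driven[OF gb m]) simp
    qed
    show "\<exists>s\<in>{0..2 * pi}. \<forall>t\<in>{0..2 * pi}.
         D_series \<alpha> \<beta> p \<rho> \<Omega>\<^sub>0 u\<^sub>0 W t \<mu> \<le> D_series \<alpha> \<beta> p \<rho> \<Omega>\<^sub>0 u\<^sub>0 W s \<mu>"
      by (rule D_extrema[OF gb \<mu>]) blast
    show "\<exists>s\<in>{0..2 * pi}. \<forall>t\<in>{0..2 * pi}.
         D_series \<alpha> \<beta> p \<rho> \<Omega>\<^sub>0 u\<^sub>0 W s \<mu> \<le> D_series \<alpha> \<beta> p \<rho> \<Omega>\<^sub>0 u\<^sub>0 W t \<mu>"
      by (rule D_extrema[OF gb \<mu>]) blast
    show "\<exists>\<tau>\<^sub>0\<in>{0..2 * pi}. \<exists>u.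
            solves_driven \<alpha> \<beta> \<tau>\<^sub>0 \<omega> \<mu> u \<and> periodic_fun_simple u (2 * pi * real p) \<and> \<not> u constant_on UNIV"
      if "omega_min \<alpha> \<beta> p \<rho> \<Omega>\<^sub>0 u\<^sub>0 W \<mu> \<le> \<omega> \<and> \<omega> \<le> omega_max \<alpha> \<beta> p \<rho> \<Omega>\<^sub>0 u\<^sub>0 W \<mu>" for \<omega>
      using locked_solution[OF gb \<mu>] that by blast
  qed
qed

end
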